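(* Let $p\in C^1([0,1];(0,+\infty))$, $r\in C^0([0,1];(0,+\infty))$, $q\in C^0([0,1];\mathbb{R})$ and let $a_1,a_2,b_1,b_2$ be real constants with $|a_1|+|a_2|>0$, $|b_1|+|b_2|>0$. Let $A:D\to L^2_r([0,1])$ be the associated Sturm-Liouville operator, with eigenvalues $\lambda_1<\lambda_2<\dots$ and orthonormal eigenfunctions $\phi_1,\phi_2,\dots$, and suppose that $\sum_{n=N}^{\infty}\lambda_n^{-1}\max_{0\le z\le 1}(|\phi_n(z)|)<+\infty$ for certain $N>0$ with $\lambda_N>0$. Let $m\ge 1$ be an integer so that $\lambda_{m+1}>0$. Let $k=(k_1,\dots,k_m)'\in\mathbb{R}^m$ be a vector for which the matrix $\mathrm{diag}(-\lambda_1,\dots,-\lambda_m)+gk'$ is Hurwitz, where $g=(g_1,\dots,g_m)'\in\mathbb{R}^m$ and $$g_n:=\frac{p(1)}{a_1^2+a_2^2}\left(a_2\phi_n(1)-a_1\frac{d\phi_n}{dz}(1)\right)\neq 0\quad\text{for } n=1,\dots,m.$$ Then there exist constants $G,c,T>0$ such that for every increasing sequence $\{\tau_i\ge 0,\ i=0,1,2,\dots\}$ with $\tau_0=0$, $\sup_{i\ge 0}(\tau_{i+1}-\tau_i)\le T$, $\lim_{i\to+\infty}\tau_i=+\infty$ and for every $x_0\in L^2_r([0,1])$, the unique function $x:\mathbb{R}_+\times[0,1]\to\mathbb{R}$ for which the mapping $\mathbb{R}_+\ni t\mapsto x[t]\in L^2_r([0,1])$ is continuous, with $x\in C^1(I\times[0,1])$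 where $I=\mathbb{R}_+\setminus\{\tau_i,\ i=0,1,2,\dots\}$, satisfying $x[t]\in C^2([0,1])$ for all $t>0$, $x(0,z)=x_0(z)$ for all $z\in[0,1]$, $$\frac{\partial x}{\partial t}(t,z)-\frac{1}{r(z)}\frac{\partial}{\partial z}\left(p(z)\frac{\partial x}{\partial z}(t,z)\right)+\frac{q(z)}{r(z)}x(t,z)=0,\quad\text{for all }(t,z)\in I\times(0,1),$$ $$b_1x(t,0)+b_2\frac{\partial x}{\partial z}(t,0)=a_1x(t,1)+a_2\frac{\partial x}{\partial z}(t,1)-u(t)=0,\quad\text{for all }t\in I,$$ and $$u(t)=\int_0^1 r(z)\left(\sum_{l=1}^m k_l\phi_l(z)\right)x(\tau_i,z)\,dz,\quad\text{for }t\in[\tau_i,\tau_{i+1})\text{ and for all integers } i\ge 0,$$ satisfies the estimate $$\|x[t]\|_r\le G\exp(-ct)\|x_0\|_r,\quad\text{for all }t\ge 0.$$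
   Context: Notation: $\mathbb{R}_+=[0,+\infty)$; a prime on a vector denotes transpose; $x[t]$ denotes the profile $z\mapsto x(t,z)$. For $r\in C^0([0,1];(0,+\infty))$, $L^2_r([0,1])$ is the Hilbert space of (equivalence classes of) measurable functions $f:[0,1]\to\mathbb{R}$ with $\|f\|_r=\left(\int_0^1 r(z)|f(z)|^2dz\right)^{1/2}<+\infty$, with inner product $\langle f,g\rangle=\int_0^1 r(z)f(z)g(z)\,dz$. $H^2(0,1)$ is the Sobolev space of continuously differentiable functions on $[0,1]$ with measurable, square integrable second derivative. The Sturm-Liouville operator $A:D\to L^2_r([0,1])$ associated with $p,r,q,a_1,a_2,b_1,b_2$ is $$(Af)(z)=-\frac{1}{r(z)}\frac{d}{dz}\left(p(z)\frac{df}{dz}(z)\right)+\frac{q(z)}{r(z)}f(z),$$ where $D$ is the set of all $f\in H^2(0,1)$ with $b_1f(0)+b_2\frac{df}{dz}(0)=a_1f(1)+a_2\frac{df}{dz}(1)=0$. It is known that all eigenvalues of $A$ are real and form an infinite increasing sequence $\lambda_1<\lambda_2<\dots<\lambda_n<\dots$ with $\lim_{n\to\infty}\lambda_n=+\infty$; to each $\lambda_n$ corresponds exactly one (normalized, up to sign) eigenfunction $\phi_n\in C^2([0,1];\mathbb{R})$ with $A\phi_n=\lambda_n\phi_n$ and $b_1\phi_n(0)+b_2\frac{d\phi_n}{dz}(0)=a_1\phi_n(1)+a_2\frac{d\phi_n}{dz}(1)=0$; and the $\phi_n$ form an orthonormal basis of $L^2_r([0,1])$. *)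

theory Defs
  imports "HOL-Analysis.Analysis" "Jordan_Normal_Form.Char_Poly"
begin

text \<open>
  Functions on \<open>[0,1]\<close> are total functions \<open>real \<Rightarrow> real\<close> of which only the values on
  \<open>{0..1}\<close> are used; derivatives on \<open>[0,1]\<close> are therefore taken within \<open>{0..1}\<close>, which makes
  them one-sided at the two end points.
\<close>

abbreviation dz :: "(real \<Rightarrow> real) \<Rightarrow> real \<Rightarrow> real" where
  "dz f z \<equiv> vector_derivative f (at z within {0..1})"

definition C1_unit :: "(real \<Rightarrow> real) \<Rightarrow> bool" where
  "C1_unit f \<longleftrightarrow>
     (\<exists>f'. continuous_on {0..1} f' \<and>
           (\<forall>z\<in>{0..1}. (f has_vector_derivative f' z) (at z within {0..1})))"

definition C2_unit :: "(real \<Rightarrow> real) \<Rightarrow> bool" where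
  "C2_unit f \<longleftrightarrow>
     (\<exists>f'. C1_unit f' \<and>
           (\<forall>z\<in>{0..1}. (f has_vector_derivative f' z) (at z within {0..1})))"

definition C1_on :: "'a::real_normed_vector set \<Rightarrow> ('a \<Rightarrow> 'b::real_normed_vector) \<Rightarrow> bool" where
  "C1_on S f \<longleftrightarrow>
     (\<exists>D :: 'a \<Rightarrow> 'a \<Rightarrow>\<^sub>L 'b. continuous_on S D \<and>
           (\<forall>s\<in>S. (f has_derivative blinfun_apply (D s)) (at s within S)))"

text \<open>
  \<open>L2 r\<close> consists of functions, not of equivalence classes: \<open>l2_norm r\<close> is only a seminorm on it,
  and equality in the Hilbert space is equality almost everywhere on \<open>[0,1]\<close>.
\<close>

definition L2 :: "(real \<Rightarrow> real) \<Rightarrow> (real \<Rightarrow> real) set" where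
  "L2 r = {f. f \<in> borel_measurable (lebesgue_on {0..1}) \<and>
              integrable (lebesgue_on {0..1}) (\<lambda>z. r z * (f z)\<^sup>2)}"

definition l2_norm :: "(real \<Rightarrow> real) \<Rightarrow> (real \<Rightarrow> real) \<Rightarrow> real" where
  "l2_norm r f = sqrt (LINT z|lebesgue_on {0..1}. r z * (f z)\<^sup>2)"

definition l2_inner :: "(real \<Rightarrow> real) \<Rightarrow> (real \<Rightarrow> real) \<Rightarrow> (real \<Rightarrow> real) \<Rightarrow> real" where
  "l2_inner r f g = (LINT z|lebesgue_on {0..1}. r z * f z * g z)"

text \<open>
  A function is in \<open>H2_unit\<close> if it is continuously differentiable and its derivative is an
  indefinite Lebesgue integral of a square integrable \<open>h\<close>, the (weak, almost everywhere defined)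
  second derivative.  Mere almost everywhere differentiability of \<open>f'\<close> would not be enough
  (Cantor function).
\<close>

definition H2_unit :: "(real \<Rightarrow> real) \<Rightarrow> bool" where
  "H2_unit f \<longleftrightarrow> C1_unit f \<and>
     (\<exists>h\<in>L2 (\<lambda>_. 1). \<forall>z\<in>{0..1}. dz f z = dz f 0 + (LINT y|lebesgue_on {0..z}. h y))"

definition SL_bc :: "real \<Rightarrow> real \<Rightarrow> real \<Rightarrow> real \<Rightarrow> (real \<Rightarrow> real) \<Rightarrow> bool" where
  "SL_bc a1 a2 b1 b2 f \<longleftrightarrow>
     b1 * f 0 + b2 * dz f 0 = 0 \<and> a1 * f 1 + a2 * dz f 1 = 0"

definition SL_domain :: "real \<Rightarrow> real \<Rightarrow> real \<Rightarrow> real \<Rightarrow> (real \<Rightarrow> real) set" where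
  "SL_domain a1 a2 b1 b2 = {f. H2_unit f \<and> SL_bc a1 a2 b1 b2 f}"

text \<open>
  For \<open>f\<close> in the domain the outer derivative exists for almost every \<open>z\<close>, so \<open>SL_op p r q f\<close> is
  meaningful as an element of \<open>L2 r\<close>.
\<close>

definition SL_op :: "(real \<Rightarrow> real) \<Rightarrow> (real \<Rightarrow> real) \<Rightarrow> (real \<Rightarrow> real) \<Rightarrow> (real \<Rightarrow> real) \<Rightarrow> real \<Rightarrow> real" where
  "SL_op p r q f z = - (1 / r z) * dz (\<lambda>y. p y * dz f y) z + q z / r z * f z"

definition SL_eigenvalue :: "(real \<Rightarrow> real) \<Rightarrow> (real \<Rightarrow> real) \<Rightarrow> (real \<Rightarrow> real) \<Rightarrow>
    real \<Rightarrow> real \<Rightarrow> real \<Rightarrow> real \<Rightarrow> real \<Rightarrow> bool" where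
  "SL_eigenvalue p r q a1 a2 b1 b2 \<mu> \<longleftrightarrow>
     (\<exists>f\<in>SL_domain a1 a2 b1 b2.
        \<not> (AE z in lebesgue_on {0..1}. f z = 0) \<and>
        (AE z in lebesgue_on {0..1}. SL_op p r q f z = \<mu> * f z))"

text \<open>
  \<open>lam 1 < lam 2 < \<dots>\<close> is the list of all eigenvalues and \<open>phi 1, phi 2, \<dots>\<close> are corresponding
  orthonormal eigenfunctions; index \<open>0\<close> is not used.  That \<open>lam\<close> tends to infinity, that
  eigenspaces are one-dimensional and that \<open>phi\<close> is a complete system are theorems of
  Sturm-Liouville theory and hence not part of the definition.
\<close>

definition SL_eigensystem :: "(real \<Rightarrow> real) \<Rightarrow> (real \<Rightarrow> real) \<Rightarrow> (real \<Rightarrow> real) \<Rightarrow>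
    real \<Rightarrow> real \<Rightarrow> real \<Rightarrow> real \<Rightarrow> (nat \<Rightarrow> real) \<Rightarrow> (nat \<Rightarrow> real \<Rightarrow> real) \<Rightarrow> bool" where
  "SL_eigensystem p r q a1 a2 b1 b2 lam phi \<longleftrightarrow>
     strict_mono_on {1..} lam \<and>
     lam ` {1..} = {\<mu>. SL_eigenvalue p r q a1 a2 b1 b2 \<mu>} \<and>
     (\<forall>n\<ge>1. C2_unit (phi n) \<and> SL_bc a1 a2 b1 b2 (phi n) \<and>
             (\<forall>z\<in>{0..1}. SL_op p r q (phi n) z = lam n * phi n z)) \<and>
     (\<forall>i\<ge>1. \<forall>j\<ge>1. l2_inner r (phi i) (phi j) = (if i = j then 1 else 0))"

definition hurwitz :: "real mat \<Rightarrow> bool" where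
  "hurwitz M \<longleftrightarrow> (\<forall>e :: complex. eigenvalue (map_mat complex_of_real M) e \<longrightarrow> Re e < 0)"

text \<open>The matrix \<open>diag(-lam 1, \<dots>, -lam m) + g k'\<close>; matrix indices start at \<open>0\<close>.\<close>

definition closed_loop_matrix ::
    "nat \<Rightarrow> (nat \<Rightarrow> real) \<Rightarrow> (nat \<Rightarrow> real) \<Rightarrow> (nat \<Rightarrow> real) \<Rightarrow> real mat" where
  "closed_loop_matrix m lam g k =
     Matrix.mat m m (\<lambda>(i, j). (if i = j then - lam (Suc i) else 0) + g (Suc i) * k (Suc j))"

definition closed_loop_solution :: "(real \<Rightarrow> real) \<Rightarrow> (real \<Rightarrow> real) \<Rightarrow> (real \<Rightarrow> real) \<Rightarrow>
    real \<Rightarrow> real \<Rightarrow> real \<Rightarrow> real \<Rightarrow> (nat \<Rightarrow> real \<Rightarrow> real) \<Rightarrow> nat \<Rightarrow> (nat \<Rightarrow> real) \<Rightarrow>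
    (nat \<Rightarrow> real) \<Rightarrow> (real \<Rightarrow> real) \<Rightarrow> (real \<Rightarrow> real \<Rightarrow> real) \<Rightarrow> bool" where
  "closed_loop_solution p r q a1 a2 b1 b2 phi m k \<tau> x0 x \<longleftrightarrow>
     (let I = {0..} - range \<tau> in
       (\<forall>t\<ge>0. x t \<in> L2 r) \<and>
       (\<forall>t\<ge>0. ((\<lambda>s. l2_norm r (\<lambda>z. x s z - x t z)) \<longlongrightarrow> 0) (at t within {0..})) \<and>
       C1_on (I \<times> {0..1}) (\<lambda>(t, z). x t z) \<and>
       (\<forall>t>0. C2_unit (x t)) \<and>
       (\<forall>z\<in>{0..1}. x 0 z = x0 z) \<and>
       (\<forall>t\<in>I. \<forall>z\<in>{0<..<1}.
          deriv (\<lambda>s. x s z) t - 1 / r z * dz (\<lambda>y. p y * dz (x t) y) z + q z / r z * x t z = 0) \<and>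
       (\<exists>u :: real \<Rightarrow> real.
          (\<forall>t\<in>I. b1 * x t 0 + b2 * dz (x t) 0 = 0 \<and>
                  a1 * x t 1 + a2 * dz (x t) 1 - u t = 0) \<and>
          (\<forall>i. \<forall>t\<in>{\<tau> i..<\<tau> (Suc i)}.
             u t = (LINT z|lebesgue_on {0..1}. r z * (\<Sum>l=1..m. k l * phi l z) * x (\<tau> i) z))))"

end

theory Submission
  imports Defs "HOL-Complex_Analysis.Great_Picard" "Jordan_Normal_Form.Schur_Decomposition"
begin

text \<open>
  Completeness of the eigenfunctions: for \<open>\<mu> = lam 1 - 1\<close>, which is not an eigenvalue, the solution
  operator \<open>K\<close> of \<open>(A - \<mu>) F = f\<close> is self-adjoint and maps bounded sets to equicontinuous ones.  If
  some nonzero continuous \<open>f\<close> were orthogonal to all \<open>phi n\<close>, a maximising sequence for the norm of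
  \<open>K\<close> on the orthogonal complement would yield, by Arzela--Ascoli, an eigenfunction orthogonal to
  all \<open>phi n\<close>, which contradicts the simplicity of the eigenvalues.

  Choose \<open>B\<close> with boundary values 0 on the left and 1 on the right and
  \<open>A B = - (g 1 * phi 1 + \<dots> + g m * phi m)\<close>.  Under a constant input \<open>u\<close> the solution is \<open>u B\<close> plus a
  heat series, which the summability hypothesis and the factors \<open>exp (- lam n * s)\<close> make smooth for
  \<open>s > 0\<close>.  Its Fourier coefficients satisfy \<open>c' = - lam n * c + g n * u\<close>; conversely this equation
  determines the coefficients of every solution, whence uniqueness.

  Stability: the first \<open>m\<close> coefficients at the sampling times follow a perturbed Euler scheme of the
  Hurwitz matrix, which contracts a suitable norm when the sampling period is small, so the input
  decays exponentially.  The remaining modes are stable and are driven by \<open>g n * u\<close>, where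
  \<open>g n / lam n\<close> is square summable because it is the \<open>n\<close>-th coefficient of \<open>B\<close>.
\<close>

section \<open>The weighted square-integrable functions on the unit interval\<close>

text \<open>Of the spectral theory only the definition of an eigensystem is available, and the
  initial profile is merely square integrable. As the input is constant on each sampling interval,
  subtracting \<open>u * B\<close> leaves homogeneous boundary conditions and a time-independent
  source; no derivative of the input occurs. Taking that source in the span of the first
  \<open>m\<close> eigenfunctions, instead of lifting with \<open>A B = 0\<close>, covers the case
  that 0 is an eigenvalue: its index is then at most \<open>m\<close>, and the nonvanishing of its
  \<open>g\<close> gives solvability. The numbers \<open>g n\<close> themselves need not be square
  summable, so in the tail they appear only after an integration in time, which produces
  \<open>g n / lam n\<close>. States are functions rather than classes: the initial profile is kept
  as it is, even on null sets, and every later profile is continuous, so equality of all Fourier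
  coefficients gives equality at every point. Differential equations are treated as first-order
  systems for a function and its flux; all boundary terms then become Wronskians.\<close>

lemma bounded_on_unit:
  fixes g :: "real \<Rightarrow> real"
  assumes "continuous_on {0..1} g"
  shows "\<exists>B>0. \<forall>z\<in>{0..1}. \<bar>g z\<bar> \<le> B"
  using compact_imp_bounded[OF compact_continuous_image[OF assms]] by (auto simp: bounded_pos)

locale weight =
  fixes r :: "real \<Rightarrow> real"
  assumes r_cont: "continuous_on {0..1} r"
    and r_pos: "\<And>z. z \<in> {0..1} \<Longrightarrow> 0 < r z"
begin

abbreviation ip :: "(real \<Rightarrow> real) \<Rightarrow> (real \<Rightarrow> real) \<Rightarrow> real" where
  "ip \<equiv> l2_inner r"
abbreviation nrm :: "(real \<Rightarrow> real) \<Rightarrow> real" where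
  "nrm \<equiv> l2_norm r"

lemma continuous_borel_measurable [measurable_dest]:
  fixes f :: "real \<Rightarrow> real"
  assumes "continuous_on {0..1} f"
  shows "f \<in> borel_measurable (lebesgue_on {0..1})"
  using continuous_imp_integrable_real[OF assms] by (rule borel_measurable_integrable)

lemma r_measurable [measurable]: "r \<in> borel_measurable (lebesgue_on {0..1})"
  using r_cont by (rule continuous_borel_measurable)

lemma AE_unitI:
  assumes "\<And>z. z \<in> {0..1} \<Longrightarrow> P z"
  shows "AE z in lebesgue_on {0..1::real}. P z"
  by (rule AE_I2) (use assms in \<open>auto simp: space_restrict_space\<close>)

lemma L2_measurable: "f \<in> L2 r \<Longrightarrow> f \<in> borel_measurable (lebesgue_on {0..1})"
  by (simp add: L2_def)

lemma ip_integrable: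
  assumes "f \<in> L2 r" "g \<in> L2 r"
  shows "integrable (lebesgue_on {0..1}) (\<lambda>z. r z * f z * g z)"
proof (rule Bochner_Integration.integrable_bound)
  have [measurable]: "f \<in> borel_measurable (lebesgue_on {0..1})" "g \<in> borel_measurable (lebesgue_on {0..1})"
    using assms L2_measurable by auto
  show "(\<lambda>z. r z * f z * g z) \<in> borel_measurable (lebesgue_on {0..1})" by measurable
  show "integrable (lebesgue_on {0..1}) (\<lambda>z. r z * (f z)\<^sup>2 + r z * (g z)\<^sup>2)"
    using assms by (auto simp: L2_def)
  have "\<bar>r z * f z * g z\<bar> \<le> \<bar>r z * (f z)\<^sup>2 + r z * (g z)\<^sup>2\<bar>" if "z \<in> {0..1}" for z
  proof -
    have "2 * (\<bar>f z\<bar> * \<bar>g z\<bar>) \<le> (f z)\<^sup>2 + (g z)\<^sup>2"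
      using sum_squares_bound[of "\<bar>f z\<bar>" "\<bar>g z\<bar>"] by simp
    moreover have "0 \<le> \<bar>f z\<bar> * \<bar>g z\<bar>" by simp
    ultimately have "\<bar>f z\<bar> * \<bar>g z\<bar> \<le> (f z)\<^sup>2 + (g z)\<^sup>2" by linarith
    then have "r z * (\<bar>f z\<bar> * \<bar>g z\<bar>) \<le> r z * ((f z)\<^sup>2 + (g z)\<^sup>2)"
      using r_pos[OF that] by (intro mult_left_mono) auto
    then show ?thesis using r_pos[OF that] by (simp add: abs_mult algebra_simps)
  qed
  then show "AE z in lebesgue_on {0..1}. norm (r z * f z * g z) \<le> norm (r z * (f z)\<^sup>2 + r z * (g z)\<^sup>2)"
    by (intro AE_unitI) auto
qed

lemma L2_add:
  assumes "f \<in> L2 r" "g \<in> L2 r" shows "(\<lambda>z. f z + g z) \<in> L2 r"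
proof -
  have "integrable (lebesgue_on {0..1}) (\<lambda>z. r z * (f z)\<^sup>2 + 2 * (r z * f z * g z) + r z * (g z)\<^sup>2)"
    using ip_integrable[OF assms] assms by (auto simp: L2_def)
  moreover have "(\<lambda>z. r z * (f z)\<^sup>2 + 2 * (r z * f z * g z) + r z * (g z)\<^sup>2) = (\<lambda>z. r z * (f z + g z)\<^sup>2)"
    by (auto simp: power2_eq_square algebra_simps)
  ultimately show ?thesis using assms by (auto simp: L2_def)
qed

lemma L2_scale:
  assumes "f \<in> L2 r" shows "(\<lambda>z. c * f z) \<in> L2 r"
proof -
  have "integrable (lebesgue_on {0..1}) (\<lambda>z. c\<^sup>2 * (r z * (f z)\<^sup>2))"
    using assms by (auto simp: L2_def)
  moreover have "(\<lambda>z. c\<^sup>2 * (r z * (f z)\<^sup>2)) = (\<lambda>z. r z * (c * f z)\<^sup>2)"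
    by (auto simp: power2_eq_square algebra_simps)
  ultimately show ?thesis using assms by (auto simp: L2_def)
qed

lemma L2_diff:
  assumes "f \<in> L2 r" "g \<in> L2 r" shows "(\<lambda>z. f z - g z) \<in> L2 r"
  using L2_add[OF assms(1) L2_scale[OF assms(2), of "-1"]] by simp

lemma L2_cont: "continuous_on {0..1} f \<Longrightarrow> f \<in> L2 r"
  unfolding L2_def using r_cont
  by (auto intro!: continuous_borel_measurable continuous_imp_integrable_real continuous_intros)

lemma L2_sum:
  assumes "\<And>i. i \<in> S \<Longrightarrow> f i \<in> L2 r" shows "(\<lambda>z. \<Sum>i\<in>S. f i z) \<in> L2 r"
  using assms
proof (induction S rule: infinite_finite_induct)
  case (insert x F)
  then show ?case using L2_add[of "f x" "\<lambda>z. \<Sum>i\<in>F. f i z"] by auto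
qed (auto intro: L2_cont)

lemma ip_sym: "ip f g = ip g f"
  by (simp add: l2_inner_def ac_simps)

lemma ip_cong:
  assumes "\<And>z. z \<in> {0..1} \<Longrightarrow> f z = f' z" "\<And>z. z \<in> {0..1} \<Longrightarrow> g z = g' z"
  shows "ip f g = ip f' g'"
  unfolding l2_inner_def by (rule Bochner_Integration.integral_cong) (use assms in auto)

lemma nrm_cong:
  assumes "\<And>z. z \<in> {0..1} \<Longrightarrow> f z = f' z"
  shows "nrm f = nrm f'"
  unfolding l2_norm_def by (rule arg_cong[where f=sqrt], rule Bochner_Integration.integral_cong) (use assms in auto)

lemma ip_add_left:
  assumes "f \<in> L2 r" "g \<in> L2 r" "h \<in> L2 r"
  shows "ip (\<lambda>z. f z + g z) h = ip f h + ip g h"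
  unfolding l2_inner_def
  using Bochner_Integration.integral_add[OF ip_integrable[OF assms(1,3)] ip_integrable[OF assms(2,3)]]
  by (simp add: algebra_simps)

lemma ip_scale_left: "ip (\<lambda>z. c * f z) h = c * ip f h"
proof -
  have "(\<lambda>z. r z * (c * f z) * h z) = (\<lambda>z. c * (r z * f z * h z))" by auto
  then show ?thesis unfolding l2_inner_def by simp
qed

lemma ip_diff_left:
  assumes "f \<in> L2 r" "g \<in> L2 r" "h \<in> L2 r"
  shows "ip (\<lambda>z. f z - g z) h = ip f h - ip g h"
  using ip_add_left[OF assms(1) L2_scale[OF assms(2), of "-1"] assms(3)] ip_scale_left[of "-1" g h] by simp

lemma ip_sum_left:
  assumes "\<And>i. i \<in> S \<Longrightarrow> f i \<in> L2 r" "h \<in> L2 r"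
  shows "ip (\<lambda>z. \<Sum>i\<in>S. f i z) h = (\<Sum>i\<in>S. ip (f i) h)"
  using assms
proof (induction S rule: infinite_finite_induct)
  case (insert x F)
  then show ?case using ip_add_left[of "f x" "\<lambda>z. \<Sum>i\<in>F. f i z" h] L2_sum[of F f] by auto
qed (auto simp: l2_inner_def)

lemma ip_add_right:
  assumes "f \<in> L2 r" "g \<in> L2 r" "h \<in> L2 r"
  shows "ip h (\<lambda>z. f z + g z) = ip h f + ip h g"
  using ip_add_left[OF assms] by (simp add: ip_sym)

lemma ip_scale_right: "ip h (\<lambda>z. c * f z) = c * ip h f"
  using ip_scale_left by (simp add: ip_sym)

lemma ip_diff_right:
  assumes "f \<in> L2 r" "g \<in> L2 r" "h \<in> L2 r"
  shows "ip h (\<lambda>z. f z - g z) = ip h f - ip h g"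
  using ip_diff_left[OF assms] by (simp add: ip_sym)

lemma ip_sum_right:
  assumes "\<And>i. i \<in> S \<Longrightarrow> f i \<in> L2 r" "h \<in> L2 r"
  shows "ip h (\<lambda>z. \<Sum>i\<in>S. f i z) = (\<Sum>i\<in>S. ip h (f i))"
  using ip_sum_left[OF assms] by (simp add: ip_sym)

lemma ip_nonneg: "0 \<le> ip f f"
proof -
  have "0 \<le> (LINT z|lebesgue_on {0..1}. r z * (f z)\<^sup>2)"
    using r_pos by (intro integral_nonneg_AE AE_unitI) (auto simp: less_imp_le)
  then show ?thesis by (simp add: l2_inner_def power2_eq_square mult.assoc)
qed

lemma nrm_sq: "(nrm f)\<^sup>2 = ip f f"
  using ip_nonneg[of f] by (simp add: l2_inner_def l2_norm_def power2_eq_square mult.assoc)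

lemma nrm_nonneg: "0 \<le> nrm f"
  using ip_nonneg[of f] by (simp add: l2_inner_def l2_norm_def power2_eq_square mult.assoc)

lemma nrm_scale: "nrm (\<lambda>z. c * f z) = \<bar>c\<bar> * nrm f"
proof (rule power2_eq_imp_eq)
  show "(nrm (\<lambda>z. c * f z))\<^sup>2 = (\<bar>c\<bar> * nrm f)\<^sup>2"
    unfolding power_mult_distrib nrm_sq ip_scale_left ip_scale_right by (simp add: power2_eq_square)
qed (auto simp: nrm_nonneg)

lemma nrm_uminus: "nrm (\<lambda>z. - f z) = nrm f"
  using nrm_scale[of "-1" f] by simp

lemma nrm_diff_commute: "nrm (\<lambda>z. f z - g z) = nrm (\<lambda>z. g z - f z)"
  using nrm_uminus[of "\<lambda>z. f z - g z"] by simp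

lemma nrm_diff_sq:
  assumes "f \<in> L2 r" "g \<in> L2 r"
  shows "(nrm (\<lambda>z. f z - g z))\<^sup>2 = (nrm f)\<^sup>2 - 2 * ip f g + (nrm g)\<^sup>2"
  using assms by (simp add: nrm_sq ip_diff_left ip_diff_right L2_diff ip_sym[of g f])

lemma nrm_add_sq:
  assumes "f \<in> L2 r" "g \<in> L2 r"
  shows "(nrm (\<lambda>z. f z + g z))\<^sup>2 = (nrm f)\<^sup>2 + 2 * ip f g + (nrm g)\<^sup>2"
  using assms by (simp add: nrm_sq ip_add_left ip_add_right L2_add ip_sym[of g f])

text \<open>The form is only semidefinite on functions, so the discriminant argument for the
  nonnegative quadratic in \<open>t\<close> needs a separate case \<open>ip g g = 0\<close>.\<close>

lemma Cauchy_Schwarz: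
  assumes "f \<in> L2 r" "g \<in> L2 r"
  shows "\<bar>ip f g\<bar> \<le> nrm f * nrm g"
proof -
  have *: "0 \<le> ip f f + 2 * t * ip f g + t\<^sup>2 * ip g g" for t
  proof -
    have "0 \<le> (nrm (\<lambda>z. f z + t * g z))\<^sup>2" by simp
    also have "\<dots> = ip f f + 2 * t * ip f g + t\<^sup>2 * ip g g"
      by (simp add: nrm_add_sq[OF assms(1) L2_scale[OF assms(2)]] nrm_scale power_mult_distrib nrm_sq ip_scale_right)
    finally show ?thesis .
  qed
  have "(ip f g)\<^sup>2 \<le> ip f f * ip g g"
  proof (cases "ip g g = 0")
    case True
    have "ip f g = 0"
    proof (rule ccontr)
      assume "ip f g \<noteq> 0"
      \<comment> \<open>With a vanishing quadratic term the expression is affine in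
        \<open>t\<close>; this \<open>t\<close> would give it the value -1.\<close>
      then have "2 * (- (ip f f + 1) / (2 * ip f g)) * ip f g = - (ip f f + 1)" by simp
      with *[of "- (ip f f + 1) / (2 * ip f g)"] True show False by simp
    qed
    then show ?thesis using True by simp
  next
    case False
    then have pos: "ip g g > 0" using ip_nonneg[of g] by linarith
    have "0 \<le> ip f f + 2 * (- ip f g / ip g g) * ip f g + (- ip f g / ip g g)\<^sup>2 * ip g g" by (rule *)
    also have "\<dots> = ip f f - (ip f g)\<^sup>2 / ip g g"
      using False by (simp add: field_simps power2_eq_square)
    finally show ?thesis using pos by (simp add: field_simps)
  qed
  then have "\<bar>ip f g\<bar>\<^sup>2 \<le> (nrm f * nrm g)\<^sup>2" by (simp add: power_mult_distrib nrm_sq)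
  then show ?thesis by (rule power2_le_imp_le) (simp add: nrm_nonneg)
qed

lemma nrm_add_le:
  assumes "f \<in> L2 r" "g \<in> L2 r"
  shows "nrm (\<lambda>z. f z + g z) \<le> nrm f + nrm g"
proof (rule power2_le_imp_le)
  show "(nrm (\<lambda>z. f z + g z))\<^sup>2 \<le> (nrm f + nrm g)\<^sup>2"
    using Cauchy_Schwarz[OF assms] by (simp add: nrm_add_sq[OF assms] power2_sum abs_le_iff)
qed (simp add: nrm_nonneg)

lemma nrm_diff_triangle:
  assumes "f \<in> L2 r" "g \<in> L2 r" "h \<in> L2 r"
  shows "nrm (\<lambda>z. f z - h z) \<le> nrm (\<lambda>z. f z - g z) + nrm (\<lambda>z. g z - h z)"
  using nrm_add_le[OF L2_diff[OF assms(1,2)] L2_diff[OF assms(2,3)]] by simp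

lemma nrm_le_add_diff:
  assumes "f \<in> L2 r" "g \<in> L2 r"
  shows "nrm f \<le> nrm g + nrm (\<lambda>z. f z - g z)"
  using nrm_add_le[OF assms(2) L2_diff[OF assms(1,2)]] by simp

lemma nrm_zero [simp]: "nrm (\<lambda>z. 0) = 0"
  by (simp add: l2_norm_def)

text \<open>A continuous nonnegative function with integral zero vanishes identically. Here the
  seminorm becomes a norm, which is why continuity appears wherever pointwise equality is
  wanted.\<close>

lemma nrm_zeroD:
  assumes "continuous_on {0..1} f" "nrm f = 0" "z \<in> {0..1}"
  shows "f z = 0"
proof -
  have "ip f f = 0" using assms(2) nrm_sq[of f] by simp
  then have "(LINT z|lebesgue_on {0..1}. r z * (f z)\<^sup>2) = 0"
    by (simp add: l2_inner_def power2_eq_square mult.assoc)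
  moreover have "continuous_on {0..1} (\<lambda>z. r z * (f z)\<^sup>2)"
    using assms(1) r_cont by (intro continuous_intros)
  moreover have "0 \<le> r z * (f z)\<^sup>2" if "z \<in> {0..1}" for z
    using r_pos[OF that] by simp
  ultimately have "\<forall>z\<in>{0..1}. r z * (f z)\<^sup>2 = 0"
    using integralL_eq_0_iff[of 0 1 "\<lambda>z. r z * (f z)\<^sup>2"] by simp
  then show ?thesis using assms(3) r_pos[OF assms(3)] by force
qed

lemma nrm_le_sup:
  assumes "f \<in> L2 r" "\<And>z. z \<in> {0..1} \<Longrightarrow> \<bar>f z\<bar> \<le> B" "B \<ge> 0"
  shows "nrm f \<le> B * nrm (\<lambda>_. 1)"
proof -
  have "(LINT z|lebesgue_on {0..1}. r z * (f z)\<^sup>2) \<le> (LINT z|lebesgue_on {0..1}. r z * (B * 1)\<^sup>2)"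
  proof (rule integral_mono_AE)
    show "integrable (lebesgue_on {0..1}) (\<lambda>z. r z * (B * 1)\<^sup>2)"
      using L2_scale[OF L2_cont[of "\<lambda>_. 1"], of B] by (simp add: L2_def)
    have "r z * (f z)\<^sup>2 \<le> r z * (B * 1)\<^sup>2" if "z \<in> {0..1}" for z
      using r_pos[OF that] assms(2)[OF that] power_mono[of "\<bar>f z\<bar>" B 2] by simp
    then show "AE z in lebesgue_on {0..1}. r z * (f z)\<^sup>2 \<le> r z * (B * 1)\<^sup>2" by (rule AE_unitI)
  qed (use assms in \<open>auto simp: L2_def\<close>)
  then have "nrm f \<le> nrm (\<lambda>z. B * 1)" unfolding l2_norm_def by (rule real_sqrt_le_mono)
  also have "\<dots> = B * nrm (\<lambda>_. 1)" using nrm_scale[of B "\<lambda>_. 1"] assms(3) by simp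
  finally show ?thesis .
qed

lemma nrm_one_pos: "nrm (\<lambda>_. 1) > 0"
  using nrm_zeroD[of "\<lambda>_. 1" 0] nrm_nonneg[of "\<lambda>_. 1"] by fastforce

lemma uniform_limit_nrm:
  assumes "uniform_limit {0..1} f g sequentially"
    and "\<And>n. f n \<in> L2 r" "g \<in> L2 r"
  shows "(\<lambda>n. nrm (\<lambda>z. f n z - g z)) \<longlonglongrightarrow> 0"
proof (rule LIMSEQ_I)
  fix e :: real assume e: "e > 0"
  define d where "d = e / (2 * nrm (\<lambda>_. 1))"
  have d: "d > 0" using e nrm_one_pos by (simp add: d_def)
  have "\<forall>\<^sub>F n in sequentially. \<forall>z\<in>{0..1}. dist (f n z) (g z) < d"
    using assms(1) d by (rule uniform_limitD)
  then obtain N where N: "\<And>n. n \<ge> N \<Longrightarrow> \<forall>z\<in>{0..1}. dist (f n z) (g z) < d"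
    by (auto simp: eventually_sequentially)
  show "\<exists>no. \<forall>n\<ge>no. norm (nrm (\<lambda>z. f n z - g z) - 0) < e"
  proof (intro exI[of _ N] allI impI)
    fix n assume "n \<ge> N"
    then have "nrm (\<lambda>z. f n z - g z) \<le> d * nrm (\<lambda>_. 1)"
      using N[of n] d by (intro nrm_le_sup L2_diff assms) (auto simp: dist_real_def less_imp_le)
    also have "\<dots> < e" using nrm_one_pos e by (simp add: d_def)
    finally show "norm (nrm (\<lambda>z. f n z - g z) - 0) < e" by (simp add: nrm_nonneg)
  qed
qed

lemma ip_tendsto:
  assumes "((\<lambda>n. nrm (\<lambda>z. f n z - g z)) \<longlongrightarrow> 0) F"
    and "\<And>n. f n \<in> L2 r" "g \<in> L2 r" "h \<in> L2 r"
  shows "((\<lambda>n. ip (f n) h) \<longlongrightarrow> ip g h) F"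
proof (rule LIM_zero_cancel, rule Lim_null_comparison)
  show "\<forall>\<^sub>F n in F. norm (ip (f n) h - ip g h) \<le> nrm (\<lambda>z. f n z - g z) * nrm h"
    using Cauchy_Schwarz[OF L2_diff[OF assms(2,3)] assms(4)]
    by (intro always_eventually) (simp add: ip_diff_left assms)
  show "((\<lambda>n. nrm (\<lambda>z. f n z - g z) * nrm h) \<longlongrightarrow> 0) F"
    using tendsto_mult_right[OF assms(1), of "nrm h"] by simp
qed

lemma ip_continuous_eq:
  assumes "continuous_on {0..1} f" "continuous_on {0..1} g"
  shows "ip f g = integral {0..1} (\<lambda>z. r z * f z * g z)"
  unfolding l2_inner_def using assms r_cont
  by (intro lebesgue_integral_eq_integral continuous_imp_integrable_real continuous_intros) auto

lemma ip_zeroD: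
  assumes "continuous_on {0..1} f" "ip f f = 0" "z \<in> {0..1}"
  shows "f z = 0"
  using assms nrm_zeroD[of f z] nrm_sq[of f] by auto

end

section \<open>Linear initial value problems and the Sturm--Liouville expression\<close>

lemma deriv_transform:
  fixes F G :: "real \<Rightarrow> real"
  assumes "z \<in> S" "\<And>y. y \<in> S \<Longrightarrow> G y = F y" "(F has_real_derivative D) (at z within S)"
  shows "(G has_real_derivative D) (at z within S)"
  by (rule has_field_derivative_transform_within[of F D z S 1 G]) (use assms in auto)

text \<open>Picard iteration. Measured with the weight \<open>exp (2 * M * z)\<close>, each
  iteration halves the distance of successive iterates, so one pass covers the whole interval
  whatever the size of \<open>M\<close>.\<close>

theorem Lipschitz_ivp_unit:
  fixes A :: "real \<Rightarrow> 'a::banach \<Rightarrow> 'a"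
  assumes cont: "\<And>y. continuous_on {0..1} y \<Longrightarrow> continuous_on {0..1} (\<lambda>z. A z (y z))"
    and lip: "\<And>z u v. z \<in> {0..1} \<Longrightarrow> norm (A z u - A z v) \<le> M * norm (u - v)"
    and M: "M > 0"
  shows "\<exists>y. y 0 = y0 \<and> (\<forall>z\<in>{0..1}. (y has_vector_derivative A z (y z)) (at z within {0..1}))"
proof -
  define G where "G = (\<lambda>y z. y0 + integral {0..z} (\<lambda>s. A s (y s)))"
  define Y where "Y n = (G ^^ n) (\<lambda>_. y0)" for n
  have Y_Suc: "Y (Suc n) = G (Y n)" for n by (simp add: Y_def)
  have G_cont: "continuous_on {0..1} (G y)" if "continuous_on {0..1} y" for y
    unfolding G_def
    by (intro continuous_intros indefinite_integral_continuous_1 integrable_continuous_real cont that)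
  have Y_cont: "continuous_on {0..1} (Y n)" for n
    by (induction n) (auto simp: Y_def intro: G_cont)
  have int: "(\<lambda>s. A s (y s)) integrable_on {0..z}" if "continuous_on {0..1} y" "z \<in> {0..1}" for y z
    using that by (intro integrable_continuous_real continuous_on_subset[OF cont[OF that(1)]]) auto
  obtain D where D: "D \<ge> 0" "\<And>z. z \<in> {0..1} \<Longrightarrow> norm (Y 1 z - Y 0 z) \<le> D"
  proof -
    have "compact ((\<lambda>z. norm (Y 1 z - Y 0 z)) ` {0..1})"
      by (intro compact_continuous_image continuous_intros Y_cont) auto
    then obtain D where "\<forall>x\<in>(\<lambda>z. norm (Y 1 z - Y 0 z)) ` {0..1}. norm x \<le> D"
      using compact_imp_bounded bounded_iff by metis
    then have "\<And>z. z \<in> {0..1} \<Longrightarrow> norm (Y 1 z - Y 0 z) \<le> max D 0" by (force simp: le_max_iff_disj)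
    then show ?thesis by (intro that[of "max D 0"]) auto
  qed
  \<comment> \<open>Integrating \<open>M\<close> times the weight reproduces at most half of the
    weight: the source of the factor 1/2 below.\<close>
  have int_exp: "((\<lambda>s. M * (c * exp (2 * M * s))) has_integral (c / 2 * exp (2 * M * z) - c / 2)) {0..z}"
    if "z \<ge> 0" for z c
  proof -
    have "((\<lambda>s. M * (c * exp (2 * M * s))) has_integral (c / 2 * exp (2 * M * z) - c / 2 * exp (2 * M * 0))) {0..z}"
      using that M
      by (intro fundamental_theorem_of_calculus)
        (auto simp: has_real_derivative_iff_has_vector_derivative[symmetric] intro!: derivative_eq_intros)
    then show ?thesis by simp
  qed
  have step: "norm (Y (Suc n) z - Y n z) \<le> D * exp (2 * M * z) * (1/2) ^ n" if "z \<in> {0..1}" for n z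
    using that
  proof (induction n arbitrary: z)
    case 0
    have "D * 1 \<le> D * exp (2 * M * z)" using D M 0 by (intro mult_left_mono) auto
    then show ?case using D(2)[OF 0] by simp
  next
    case (Suc n)
    define c where "c = D * (1/2) ^ n"
    have c: "c \<ge> 0" using D by (simp add: c_def)
    have "Y (Suc (Suc n)) z - Y (Suc n) z = integral {0..z} (\<lambda>s. A s (Y (Suc n) s) - A s (Y n s))"
      using Henstock_Kurzweil_Integration.integral_diff[OF int[OF Y_cont[of "Suc n"] Suc.prems] int[OF Y_cont[of n] Suc.prems]]
        fun_cong[OF Y_Suc[of "Suc n"], of z] fun_cong[OF Y_Suc[of n], of z]
      unfolding G_def by (simp only: add_diff_cancel_left)
    also have "norm \<dots> \<le> integral {0..z} (\<lambda>s. M * (c * exp (2 * M * s)))"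
    proof (rule integral_norm_bound_integral)
      show "(\<lambda>s. A s (Y (Suc n) s) - A s (Y n s)) integrable_on {0..z}"
        using int[OF Y_cont Suc.prems] by (intro integrable_diff)
      show "(\<lambda>s. M * (c * exp (2 * M * s))) integrable_on {0..z}"
        using int_exp Suc.prems by (auto simp: integrable_on_def)
      fix s assume "s \<in> {0..z}"
      then have s: "s \<in> {0..1}" using Suc.prems by auto
      have "norm (A s (Y (Suc n) s) - A s (Y n s)) \<le> M * norm (Y (Suc n) s - Y n s)" by (rule lip[OF s])
      also have "\<dots> \<le> M * (c * exp (2 * M * s))"
        using Suc.IH[OF s] M by (intro mult_left_mono) (auto simp: c_def mult_ac)
      finally show "norm (A s (Y (Suc n) s) - A s (Y n s)) \<le> M * (c * exp (2 * M * s))" .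
    qed
    also have "\<dots> = c / 2 * exp (2 * M * z) - c / 2"
      using Suc.prems by (intro integral_unique[OF int_exp]) auto
    also have "\<dots> \<le> D * exp (2 * M * z) * (1/2) ^ Suc n" using c by (simp add: c_def mult_ac)
    finally show ?case .
  qed
  define y where "y z = y0 + (\<Sum>i. Y (Suc i) z - Y i z)" for z
  have "uniform_limit {0..1} (\<lambda>n z. \<Sum>i<n. Y (Suc i) z - Y i z) (\<lambda>z. \<Sum>i. Y (Suc i) z - Y i z) sequentially"
  proof (rule Weierstrass_m_test)
    show "summable (\<lambda>n. D * exp (2 * M) * (1/2::real) ^ n)"
      by (intro summable_mult summable_geometric) auto
    fix n z assume z: "z \<in> {0..1::real}"
    have "D * exp (2 * M * z) * (1/2) ^ n \<le> D * exp (2 * M) * (1/2) ^ n"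
      using z D M by (intro mult_right_mono mult_left_mono) auto
    then show "norm (Y (Suc n) z - Y n z) \<le> D * exp (2 * M) * (1/2) ^ n"
      using step[OF z, of n] by linarith
  qed
  then have "uniform_limit {0..1} (\<lambda>n z. y0 + (\<Sum>i<n. Y (Suc i) z - Y i z)) y sequentially"
    unfolding y_def by (intro uniform_limit_add uniform_limit_const)
  moreover have "(\<lambda>n z. y0 + (\<Sum>i<n. Y (Suc i) z - Y i z)) = Y"
  proof (intro ext)
    show "y0 + (\<Sum>i<n. Y (Suc i) z - Y i z) = Y n z" for n z
      using sum_lessThan_telescope[of "\<lambda>i. Y i z" n] by (simp add: Y_def)
  qed
  ultimately have lim: "uniform_limit {0..1} Y y sequentially" by simp
  then have y_cont: "continuous_on {0..1} y"
    by (rule uniform_limit_theorem[rotated]) (auto intro!: always_eventually Y_cont)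
  \<comment> \<open>The Lipschitz bound carries the uniform convergence of the iterates over to the
    integrands, so the limit may be taken in \<open>Y (Suc n) = G (Y n)\<close>.\<close>
  have fix_eq: "y z = G y z" if z: "z \<in> {0..1}" for z
  proof -
    have "uniform_limit {0..z} (\<lambda>n s. A s (Y n s)) (\<lambda>s. A s (y s)) sequentially"
    proof (rule uniform_limitI)
      fix e :: real assume "e > 0"
      then have "\<forall>\<^sub>F n in sequentially. \<forall>s\<in>{0..1}. dist (Y n s) (y s) < e / M"
        using uniform_limitD[OF lim, of "e / M"] M by simp
      then show "\<forall>\<^sub>F n in sequentially. \<forall>s\<in>{0..z}. dist (A s (Y n s)) (A s (y s)) < e"
      proof eventually_elim
        case (elim n)
        show ?case
        proof
          fix s assume "s \<in> {0..z}"
          then have s: "s \<in> {0..1}" using z by auto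
          have "M * dist (Y n s) (y s) < e" using elim s M by (auto simp: field_simps)
          then show "dist (A s (Y n s)) (A s (y s)) < e"
            using lip[OF s, of "Y n s" "y s"] by (simp add: dist_norm)
        qed
      qed
    qed
    then obtain I J where IJ: "\<And>n. ((\<lambda>s. A s (Y n s)) has_integral I n) {0..z}"
        "((\<lambda>s. A s (y s)) has_integral J) {0..z}" "I \<longlonglongrightarrow> J"
      using z by (elim uniform_limit_integral) (auto intro!: continuous_on_subset[OF cont[OF Y_cont]])
    have "(\<lambda>n. Y (Suc n) z) \<longlonglongrightarrow> y0 + J"
      unfolding Y_Suc G_def integral_unique[OF IJ(1)] by (intro tendsto_intros IJ(3))
    moreover have "(\<lambda>n. Y (Suc n) z) \<longlonglongrightarrow> y z"
      using tendsto_uniform_limitI[OF lim z] by (rule LIMSEQ_Suc)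
    ultimately have "y z = y0 + J" using LIMSEQ_unique by blast
    then show ?thesis using IJ by (simp add: G_def integral_unique)
  qed
  show ?thesis
  proof (intro exI[of _ y] conjI ballI)
    show "y 0 = y0" using fix_eq[of 0] by (simp add: G_def)
    fix z :: real assume z: "z \<in> {0..1}"
    have "(G y has_vector_derivative A z (y z)) (at z within {0..1})"
      unfolding G_def
      by (auto intro!: derivative_eq_intros integral_has_vector_derivative[OF cont[OF y_cont] z])
    then show "(y has_vector_derivative A z (y z)) (at z within {0..1})"
      using fix_eq z by (elim has_vector_derivative_transform[rotated 2]) auto
  qed
qed

section \<open>The Sturm-Liouville expression in flux form\<close>

locale sturm = weight r for r +
  fixes p q :: "real \<Rightarrow> real" and a1 a2 b1 b2 :: real
  assumes p_C1: "C1_unit p" and p_pos: "\<And>z. z \<in> {0..1} \<Longrightarrow> 0 < p z"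
    and q_cont: "continuous_on {0..1} q"
    and a_nz: "\<bar>a1\<bar> + \<bar>a2\<bar> > 0" and b_nz: "\<bar>b1\<bar> + \<bar>b2\<bar> > 0"
begin

text \<open>\<open>isA F P h\<close> expresses \<open>A F = h\<close> as a first-order system for \<open>F\<close> and the flux \<open>P = p F'\<close>;
  boundary conditions are kept separate.\<close>

definition isA :: "(real \<Rightarrow> real) \<Rightarrow> (real \<Rightarrow> real) \<Rightarrow> (real \<Rightarrow> real) \<Rightarrow> bool" where
  "isA F P h \<longleftrightarrow> continuous_on {0..1} h \<and>
     (\<forall>z\<in>{0..1}. (F has_real_derivative P z / p z) (at z within {0..1}) \<and>
                 (P has_real_derivative q z * F z - r z * h z) (at z within {0..1}))"

text \<open>\<open>P 0 / p 0\<close> is the derivative of \<open>F\<close> at 0 when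
  \<open>P\<close> is its flux. Written this way the boundary values are linear in the pair without
  any differentiability assumption.\<close>

definition bcL :: "(real \<Rightarrow> real) \<Rightarrow> (real \<Rightarrow> real) \<Rightarrow> real" where
  "bcL F P = b1 * F 0 + b2 * (P 0 / p 0)"

definition bcR :: "(real \<Rightarrow> real) \<Rightarrow> (real \<Rightarrow> real) \<Rightarrow> real" where
  "bcR F P = a1 * F 1 + a2 * (P 1 / p 1)"

lemma p_cont: "continuous_on {0..1} p"
  using p_C1 unfolding C1_unit_def by (metis continuous_on_vector_derivative)

lemma isAD:
  assumes "isA F P h"
  shows "continuous_on {0..1} h"
    and "\<And>z. z \<in> {0..1} \<Longrightarrow> (F has_real_derivative P z / p z) (at z within {0..1})"
    and "\<And>z. z \<in> {0..1} \<Longrightarrow> (P has_real_derivative q z * F z - r z * h z) (at z within {0..1})"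
    and "continuous_on {0..1} F" and "continuous_on {0..1} P"
  using assms unfolding isA_def by (auto intro!: DERIV_continuous_on)

lemma isA_L2: "isA F P h \<Longrightarrow> F \<in> L2 r" "isA F P h \<Longrightarrow> h \<in> L2 r"
  using isAD(1,4) L2_cont by auto

lemma isA_add:
  assumes "isA F P h" "isA G Q k"
  shows "isA (\<lambda>z. F z + G z) (\<lambda>z. P z + Q z) (\<lambda>z. h z + k z)"
  unfolding isA_def
proof (intro conjI ballI)
  show "continuous_on {0..1} (\<lambda>z. h z + k z)" using assms isAD by (intro continuous_intros) auto
  fix z :: real assume z: "z \<in> {0..1}"
  note [derivative_intros] = isAD(2,3)[OF assms(1) z] isAD(2,3)[OF assms(2) z]
  show "((\<lambda>z. F z + G z) has_real_derivative (P z + Q z) / p z) (at z within {0..1})"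
    by (auto intro!: derivative_eq_intros simp: add_divide_distrib)
  show "((\<lambda>z. P z + Q z) has_real_derivative q z * (F z + G z) - r z * (h z + k z)) (at z within {0..1})"
    by (auto intro!: derivative_eq_intros simp: algebra_simps)
qed

lemma isA_scale:
  assumes "isA F P h"
  shows "isA (\<lambda>z. c * F z) (\<lambda>z. c * P z) (\<lambda>z. c * h z)"
  unfolding isA_def
proof (intro conjI ballI)
  show "continuous_on {0..1} (\<lambda>z. c * h z)" using assms isAD by (intro continuous_intros) auto
  fix z :: real assume z: "z \<in> {0..1}"
  note [derivative_intros] = isAD(2,3)[OF assms(1) z]
  show "((\<lambda>z. c * F z) has_real_derivative (c * P z) / p z) (at z within {0..1})"
    by (auto intro!: derivative_eq_intros)
  show "((\<lambda>z. c * P z) has_real_derivative q z * (c * F z) - r z * (c * h z)) (at z within {0..1})"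
    by (auto intro!: derivative_eq_intros simp: algebra_simps)
qed

lemma isA_diff:
  assumes "isA F P h" "isA G Q k"
  shows "isA (\<lambda>z. F z - G z) (\<lambda>z. P z - Q z) (\<lambda>z. h z - k z)"
  using isA_add[OF assms(1) isA_scale[OF assms(2), of "-1"]] by simp

lemma isA_zero: "isA (\<lambda>z. 0) (\<lambda>z. 0) (\<lambda>z. 0)"
  by (auto simp: isA_def)

lemma isA_cong:
  assumes "isA F P h" "\<And>z. z \<in> {0..1} \<Longrightarrow> F z = F' z" "\<And>z. z \<in> {0..1} \<Longrightarrow> P z = P' z"
    "\<And>z. z \<in> {0..1} \<Longrightarrow> h z = h' z"
  shows "isA F' P' h'"
  unfolding isA_def
proof (intro conjI ballI)
  show "continuous_on {0..1} h'"
    using isAD(1)[OF assms(1)] assms(4) by (rule continuous_on_eq)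
  fix z :: real assume z: "z \<in> {0..1}"
  show "(F' has_real_derivative P' z / p z) (at z within {0..1})"
    using deriv_transform[OF z assms(2)[symmetric] isAD(2)[OF assms(1) z]] assms(3)[OF z] by simp
  show "(P' has_real_derivative q z * F' z - r z * h' z) (at z within {0..1})"
    using deriv_transform[OF z assms(3)[symmetric] isAD(3)[OF assms(1) z]] assms(2,4)[OF z] by simp
qed

lemma bc_linear:
  "bcL (\<lambda>z. F z + G z) (\<lambda>z. P z + Q z) = bcL F P + bcL G Q"
  "bcR (\<lambda>z. F z + G z) (\<lambda>z. P z + Q z) = bcR F P + bcR G Q"
  "bcL (\<lambda>z. F z - G z) (\<lambda>z. P z - Q z) = bcL F P - bcL G Q"
  "bcR (\<lambda>z. F z - G z) (\<lambda>z. P z - Q z) = bcR F P - bcR G Q"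
  "bcL (\<lambda>z. c * F z) (\<lambda>z. c * P z) = c * bcL F P"
  "bcR (\<lambda>z. c * F z) (\<lambda>z. c * P z) = c * bcR F P"
  by (auto simp: bcL_def bcR_def algebra_simps add_divide_distrib diff_divide_distrib)

lemma isA_dz:
  assumes "isA F P h" "z \<in> {0..1}"
  shows "dz F z = P z / p z" and "dz (\<lambda>y. p y * dz F y) z = q z * F z - r z * h z"
proof -
  have *: "dz F z = P z / p z" if "z \<in> {0..1}" for z
    using isAD(2)[OF assms(1) that] that
    by (intro vector_derivative_within_closed_interval) (auto simp: has_real_derivative_iff_has_vector_derivative)
  show "dz F z = P z / p z" using *[OF assms(2)] .
  have "((\<lambda>y. p y * dz F y) has_real_derivative q z * F z - r z * h z) (at z within {0..1})"
  proof (rule deriv_transform[OF assms(2) _ isAD(3)[OF assms]])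
    fix y :: real assume "y \<in> {0..1}"
    then show "p y * dz F y = P y" using *[of y] p_pos[of y] by auto
  qed
  then show "dz (\<lambda>y. p y * dz F y) z = q z * F z - r z * h z"
    using assms(2)
    by (intro vector_derivative_within_closed_interval) (auto simp: has_real_derivative_iff_has_vector_derivative)
qed

lemma isA_SL_op:
  assumes "isA F P h" "z \<in> {0..1}"
  shows "SL_op p r q F z = h z"
  using r_pos[OF assms(2)] unfolding SL_op_def isA_dz(2)[OF assms] by (simp add: field_simps)

lemma isA_bc: "isA F P h \<Longrightarrow> SL_bc a1 a2 b1 b2 F \<longleftrightarrow> bcL F P = 0 \<and> bcR F P = 0"
  unfolding SL_bc_def bcL_def bcR_def using isA_dz(1)[of F P h 0] isA_dz(1)[of F P h 1] by auto

text \<open>Continuous differentiability of \<open>p\<close> enters here: the derivative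
  \<open>P / p\<close> of \<open>F\<close> is itself continuously differentiable, which leads back
  from the flux form to \<open>C2_unit\<close> and \<open>H2_unit\<close>.\<close>

lemma P_over_p_deriv:
  assumes "isA F P h"
  obtains h' where "continuous_on {0..1} h'"
    "\<And>z. z \<in> {0..1} \<Longrightarrow> ((\<lambda>z. P z / p z) has_real_derivative h' z) (at z within {0..1})"
proof -
  obtain p' where p': "continuous_on {0..1} p'" "\<And>z. z \<in> {0..1} \<Longrightarrow> (p has_real_derivative p' z) (at z within {0..1})"
    using p_C1 unfolding C1_unit_def has_real_derivative_iff_has_vector_derivative by blast
  define h' where "h' z = ((q z * F z - r z * h z) * p z - P z * p' z) / (p z * p z)" for z
  have nz: "p z \<noteq> 0" if "0 \<le> z" "z \<le> 1" for z using p_pos[of z] that by auto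
  show ?thesis
  proof (rule that[of h'])
    show "continuous_on {0..1} h'"
      unfolding h'_def using isAD[OF assms] q_cont r_cont p'(1) p_cont nz
      by (intro continuous_intros) auto
    show "((\<lambda>z. P z / p z) has_real_derivative h' z) (at z within {0..1})" if "z \<in> {0..1}" for z
      using DERIV_divide[OF isAD(3)[OF assms that] p'(2)[OF that]] nz that by (simp add: h'_def)
  qed
qed

lemma isA_C2: assumes "isA F P h" shows "C2_unit F"
proof -
  obtain h' where "continuous_on {0..1} h'"
    "\<And>z. z \<in> {0..1} \<Longrightarrow> ((\<lambda>z. P z / p z) has_real_derivative h' z) (at z within {0..1})"
    using P_over_p_deriv[OF assms] by blast
  then have "C1_unit (\<lambda>z. P z / p z)"
    unfolding C1_unit_def has_real_derivative_iff_has_vector_derivative by blast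
  then show ?thesis
    unfolding C2_unit_def using isAD(2)[OF assms]
    by (auto simp: has_real_derivative_iff_has_vector_derivative)
qed

lemma isA_H2: assumes "isA F P h" shows "H2_unit F"
proof -
  obtain h' where h': "continuous_on {0..1} h'"
    "\<And>z. z \<in> {0..1} \<Longrightarrow> ((\<lambda>z. P z / p z) has_real_derivative h' z) (at z within {0..1})"
    using P_over_p_deriv[OF assms] by blast
  have "C1_unit F"
    unfolding C1_unit_def
  proof (intro exI conjI ballI)
    show "continuous_on {0..1} (\<lambda>z. P z / p z)"
      using isAD(5)[OF assms] p_cont p_pos by (intro continuous_intros) force+
    show "(F has_vector_derivative P z / p z) (at z within {0..1})" if "z \<in> {0..1}" for z
      using isAD(2)[OF assms that] by (simp add: has_real_derivative_iff_has_vector_derivative)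
  qed
  moreover have "h' \<in> L2 (\<lambda>_. 1)"
    unfolding L2_def using h'(1)
    by (auto intro!: continuous_borel_measurable continuous_imp_integrable_real continuous_intros)
  moreover have "dz F z = dz F 0 + (LINT y|lebesgue_on {0..z}. h' y)" if z: "z \<in> {0..1}" for z
  proof -
    have c: "continuous_on {0..z} h'" using z by (intro continuous_on_subset[OF h'(1)]) auto
    have "(h' has_integral P z / p z - P 0 / p 0) {0..z}"
    proof (rule fundamental_theorem_of_calculus)
      fix x assume "x \<in> {0..z}"
      then show "((\<lambda>z. P z / p z) has_vector_derivative h' x) (at x within {0..z})"
        using h'(2)[of x] z has_vector_derivative_within_subset[of "\<lambda>z. P z / p z" "h' x" x "{0..1}" "{0..z}"]
        by (auto simp: has_real_derivative_iff_has_vector_derivative)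
    qed (use z in auto)
    moreover have "(LINT y|lebesgue_on {0..z}. h' y) = integral {0..z} h'"
      using c by (intro lebesgue_integral_eq_integral continuous_imp_integrable_real) auto
    ultimately show ?thesis using isA_dz(1)[OF assms, of z] isA_dz(1)[OF assms, of 0] z
      by (simp add: integral_unique)
  qed
  ultimately show ?thesis unfolding H2_unit_def by blast
qed

text \<open>Lets eigenfunctions and arbitrary closed-loop solutions, which are given by classical
  derivatives, enter the flux calculus.\<close>

lemma C2_isA:
  assumes "C2_unit F"
  shows "isA F (\<lambda>z. p z * dz F z) (SL_op p r q F)"
proof -
  obtain F' F'' where F: "\<And>z. z \<in> {0..1} \<Longrightarrow> (F has_real_derivative F' z) (at z within {0..1})"
    "\<And>z. z \<in> {0..1} \<Longrightarrow> (F' has_real_derivative F'' z) (at z within {0..1})" "continuous_on {0..1} F''"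
    using assms unfolding C1_unit_def C2_unit_def has_real_derivative_iff_has_vector_derivative by blast
  obtain p' where p': "continuous_on {0..1} p'" "\<And>z. z \<in> {0..1} \<Longrightarrow> (p has_real_derivative p' z) (at z within {0..1})"
    using p_C1 unfolding C1_unit_def has_real_derivative_iff_has_vector_derivative by blast
  define h where "h z = - (1 / r z) * (p' z * F' z + p z * F'' z) + q z / r z * F z" for z
  have rnz: "r z \<noteq> 0" if "0 \<le> z" "z \<le> 1" for z using r_pos[of z] that by auto
  have pnz: "p z \<noteq> 0" if "0 \<le> z" "z \<le> 1" for z using p_pos[of z] that by auto
  have cF: "continuous_on {0..1} F" "continuous_on {0..1} F'"
    using F(1,2) by (blast intro: DERIV_continuous_on)+
  have "isA F (\<lambda>z. p z * F' z) h"
    unfolding isA_def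
  proof (intro conjI ballI)
    show "continuous_on {0..1} h" unfolding h_def
      using rnz cF F(3) p' p_cont q_cont r_cont by (intro continuous_intros) auto
    fix z :: real assume z: "z \<in> {0..1}"
    show "(F has_real_derivative p z * F' z / p z) (at z within {0..1})" using F(1)[OF z] pnz z by auto
    show "((\<lambda>z. p z * F' z) has_real_derivative q z * F z - r z * h z) (at z within {0..1})"
      by (rule DERIV_cong[OF DERIV_mult[OF p'(2)[OF z] F(2)[OF z]]]) (use rnz z in \<open>simp add: h_def field_simps\<close>)
  qed
  then show ?thesis
  proof (rule isA_cong)
    fix z :: real assume z: "z \<in> {0..1}"
    show "h z = SL_op p r q F z" using isA_SL_op[OF \<open>isA F (\<lambda>z. p z * F' z) h\<close> z] by simp
    show "p z * F' z = p z * dz F z" using isA_dz(1)[OF \<open>isA F (\<lambda>z. p z * F' z) h\<close> z] pnz z by simp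
  qed auto
qed

text \<open>The equation \<open>(A - \<mu>) F = f\<close> is encoded by the right-hand side
  \<open>f + \<mu> F\<close>. It is a linear system for \<open>(F, P)\<close> whose coefficients
  \<open>1 / p\<close> and \<open>q - \<mu> r\<close> are bounded on the interval, so Picard
  iteration applies.\<close>

lemma isA_ivp:
  assumes "continuous_on {0..1} f"
  shows "\<exists>F P. isA F P (\<lambda>z. f z + \<mu> * F z) \<and> F 0 = \<alpha> \<and> P 0 = \<beta>"
proof -
  have pnz: "p z \<noteq> 0" if "0 \<le> z" "z \<le> 1" for z using p_pos[of z] that by auto
  have c1: "continuous_on {0..1} (\<lambda>z. 1 / p z)" "continuous_on {0..1} (\<lambda>z. q z - \<mu> * r z)"
    using p_cont pnz q_cont r_cont by (auto intro!: continuous_intros)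
  obtain B1 where B1: "B1 > 0" "\<And>z. z \<in> {0..1} \<Longrightarrow> \<bar>1 / p z\<bar> \<le> B1" using bounded_on_unit[OF c1(1)] by blast
  obtain B2 where B2: "B2 > 0" "\<And>z. z \<in> {0..1} \<Longrightarrow> \<bar>q z - \<mu> * r z\<bar> \<le> B2" using bounded_on_unit[OF c1(2)] by blast
  define A :: "real \<Rightarrow> real \<times> real \<Rightarrow> real \<times> real" where
    "A = (\<lambda>z y. (snd y / p z, (q z - \<mu> * r z) * fst y - r z * f z))"
  have "\<exists>y. y 0 = (\<alpha>, \<beta>) \<and> (\<forall>z\<in>{0..1}. (y has_vector_derivative A z (y z)) (at z within {0..1}))"
  proof (rule Lipschitz_ivp_unit[where M = "B1 + B2"])
    show "continuous_on {0..1} (\<lambda>z. A z (y z))" if "continuous_on {0..1} y" for y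
      unfolding A_def using that p_cont q_cont r_cont assms pnz by (intro continuous_intros) auto
    fix z :: real and u v :: "real \<times> real" assume z: "z \<in> {0..1}"
    define a where "a = fst u - fst v"
    define b where "b = snd u - snd v"
    have ab: "\<bar>a\<bar> \<le> norm (u - v)" "\<bar>b\<bar> \<le> norm (u - v)"
      using norm_fst_le[of "fst (u - v)" "snd (u - v)", unfolded prod.collapse]
        norm_snd_le[of "snd (u - v)" "fst (u - v)", unfolded prod.collapse]
      by (simp_all add: a_def b_def fst_diff snd_diff)
    have "A z u - A z v = (1 / p z * b, (q z - \<mu> * r z) * a)"
      by (auto simp: A_def a_def b_def field_simps diff_divide_distrib)
    also have "norm \<dots> \<le> \<bar>1 / p z\<bar> * \<bar>b\<bar> + \<bar>q z - \<mu> * r z\<bar> * \<bar>a\<bar>"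
      unfolding abs_mult[symmetric] using norm_Pair_le by (metis real_norm_def)
    also have "\<dots> \<le> B1 * norm (u - v) + B2 * norm (u - v)"
      using ab B1(2)[OF z] B2(2)[OF z] B1(1) B2(1) by (intro add_mono mult_mono) auto
    finally show "norm (A z u - A z v) \<le> (B1 + B2) * norm (u - v)" by (simp add: algebra_simps)
  qed (use B1 B2 in auto)
  then obtain y where y: "y 0 = (\<alpha>, \<beta>)" "\<And>z. z \<in> {0..1} \<Longrightarrow> (y has_vector_derivative A z (y z)) (at z within {0..1})"
    by blast
  have F: "((\<lambda>z. fst (y z)) has_real_derivative snd (y z) / p z) (at z within {0..1})" if "z \<in> {0..1}" for z
    using bounded_linear.has_vector_derivative[OF bounded_linear_fst y(2)[OF that]]
    by (simp add: A_def has_real_derivative_iff_has_vector_derivative)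
  moreover have "((\<lambda>z. snd (y z)) has_real_derivative (q z - \<mu> * r z) * fst (y z) - r z * f z) (at z within {0..1})" if "z \<in> {0..1}" for z
    using bounded_linear.has_vector_derivative[OF bounded_linear_snd y(2)[OF that]]
    by (simp add: A_def has_real_derivative_iff_has_vector_derivative)
  moreover have "continuous_on {0..1} (\<lambda>z. f z + \<mu> * fst (y z))"
    using assms by (intro continuous_on_add continuous_on_mult continuous_on_const DERIV_continuous_on[OF F])
  ultimately have "isA (\<lambda>z. fst (y z)) (\<lambda>z. snd (y z)) (\<lambda>z. f z + \<mu> * fst (y z))"
    unfolding isA_def by (auto simp: algebra_simps)
  then show ?thesis using y(1) by (intro exI[of _ "\<lambda>z. fst (y z)"] exI[of _ "\<lambda>z. snd (y z)"]) auto
qed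

text \<open>Gronwall's inequality for \<open>F^2 + P^2\<close>. The bound contains the weighted norm
  of \<open>f\<close>, not its supremum; this later makes the solution operator continuous from the
  weighted norm to the sup norm.\<close>

lemma isA_energy:
  "\<exists>C>0. \<forall>F P f. isA F P (\<lambda>z. f z + \<mu> * F z) \<longrightarrow> continuous_on {0..1} f \<longrightarrow>
     (\<forall>z\<in>{0..1}. (F z)\<^sup>2 + (P z)\<^sup>2 \<le> C * ((F 0)\<^sup>2 + (P 0)\<^sup>2 + (nrm f)\<^sup>2))"
proof -
  have pnz: "p z \<noteq> 0" if "0 \<le> z" "z \<le> 1" for z using p_pos[of z] that by auto
  have c1: "continuous_on {0..1} (\<lambda>z. 1 / p z + q z - \<mu> * r z)"
    using p_cont pnz q_cont r_cont by (auto intro!: continuous_intros)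
  obtain B where B: "B > 0" "\<And>z. z \<in> {0..1} \<Longrightarrow> \<bar>1 / p z + q z - \<mu> * r z\<bar> \<le> B" using bounded_on_unit[OF c1] by blast
  obtain R where R: "R > 0" "\<And>z. z \<in> {0..1} \<Longrightarrow> \<bar>r z\<bar> \<le> R" using bounded_on_unit[OF r_cont] by blast
  define c where "c = B + R"
  have c: "c > 0" using B R by (simp add: c_def)
  show ?thesis
  proof (intro exI[of _ "exp c"] conjI allI impI ballI)
    fix F P f z assume A: "isA F P (\<lambda>z. f z + \<mu> * F z)" and f: "continuous_on {0..1} f" and z: "z \<in> {0..1::real}"
    define E where "E y = (F y)\<^sup>2 + (P y)\<^sup>2" for y
    define E' where "E' y = 2 * F y * (P y / p y) + 2 * P y * (q y * F y - r y * (f y + \<mu> * F y))" for y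
    have E': "(E has_real_derivative E' y) (at y within {0..1})" if "y \<in> {0..1}" for y
      unfolding E_def E'_def
      by (auto intro!: derivative_eq_intros isAD(2,3)[OF A that])
    have rf_cont: "continuous_on {0..1} (\<lambda>y. r y * (f y)\<^sup>2)" using r_cont f by (intro continuous_intros)
    \<comment> \<open>The integrating factor absorbs the terms quadratic in \<open>(F, P)\<close>,
      the running integral those in \<open>f\<close>; hence \<open>H\<close> is
      nonincreasing.\<close>
    define H where "H y = exp (- c * y) * E y - integral {0..y} (\<lambda>y. r y * (f y)\<^sup>2)" for y
    have H': "(H has_real_derivative (exp (- c * y) * (E' y - c * E y) - r y * (f y)\<^sup>2)) (at y within {0..1})" if "y \<in> {0..1}" for y
      unfolding H_def
      by (auto intro!: derivative_eq_intros E'[OF that] integral_has_real_derivative[OF rf_cont that] simp: algebra_simps)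
    have neg: "exp (- c * y) * (E' y - c * E y) - r y * (f y)\<^sup>2 \<le> 0" if y: "y \<in> {0..1}" for y
    proof -
      \<comment> \<open>All contributions without \<open>f\<close> combine into the single product
        \<open>2 F P\<close> times \<open>b\<close>.\<close>
      define b where "b = 1 / p y + q y - \<mu> * r y"
      have "E' y = b * (2 * F y * P y) + r y * (2 * P y * (- f y))"
        by (simp add: E'_def b_def algebra_simps)
      moreover have "b * (2 * F y * P y) \<le> B * E y"
      proof -
        have "b * (2 * F y * P y) \<le> \<bar>b\<bar> * \<bar>2 * F y * P y\<bar>" by (metis abs_ge_self abs_mult)
        also have "\<dots> \<le> B * E y"
          using B(2)[OF y] sum_squares_bound[of "\<bar>F y\<bar>" "\<bar>P y\<bar>"]
          by (intro mult_mono) (auto simp: b_def E_def abs_mult)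
        finally show ?thesis .
      qed
      moreover have "r y * (2 * P y * (- f y)) \<le> R * E y + r y * (f y)\<^sup>2"
      proof -
        have "r y * (2 * P y * (- f y)) \<le> r y * ((P y)\<^sup>2 + (f y)\<^sup>2)"
          using r_pos[OF y] sum_squares_bound[of "P y" "- f y"] by (intro mult_left_mono) auto
        also have "\<dots> \<le> R * E y + r y * (f y)\<^sup>2"
          using r_pos[OF y] R(2)[OF y] by (simp add: E_def distrib_left mult_right_mono add_increasing)
        finally show ?thesis .
      qed
      ultimately have "E' y - c * E y \<le> r y * (f y)\<^sup>2" by (simp add: c_def algebra_simps)
      then have "exp (- c * y) * (E' y - c * E y) \<le> exp (- c * y) * (r y * (f y)\<^sup>2)" by (intro mult_left_mono) auto
      also have "\<dots> \<le> 1 * (r y * (f y)\<^sup>2)"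
        using y c r_pos[OF y] by (intro mult_right_mono) auto
      finally show ?thesis by simp
    qed
    have "H z \<le> H 0"
    proof (rule DERIV_nonpos_imp_decreasing_open[of 0 z H])
      show "0 \<le> z" using z by auto
      show "continuous_on {0..z} H" using z by (intro continuous_on_subset[OF DERIV_continuous_on[OF H']]) auto
      fix y assume y: "0 < y" "y < z"
      then have "(H has_real_derivative (exp (- c * y) * (E' y - c * E y) - r y * (f y)\<^sup>2)) (at y)"
        using H'[of y] z at_within_Icc_at[of 0 y 1] by auto
      then show "\<exists>d. (H has_real_derivative d) (at y) \<and> d \<le> 0" using neg[of y] y z by auto
    qed
    moreover have "H 0 = E 0" by (simp add: H_def)
    moreover have "integral {0..z} (\<lambda>y. r y * (f y)\<^sup>2) \<le> (nrm f)\<^sup>2"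
    proof -
      have "integral {0..z} (\<lambda>y. r y * (f y)\<^sup>2) \<le> integral {0..1} (\<lambda>y. r y * (f y)\<^sup>2)"
        using z r_pos rf_cont
        by (intro integral_subset_le integrable_continuous_real) (auto simp: less_imp_le intro: continuous_on_subset)
      also have "\<dots> = (nrm f)\<^sup>2"
        unfolding nrm_sq ip_continuous_eq[OF f f] by (simp add: power2_eq_square mult.assoc)
      finally show ?thesis .
    qed
    ultimately have *: "exp (- c * z) * E z \<le> E 0 + (nrm f)\<^sup>2" by (simp add: H_def)
    have E0: "E z \<ge> 0" by (simp add: E_def)
    have "exp (- c) * E z \<le> exp (- c * z) * E z" using E0 z c by (intro mult_right_mono) auto
    also note *
    finally have "exp c * (exp (- c) * E z) \<le> exp c * (E 0 + (nrm f)\<^sup>2)" by (intro mult_left_mono) auto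
    then show "(F z)\<^sup>2 + (P z)\<^sup>2 \<le> exp c * ((F 0)\<^sup>2 + (P 0)\<^sup>2 + (nrm f)\<^sup>2)"
      unfolding mult.assoc[symmetric] exp_add[symmetric] by (simp add: E_def)
  qed auto
qed

lemma isA_zero_data:
  assumes "isA F P (\<lambda>z. \<mu> * F z)" "F 0 = 0" "P 0 = 0" "z \<in> {0..1}"
  shows "F z = 0" "P z = 0"
proof -
  obtain C where C: "\<forall>F P f. isA F P (\<lambda>z. f z + \<mu> * F z) \<longrightarrow> continuous_on {0..1} f \<longrightarrow>
     (\<forall>z\<in>{0..1}. (F z)\<^sup>2 + (P z)\<^sup>2 \<le> C * ((F 0)\<^sup>2 + (P 0)\<^sup>2 + (nrm f)\<^sup>2))"
    using isA_energy[of \<mu>] by blast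
  from C[THEN spec, of F, THEN spec, of P, THEN spec, of "\<lambda>_. 0"] have "(F z)\<^sup>2 + (P z)\<^sup>2 \<le> 0" using assms by simp
  then show "F z = 0" "P z = 0" by (simp_all add: sum_power2_le_zero_iff)
qed

text \<open>The Wronskian \<open>F * Q - P * G\<close> has derivative
  \<open>r * (h * G - F * k)\<close>, since the terms with \<open>q\<close> and \<open>1 / p\<close>
  cancel; it remains to integrate over the interval.\<close>

lemma Lagrange:
  assumes "isA F P h" "isA G Q k"
  shows "ip h G - ip F k = (F 1 * Q 1 - P 1 * G 1) - (F 0 * Q 0 - P 0 * G 0)"
proof -
  have "((\<lambda>z. r z * h z * G z - r z * F z * k z) has_integral (F 1 * Q 1 - P 1 * G 1) - (F 0 * Q 0 - P 0 * G 0)) {0..1}"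
  proof (rule fundamental_theorem_of_calculus)
    fix z :: real assume z: "z \<in> {0..1}"
    note [derivative_intros] = isAD(2,3)[OF assms(1) z] isAD(2,3)[OF assms(2) z]
    show "((\<lambda>z. F z * Q z - P z * G z) has_vector_derivative (r z * h z * G z - r z * F z * k z)) (at z within {0..1})"
      unfolding has_real_derivative_iff_has_vector_derivative[symmetric]
      by (auto intro!: derivative_eq_intros simp: algebra_simps)
  qed auto
  moreover have "ip h G = integral {0..1} (\<lambda>z. r z * h z * G z)" "ip F k = integral {0..1} (\<lambda>z. r z * F z * k z)"
    using isAD[OF assms(1)] isAD[OF assms(2)] by (auto intro!: ip_continuous_eq)
  moreover have "integral {0..1} (\<lambda>z. r z * h z * G z - r z * F z * k z) =
      integral {0..1} (\<lambda>z. r z * h z * G z) - integral {0..1} (\<lambda>z. r z * F z * k z)"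
    using isAD[OF assms(1)] isAD[OF assms(2)] r_cont
    by (intro Henstock_Kurzweil_Integration.integral_diff integrable_continuous_real continuous_intros) auto
  ultimately show ?thesis by (simp add: integral_unique)
qed

text \<open>Both data pairs at 0 lie on the line annihilated by the nonzero functional with
  coefficients \<open>b1\<close> and \<open>b2 / p 0\<close>, hence are linearly dependent. The
  determinant is multiplied by \<open>b1 * p 0\<close> and by \<open>b2\<close>, at least one of
  which is nonzero.\<close>

lemma bcL_wronskian:
  assumes "bcL F P = 0" "bcL G Q = 0"
  shows "F 0 * Q 0 - P 0 * G 0 = 0"
proof -
  have p0: "p 0 > 0" by (rule p_pos) auto
  have e: "b1 * F 0 * p 0 + b2 * P 0 = 0" "b1 * G 0 * p 0 + b2 * Q 0 = 0"
    using assms p0 by (auto simp: bcL_def field_simps)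
  have "b1 * p 0 * (F 0 * Q 0 - P 0 * G 0) = (b1 * F 0 * p 0 + b2 * P 0) * Q 0 - (b1 * G 0 * p 0 + b2 * Q 0) * P 0"
    "b2 * (F 0 * Q 0 - P 0 * G 0) = F 0 * (b1 * G 0 * p 0 + b2 * Q 0) - (b1 * F 0 * p 0 + b2 * P 0) * G 0"
    by (simp_all add: algebra_simps)
  then have "b1 * p 0 * (F 0 * Q 0 - P 0 * G 0) = 0" "b2 * (F 0 * Q 0 - P 0 * G 0) = 0"
    unfolding e by simp_all
  then show ?thesis using b_nz p0 by auto
qed

lemma bcR_wronskian:
  assumes "bcR F P = 0" "bcR G Q = 0"
  shows "F 1 * Q 1 - P 1 * G 1 = 0"
proof -
  have p0: "p 1 > 0" by (rule p_pos) auto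
  have e: "a1 * F 1 * p 1 + a2 * P 1 = 0" "a1 * G 1 * p 1 + a2 * Q 1 = 0"
    using assms p0 by (auto simp: bcR_def field_simps)
  have "a1 * p 1 * (F 1 * Q 1 - P 1 * G 1) = (a1 * F 1 * p 1 + a2 * P 1) * Q 1 - (a1 * G 1 * p 1 + a2 * Q 1) * P 1"
    "a2 * (F 1 * Q 1 - P 1 * G 1) = F 1 * (a1 * G 1 * p 1 + a2 * Q 1) - (a1 * F 1 * p 1 + a2 * P 1) * G 1"
    by (simp_all add: algebra_simps)
  then have "a1 * p 1 * (F 1 * Q 1 - P 1 * G 1) = 0" "a2 * (F 1 * Q 1 - P 1 * G 1) = 0"
    unfolding e by simp_all
  then show ?thesis using a_nz p0 by auto
qed

lemma self_adjoint:
  assumes "isA F P h" "isA G Q k" "bcL F P = 0" "bcL G Q = 0" "bcR F P = 0" "bcR G Q = 0"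
  shows "ip h G = ip F k"
  using Lagrange[OF assms(1,2)] bcL_wronskian[OF assms(3,4)] bcR_wronskian[OF assms(5,6)] by simp

text \<open>A continuous function that vanishes almost everywhere vanishes, so a single nonzero
  value suffices for the almost-everywhere definition of an eigenvalue.\<close>

lemma isA_eigenvalue:
  assumes "isA F P (\<lambda>z. \<mu> * F z)" "bcL F P = 0" "bcR F P = 0" "z0 \<in> {0..1}" "F z0 \<noteq> 0"
  shows "SL_eigenvalue p r q a1 a2 b1 b2 \<mu>"
  unfolding SL_eigenvalue_def
proof (intro bexI conjI)
  show "F \<in> SL_domain a1 a2 b1 b2"
    using isA_H2[OF assms(1)] isA_bc[OF assms(1)] assms(2,3) by (simp add: SL_domain_def)
  show "AE z in lebesgue_on {0..1}. SL_op p r q F z = \<mu> * F z"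
    by (rule AE_unitI) (rule isA_SL_op[OF assms(1)])
  show "\<not> (AE z in lebesgue_on {0..1}. F z = 0)"
  proof
    assume ae: "AE z in lebesgue_on {0..1}. F z = 0"
    have "ip F F = 0"
      unfolding l2_inner_def by (rule integral_eq_zero_AE) (use ae in auto)
    then show False using ip_zeroD[OF isAD(4)[OF assms(1)]] assms(4,5) by auto
  qed
qed

end

section \<open>Completeness of the eigenfunctions\<close>

context sturm
begin

lemma isA_F_zero:
  assumes "isA F P h" "\<And>z. z \<in> {0..1} \<Longrightarrow> F z = 0" "z \<in> {0..1}"
  shows "P z = 0" "h z = 0"
proof -
  have A: "isA (\<lambda>_. 0) P h" by (rule isA_cong[OF assms(1)]) (use assms(2) in auto)
  have "P z / p z = 0" using isA_dz(1)[OF A assms(3)] isA_dz(1)[OF isA_zero assms(3)] by simp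
  then show "P z = 0" using p_pos[OF assms(3)] by auto
  show "h z = 0" using isA_SL_op[OF A assms(3)] isA_SL_op[OF isA_zero assms(3)] by simp
qed

text \<open>The initial pair \<open>(b2, - b1 * p 0)\<close> spans the kernel of the left boundary
  functional, so \<open>u\<close> is the shooting solution from the left end.\<close>

lemma left_solution:
  "\<exists>u w. isA u w (\<lambda>z. \<mu> * u z) \<and> bcL u w = 0 \<and> u 0 = b2 \<and> w 0 = - b1 * p 0"
proof -
  have p0: "p 0 > 0" by (rule p_pos) auto
  obtain u w where "isA u w (\<lambda>z. 0 + \<mu> * u z)" "u 0 = b2" "w 0 = - b1 * p 0"
    using isA_ivp[of "\<lambda>_. 0" \<mu> b2 "- b1 * p 0"] by auto
  then show ?thesis using p0 by (intro exI[of _ u] exI[of _ w]) (auto simp: bcL_def)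
qed

lemma not_eigenvalue_zero:
  assumes "isA F P (\<lambda>z. \<mu> * F z)" "bcL F P = 0" "bcR F P = 0" "\<not> SL_eigenvalue p r q a1 a2 b1 b2 \<mu>"
    "z \<in> {0..1}"
  shows "F z = 0" "P z = 0"
  using isA_eigenvalue[OF assms(1-3)] assms(4) isA_F_zero[OF assms(1) _ assms(5)] assms(5) by blast+

text \<open>A zero of the shooting function would make \<open>u\<close> satisfy both boundary
  conditions. As \<open>\<mu>\<close> is no eigenvalue, \<open>u\<close> and its flux would vanish,
  against their initial values.\<close>

lemma left_solution_bcR:
  assumes "isA u w (\<lambda>z. \<mu> * u z)" "bcL u w = 0" "u 0 = b2" "w 0 = - b1 * p 0"
    and "\<not> SL_eigenvalue p r q a1 a2 b1 b2 \<mu>"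
  shows "bcR u w \<noteq> 0"
proof
  assume "bcR u w = 0"
  then have "u 0 = 0" "w 0 = 0" using not_eigenvalue_zero[OF assms(1,2) _ assms(5), of 0] by auto
  then show False using assms(3,4) b_nz p_pos[of 0] by auto
qed

lemma bcL_zero_data: "F 0 = 0 \<Longrightarrow> P 0 = 0 \<Longrightarrow> bcL F P = 0"
  by (simp add: bcL_def)

text \<open>Shooting: the solution with zero data at 0 meets the left condition, and a multiple of
  the left solution \<open>u\<close>, whose right boundary value is nonzero, corrects the right one.
  The bounds come from the energy estimate; the one for the flux later yields
  equicontinuity.\<close>

lemma bvp_solution:
  assumes "\<not> SL_eigenvalue p r q a1 a2 b1 b2 \<mu>"
  shows "\<exists>C>0. \<forall>f. continuous_on {0..1} f \<longrightarrow> (\<exists>F P. isA F P (\<lambda>z. f z + \<mu> * F z) \<and> bcL F P = 0 \<and> bcR F P = 0 \<and>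
    (\<forall>z\<in>{0..1}. \<bar>F z\<bar> \<le> C * nrm f \<and> \<bar>P z\<bar> \<le> C * nrm f))"
proof -
  obtain u w where u: "isA u w (\<lambda>z. \<mu> * u z)" "bcL u w = 0" "u 0 = b2" "w 0 = - b1 * p 0"
    using left_solution[of \<mu>] by blast
  have nz: "bcR u w \<noteq> 0" using left_solution_bcR[OF u assms] .
  obtain U where U: "U > 0" "\<And>z. z \<in> {0..1} \<Longrightarrow> \<bar>u z\<bar> \<le> U" using bounded_on_unit[OF isAD(4)[OF u(1)]] by blast
  obtain W where W: "W > 0" "\<And>z. z \<in> {0..1} \<Longrightarrow> \<bar>w z\<bar> \<le> W" using bounded_on_unit[OF isAD(5)[OF u(1)]] by blast
  obtain C0 where C0: "C0 > 0" "\<forall>F P f. isA F P (\<lambda>z. f z + \<mu> * F z) \<longrightarrow> continuous_on {0..1} f \<longrightarrow>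
     (\<forall>z\<in>{0..1}. (F z)\<^sup>2 + (P z)\<^sup>2 \<le> C0 * ((F 0)\<^sup>2 + (P 0)\<^sup>2 + (nrm f)\<^sup>2))"
    using isA_energy[of \<mu>] by blast
  define S where "S = sqrt C0"
  have S: "S > 0" using C0 by (simp add: S_def)
  \<comment> \<open>\<open>A * nrm f\<close> will bound the coefficient of \<open>u\<close> in the
    correction, since \<open>F 1\<close> and \<open>P 1\<close> are at most \<open>S * nrm f\<close>
    in modulus.\<close>
  define A where "A = (\<bar>a1\<bar> + \<bar>a2\<bar> / p 1) * S / \<bar>bcR u w\<bar>"
  have p1: "p 1 > 0" by (rule p_pos) auto
  have A: "A \<ge> 0" using S p1 by (simp add: A_def)
  show ?thesis
  proof (intro exI[of _ "S + A * (U + W)"] conjI allI impI)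
    show "S + A * (U + W) > 0" using S A U W by (intro add_pos_nonneg mult_nonneg_nonneg) auto
    fix f :: "real \<Rightarrow> real" assume f: "continuous_on {0..1} f"
    obtain F P where F: "isA F P (\<lambda>z. f z + \<mu> * F z)" "F 0 = 0" "P 0 = 0"
      using isA_ivp[OF f] by blast
    have FP: "\<bar>F z\<bar> \<le> S * nrm f" "\<bar>P z\<bar> \<le> S * nrm f" if "z \<in> {0..1}" for z
    proof -
      have "(F z)\<^sup>2 + (P z)\<^sup>2 \<le> (S * nrm f)\<^sup>2"
        using C0 F f that by (fastforce simp: S_def power_mult_distrib)
      then have "\<bar>F z\<bar>\<^sup>2 \<le> (S * nrm f)\<^sup>2" "\<bar>P z\<bar>\<^sup>2 \<le> (S * nrm f)\<^sup>2"
        using zero_le_power2[of "F z"] zero_le_power2[of "P z"] unfolding power2_abs by linarith+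
      then show "\<bar>F z\<bar> \<le> S * nrm f" "\<bar>P z\<bar> \<le> S * nrm f"
        using S nrm_nonneg[of f] by (auto intro: power2_le_imp_le)
    qed
    define c where "c = - bcR F P / bcR u w"
    have c: "\<bar>c\<bar> \<le> A * nrm f"
    proof -
      have "\<bar>bcR F P\<bar> \<le> \<bar>a1\<bar> * \<bar>F 1\<bar> + \<bar>a2\<bar> * \<bar>P 1\<bar> / p 1"
        unfolding bcR_def using p1 by (simp add: abs_mult abs_triangle_ineq[THEN order_trans])
      also have "\<dots> \<le> \<bar>a1\<bar> * (S * nrm f) + \<bar>a2\<bar> * (S * nrm f) / p 1"
        using FP[of 1] p1 by (intro add_mono divide_right_mono mult_left_mono) auto
      also have "\<dots> = (\<bar>a1\<bar> + \<bar>a2\<bar> / p 1) * S * nrm f" by (simp add: algebra_simps)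
      finally show ?thesis using nz by (simp add: c_def A_def abs_divide field_simps)
    qed
    have cb: "\<bar>c * x\<bar> \<le> A * nrm f * B" if "\<bar>x\<bar> \<le> B" for x B
      unfolding abs_mult using c that A nrm_nonneg[of f] by (intro mult_mono) auto
    show "\<exists>F P. isA F P (\<lambda>z. f z + \<mu> * F z) \<and> bcL F P = 0 \<and> bcR F P = 0 \<and>
      (\<forall>z\<in>{0..1}. \<bar>F z\<bar> \<le> (S + A * (U + W)) * nrm f \<and> \<bar>P z\<bar> \<le> (S + A * (U + W)) * nrm f)"
    proof (intro exI conjI ballI)
      have "isA (\<lambda>z. F z + c * u z) (\<lambda>z. P z + c * w z) (\<lambda>z. (f z + \<mu> * F z) + c * (\<mu> * u z))"
        by (intro isA_add isA_scale F u)
      then show "isA (\<lambda>z. F z + c * u z) (\<lambda>z. P z + c * w z) (\<lambda>z. f z + \<mu> * (F z + c * u z))"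
        by (simp add: algebra_simps)
      show "bcL (\<lambda>z. F z + c * u z) (\<lambda>z. P z + c * w z) = 0"
        using bcL_zero_data[of F P] F(2,3) u(2) by (simp add: bc_linear)
      show "bcR (\<lambda>z. F z + c * u z) (\<lambda>z. P z + c * w z) = 0"
        unfolding bc_linear using nz by (simp add: c_def)
      fix z :: real assume z: "z \<in> {0..1}"
      have n: "0 \<le> A * nrm f * U" "0 \<le> A * nrm f * W"
        using A U W nrm_nonneg[of f] by auto
      have "\<bar>F z + c * u z\<bar> \<le> S * nrm f + A * nrm f * U"
        using FP(1)[OF z] cb[OF U(2)[OF z]] by linarith
      then show "\<bar>F z + c * u z\<bar> \<le> (S + A * (U + W)) * nrm f" using n by (simp add: algebra_simps)
      have "\<bar>P z + c * w z\<bar> \<le> S * nrm f + A * nrm f * W"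
        using FP(2)[OF z] cb[OF W(2)[OF z]] by linarith
      then show "\<bar>P z + c * w z\<bar> \<le> (S + A * (U + W)) * nrm f" using n by (simp add: algebra_simps)
    qed
  qed
qed

end

section \<open>Eigenfunctions and the solution operator below the spectrum\<close>

locale sturm_eigen = sturm +
  fixes lam :: "nat \<Rightarrow> real" and phi :: "nat \<Rightarrow> real \<Rightarrow> real"
  assumes eigensystem: "SL_eigensystem p r q a1 a2 b1 b2 lam phi"
begin

definition psi :: "nat \<Rightarrow> real \<Rightarrow> real" where
  "psi n z = p z * dz (phi n) z"

lemma lam_less: "1 \<le> i \<Longrightarrow> i < j \<Longrightarrow> lam i < lam j"
  using eigensystem by (auto simp: SL_eigensystem_def strict_mono_on_def)

lemma lam_le: "1 \<le> i \<Longrightarrow> i \<le> j \<Longrightarrow> lam i \<le> lam j"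
  using lam_less[of i j] by (cases "i = j") auto

lemma eigenvalue_iff: "SL_eigenvalue p r q a1 a2 b1 b2 \<mu> \<longleftrightarrow> (\<exists>j\<ge>1. \<mu> = lam j)"
  using eigensystem by (auto simp: SL_eigensystem_def image_iff set_eq_iff)

lemma phi_isA:
  assumes "n \<ge> 1" shows "isA (phi n) (psi n) (\<lambda>z. lam n * phi n z)"
proof -
  have "isA (phi n) (\<lambda>z. p z * dz (phi n) z) (SL_op p r q (phi n))"
    using eigensystem assms by (intro C2_isA) (auto simp: SL_eigensystem_def)
  then show ?thesis
    by (rule isA_cong) (use eigensystem assms in \<open>auto simp: SL_eigensystem_def psi_def\<close>)
qed

lemma phi_bc: "n \<ge> 1 \<Longrightarrow> bcL (phi n) (psi n) = 0" "n \<ge> 1 \<Longrightarrow> bcR (phi n) (psi n) = 0"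
  using eigensystem isA_bc[OF phi_isA] by (auto simp: SL_eigensystem_def)

lemma phi_orth: "i \<ge> 1 \<Longrightarrow> j \<ge> 1 \<Longrightarrow> ip (phi i) (phi j) = (if i = j then 1 else 0)"
  using eigensystem by (auto simp: SL_eigensystem_def)

lemma phi_cont: "n \<ge> 1 \<Longrightarrow> continuous_on {0..1} (phi n)"
  using isAD(4)[OF phi_isA] .

lemma phi_L2: "n \<ge> 1 \<Longrightarrow> phi n \<in> L2 r"
  using L2_cont[OF phi_cont] .

text \<open>The left boundary condition determines the initial data up to a factor, by the vanishing
  Wronskian, and the initial data determine the solution.\<close>

lemma eigen_simple:
  assumes "isA F P (\<lambda>z. lam j * F z)" "bcL F P = 0" "j \<ge> 1"
  obtains c where "\<And>z. z \<in> {0..1} \<Longrightarrow> F z = c * phi j z"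
proof -
  have nz: "phi j 0 \<noteq> 0 \<or> psi j 0 \<noteq> 0"
  proof (rule ccontr)
    assume "\<not> ?thesis"
    then have "phi j z = 0" if "z \<in> {0..1}" for z
      using isA_zero_data(1)[OF phi_isA[OF assms(3)] _ _ that] by auto
    then have "ip (phi j) (phi j) = ip (\<lambda>_. 0) (\<lambda>_. 0)" by (intro ip_cong) auto
    then show False using phi_orth[OF assms(3,3)] by (simp add: l2_inner_def)
  qed
  have w: "F 0 * psi j 0 - P 0 * phi j 0 = 0" by (rule bcL_wronskian[OF assms(2) phi_bc(1)[OF assms(3)]])
  obtain c where c: "F 0 - c * phi j 0 = 0" "P 0 - c * psi j 0 = 0"
  proof (cases "phi j 0 = 0")
    case True
    then show ?thesis using that[of "P 0 / psi j 0"] nz w by auto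
  next
    case False
    then show ?thesis using that[of "F 0 / phi j 0"] w by (auto simp: field_simps)
  qed
  have "isA (\<lambda>z. F z - c * phi j z) (\<lambda>z. P z - c * psi j z) (\<lambda>z. lam j * F z - c * (lam j * phi j z))"
    by (intro isA_diff isA_scale phi_isA assms)
  then have "isA (\<lambda>z. F z - c * phi j z) (\<lambda>z. P z - c * psi j z) (\<lambda>z. lam j * (F z - c * phi j z))"
    by (simp add: algebra_simps)
  from isA_zero_data(1)[OF this] c show ?thesis by (intro that[of c]) auto
qed

definition mu0 :: real where "mu0 = lam 1 - 1"

lemma mu0_less: "n \<ge> 1 \<Longrightarrow> mu0 < lam n"
  using lam_le[of 1 n] by (simp add: mu0_def)

lemma mu0_not_eigenvalue: "\<not> SL_eigenvalue p r q a1 a2 b1 b2 mu0"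
  unfolding eigenvalue_iff using mu0_less by force

text \<open>A solution of the boundary value problem together with its flux, fixed by choice. It is
  determined only on the unit interval, so identities for \<open>K\<close> hold pointwise there, and
  congruence in the argument needs a proof (\<open>K_cong\<close>).\<close>

definition KK :: "(real \<Rightarrow> real) \<Rightarrow> (real \<Rightarrow> real) \<times> (real \<Rightarrow> real)" where
  "KK f = (SOME FP. isA (fst FP) (snd FP) (\<lambda>z. f z + mu0 * fst FP z) \<and> bcL (fst FP) (snd FP) = 0 \<and> bcR (fst FP) (snd FP) = 0)"
definition K :: "(real \<Rightarrow> real) \<Rightarrow> real \<Rightarrow> real" where "K f = fst (KK f)"
definition KP :: "(real \<Rightarrow> real) \<Rightarrow> real \<Rightarrow> real" where "KP f = snd (KK f)"

lemma K_spec: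
  assumes "continuous_on {0..1} f"
  shows "isA (K f) (KP f) (\<lambda>z. f z + mu0 * K f z)" "bcL (K f) (KP f) = 0" "bcR (K f) (KP f) = 0"
proof -
  obtain F P where "isA F P (\<lambda>z. f z + mu0 * F z)" "bcL F P = 0" "bcR F P = 0"
    using bvp_solution[OF mu0_not_eigenvalue] assms by metis
  then have "\<exists>FP. isA (fst FP) (snd FP) (\<lambda>z. f z + mu0 * fst FP z) \<and> bcL (fst FP) (snd FP) = 0 \<and> bcR (fst FP) (snd FP) = 0"
    by (intro exI[of _ "(F, P)"]) auto
  from someI_ex[OF this] show "isA (K f) (KP f) (\<lambda>z. f z + mu0 * K f z)" "bcL (K f) (KP f) = 0" "bcR (K f) (KP f) = 0"
    unfolding K_def KP_def KK_def by auto
qed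

lemma K_cont: "continuous_on {0..1} f \<Longrightarrow> continuous_on {0..1} (K f)"
  using isAD(4)[OF K_spec(1)] .

lemma K_unique:
  assumes "continuous_on {0..1} f" "isA F P (\<lambda>z. f z + mu0 * F z)" "bcL F P = 0" "bcR F P = 0" "z \<in> {0..1}"
  shows "K f z = F z" "KP f z = P z"
proof -
  have "isA (\<lambda>z. K f z - F z) (\<lambda>z. KP f z - P z) (\<lambda>z. (f z + mu0 * K f z) - (f z + mu0 * F z))"
    by (intro isA_diff K_spec assms)
  then have "isA (\<lambda>z. K f z - F z) (\<lambda>z. KP f z - P z) (\<lambda>z. mu0 * (K f z - F z))"
    by (simp add: algebra_simps)
  from not_eigenvalue_zero[OF this _ _ mu0_not_eigenvalue assms(5)]
  show "K f z = F z" "KP f z = P z"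
    using K_spec[OF assms(1)] assms by (simp_all add: bc_linear)
qed

text \<open>The Lipschitz bound comes from the derivative \<open>KP f / p\<close> of
  \<open>K f\<close>. Both bounds are uniform over functions of norm at most 1, as Arzela-Ascoli
  asks.\<close>

lemma K_bound:
  "\<exists>C>0. \<forall>f. continuous_on {0..1} f \<longrightarrow> (\<forall>z\<in>{0..1}. \<bar>K f z\<bar> \<le> C * nrm f) \<and>
     (\<forall>x\<in>{0..1}. \<forall>y\<in>{0..1}. \<bar>K f x - K f y\<bar> \<le> C * nrm f * \<bar>x - y\<bar>)"
proof -
  obtain C where C: "C > 0" "\<And>f. continuous_on {0..1} f \<Longrightarrow> \<exists>F P. isA F P (\<lambda>z. f z + mu0 * F z) \<and> bcL F P = 0 \<and> bcR F P = 0 \<and>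
    (\<forall>z\<in>{0..1}. \<bar>F z\<bar> \<le> C * nrm f \<and> \<bar>P z\<bar> \<le> C * nrm f)"
    using bvp_solution[OF mu0_not_eigenvalue] by blast
  have pnz: "p z \<noteq> 0" if "0 \<le> z" "z \<le> 1" for z using p_pos[of z] that by auto
  have "continuous_on {0..1} (\<lambda>z. 1 / p z)" using p_cont pnz by (intro continuous_intros) auto
  then obtain B where B: "B > 0" "\<And>z. z \<in> {0..1} \<Longrightarrow> \<bar>1 / p z\<bar> \<le> B"
    using bounded_on_unit by blast
  have bd: "\<bar>K f z\<bar> \<le> C * nrm f \<and> \<bar>KP f z\<bar> \<le> C * nrm f" if f: "continuous_on {0..1} f" and z: "z \<in> {0..1}" for f z
  proof -
    obtain F P where "isA F P (\<lambda>z. f z + mu0 * F z)" "bcL F P = 0" "bcR F P = 0"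
      "\<forall>z\<in>{0..1}. \<bar>F z\<bar> \<le> C * nrm f \<and> \<bar>P z\<bar> \<le> C * nrm f" using C(2)[OF f] by blast
    then show ?thesis using K_unique[OF f, of F P z] z by auto
  qed
  show ?thesis
  proof (intro exI[of _ "C + B * C"] conjI allI impI ballI)
    show "C + B * C > 0" using B C by (simp add: add_pos_pos)
    fix f :: "real \<Rightarrow> real" assume f: "continuous_on {0..1} f"
    have n: "0 \<le> B * C * nrm f" "0 \<le> C * nrm f" using B C nrm_nonneg[of f] by auto
    show "\<bar>K f z\<bar> \<le> (C + B * C) * nrm f" if "z \<in> {0..1}" for z
      using bd[OF f that] n by (simp add: algebra_simps)
    fix x y :: real assume xy: "x \<in> {0..1}" "y \<in> {0..1}"
    have "norm (K f x - K f y) \<le> B * (C * nrm f) * norm (x - y)"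
    proof (rule field_differentiable_bound[where S = "{0..1}" and f' = "\<lambda>z. KP f z / p z"])
      fix z :: real assume z: "z \<in> {0..1}"
      show "(K f has_real_derivative KP f z / p z) (at z within {0..1})"
        by (rule isAD(2)[OF K_spec(1)[OF f] z])
      have "\<bar>1 / p z\<bar> * \<bar>KP f z\<bar> \<le> B * (C * nrm f)"
        using bd[OF f z] B(2)[OF z] B(1) by (intro mult_mono) auto
      then show "norm (KP f z / p z) \<le> B * (C * nrm f)" by (simp add: abs_divide)
    qed (use xy in auto)
    also have "\<dots> \<le> (C + B * C) * nrm f * \<bar>x - y\<bar>"
      using mult_nonneg_nonneg[OF n(2) abs_ge_zero[of "x - y"]] by (simp add: algebra_simps)
    finally show "\<bar>K f x - K f y\<bar> \<le> (C + B * C) * nrm f * \<bar>x - y\<bar>" by simp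
  qed
qed

lemma K_scale:
  assumes "continuous_on {0..1} f" "z \<in> {0..1}"
  shows "K (\<lambda>z. c * f z) z = c * K f z"
proof (rule K_unique(1))
  show "isA (\<lambda>z. c * K f z) (\<lambda>z. c * KP f z) (\<lambda>z. c * f z + mu0 * (c * K f z))"
    using isA_scale[OF K_spec(1)[OF assms(1)], of c] by (simp add: algebra_simps)
qed (use assms K_spec in \<open>auto simp: bc_linear intro!: continuous_intros\<close>)

lemma K_add:
  assumes "continuous_on {0..1} f" "continuous_on {0..1} g" "z \<in> {0..1}"
  shows "K (\<lambda>z. f z + g z) z = K f z + K g z"
proof (rule K_unique(1))
  show "isA (\<lambda>z. K f z + K g z) (\<lambda>z. KP f z + KP g z) (\<lambda>z. f z + g z + mu0 * (K f z + K g z))"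
    using isA_add[OF K_spec(1)[OF assms(1)] K_spec(1)[OF assms(2)]] by (simp add: algebra_simps)
qed (use assms K_spec in \<open>auto simp: bc_linear intro!: continuous_intros\<close>)

lemma K_diff:
  assumes "continuous_on {0..1} f" "continuous_on {0..1} g" "z \<in> {0..1}"
  shows "K (\<lambda>z. f z - g z) z = K f z - K g z"
  using K_add[OF assms(1) _ assms(3), of "\<lambda>z. -1 * g z"] K_scale[OF assms(2,3), of "-1"] assms(2)
  by (auto intro: continuous_intros)

lemma K_cong:
  assumes "continuous_on {0..1} f" "\<And>z. z \<in> {0..1} \<Longrightarrow> f z = g z" "z \<in> {0..1}"
  shows "K f z = K g z"
proof (rule K_unique(1))
  have "continuous_on {0..1} g" using assms(1,2) by (rule continuous_on_eq)
  then show "isA (K g) (KP g) (\<lambda>z. f z + mu0 * K g z)"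
    by (rule isA_cong[OF K_spec(1)]) (use assms(2) in auto)
  show "bcL (K g) (KP g) = 0" "bcR (K g) (KP g) = 0" using K_spec \<open>continuous_on {0..1} g\<close> by auto
qed (use assms in auto)

lemma K_self_adjoint:
  assumes "continuous_on {0..1} f" "continuous_on {0..1} g"
  shows "ip (K f) g = ip f (K g)"
proof -
  have L: "f \<in> L2 r" "g \<in> L2 r" "K f \<in> L2 r" "K g \<in> L2 r" using assms K_cont L2_cont by auto
  have "ip (\<lambda>z. f z + mu0 * K f z) (K g) = ip (K f) (\<lambda>z. g z + mu0 * K g z)"
    by (rule self_adjoint[OF K_spec(1)[OF assms(1)] K_spec(1)[OF assms(2)]])
      (simp_all add: K_spec assms)
  then show ?thesis using L by (simp add: ip_add_left ip_add_right L2_scale ip_scale_left ip_scale_right)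
qed

lemma K_phi:
  assumes "n \<ge> 1" "z \<in> {0..1}"
  shows "K (phi n) z = 1 / (lam n - mu0) * phi n z"
proof (rule K_unique(1))
  have "(\<lambda>z. 1 / (lam n - mu0) * (lam n * phi n z)) = (\<lambda>z. phi n z + mu0 * (1 / (lam n - mu0) * phi n z))"
    using mu0_less[OF assms(1)] by (auto simp: field_simps)
  then show "isA (\<lambda>z. 1 / (lam n - mu0) * phi n z) (\<lambda>z. 1 / (lam n - mu0) * psi n z)
      (\<lambda>z. phi n z + mu0 * (1 / (lam n - mu0) * phi n z))"
    using isA_scale[OF phi_isA[OF assms(1)], of "1 / (lam n - mu0)"] by simp
  show "bcL (\<lambda>z. 1 / (lam n - mu0) * phi n z) (\<lambda>z. 1 / (lam n - mu0) * psi n z) = 0"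
    "bcR (\<lambda>z. 1 / (lam n - mu0) * phi n z) (\<lambda>z. 1 / (lam n - mu0) * psi n z) = 0"
    unfolding bc_linear phi_bc[OF assms(1)] by simp_all
qed (use assms phi_cont in auto)

lemma K_eq_zeroD:
  assumes "continuous_on {0..1} f" "\<And>z. z \<in> {0..1} \<Longrightarrow> K f z = 0" "z \<in> {0..1}"
  shows "f z = 0"
  using isA_F_zero(2)[OF K_spec(1)[OF assms(1)] assms(2,3)] assms(2)[OF assms(3)] by simp

text \<open>Continuity is included because \<open>K\<close> is controlled on continuous functions
  only.\<close>

definition orth :: "(real \<Rightarrow> real) \<Rightarrow> bool" where
  "orth f \<longleftrightarrow> continuous_on {0..1} f \<and> (\<forall>n\<ge>1. ip f (phi n) = 0)"

lemma orth_K: assumes "orth f" shows "orth (K f)"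
  unfolding orth_def
proof (intro conjI allI impI)
  have f: "continuous_on {0..1} f" using assms by (simp add: orth_def)
  then show "continuous_on {0..1} (K f)" by (rule K_cont)
  fix n :: nat assume n: "n \<ge> 1"
  have "ip (K f) (phi n) = ip f (K (phi n))" by (rule K_self_adjoint[OF f phi_cont[OF n]])
  also have "\<dots> = ip f (\<lambda>z. 1 / (lam n - mu0) * phi n z)" by (rule ip_cong) (simp_all add: K_phi[OF n])
  also have "\<dots> = 0" unfolding ip_scale_right using assms n by (simp add: orth_def)
  finally show "ip (K f) (phi n) = 0" .
qed

lemma orth_scale: "orth f \<Longrightarrow> orth (\<lambda>z. c * f z)"
  by (auto simp: orth_def ip_scale_left intro!: continuous_intros)

lemma orth_add: "orth f \<Longrightarrow> orth g \<Longrightarrow> orth (\<lambda>z. f z + g z)"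
  by (auto simp: orth_def ip_add_left L2_cont phi_L2 intro!: continuous_intros)

text \<open>\<open>K f = \<sigma> f\<close> means that \<open>K f\<close>, if nonzero, is an
  eigenfunction of \<open>A\<close> for \<open>1 / \<sigma> + mu0\<close>, hence a multiple of some
  \<open>phi j\<close> by simplicity; orthogonality makes the factor zero.\<close>

lemma orth_eigen_zero:
  assumes "orth f" "\<sigma> \<noteq> 0" "\<And>z. z \<in> {0..1} \<Longrightarrow> K f z = \<sigma> * f z" "z \<in> {0..1}"
  shows "f z = 0"
proof (rule ccontr)
  assume "f z \<noteq> 0"
  then have nz: "K f z \<noteq> 0" using assms by simp
  have f: "continuous_on {0..1} f" using assms by (simp add: orth_def)
  have A: "isA (K f) (KP f) (\<lambda>z. (1 / \<sigma> + mu0) * K f z)"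
    by (rule isA_cong[OF K_spec(1)[OF f]]) (use assms in \<open>auto simp: algebra_simps\<close>)
  obtain j where j: "j \<ge> 1" "1 / \<sigma> + mu0 = lam j"
    using isA_eigenvalue[OF A K_spec(2,3)[OF f] assms(4) nz] eigenvalue_iff by auto
  obtain c where c: "\<And>z. z \<in> {0..1} \<Longrightarrow> K f z = c * phi j z"
    using eigen_simple[OF A[unfolded j(2)] K_spec(2)[OF f] j(1)] by metis
  have "0 = ip (K f) (phi j)" using orth_K[OF assms(1)] j by (simp add: orth_def)
  also have "\<dots> = ip (\<lambda>z. c * phi j z) (phi j)" by (rule ip_cong) (use c in auto)
  also have "\<dots> = c" using phi_orth[OF j(1) j(1)] by (simp add: ip_scale_left)
  finally show False using c[OF assms(4)] nz by simp
qed

theorem orth_zero: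
  assumes "orth f" "z \<in> {0..1}"
  shows "f z = 0"
proof (rule ccontr)
  assume fz: "f z \<noteq> 0"
  have orth_cont: "continuous_on {0..1} g" if "orth g" for g using that by (simp add: orth_def)
  have orth_L2: "g \<in> L2 r" if "orth g" for g using orth_cont[OF that] L2_cont by blast
  obtain C where C: "C > 0" "\<And>f z. continuous_on {0..1} f \<Longrightarrow> z \<in> {0..1} \<Longrightarrow> \<bar>K f z\<bar> \<le> C * nrm f"
     "\<And>f x y. continuous_on {0..1} f \<Longrightarrow> x \<in> {0..1} \<Longrightarrow> y \<in> {0..1} \<Longrightarrow> \<bar>K f x - K f y\<bar> \<le> C * nrm f * \<bar>x - y\<bar>"
    using K_bound by metis
  define N1 where "N1 = nrm (\<lambda>_. 1)"
  have K_nrm: "nrm (K g) \<le> C * nrm g * N1" if "orth g" for g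
    unfolding N1_def using C orth_cont[OF that] nrm_nonneg[of g]
    by (intro nrm_le_sup L2_cont K_cont) auto
  define S where "S = {nrm (K g) | g. orth g \<and> nrm g \<le> 1}"
  have S_bdd: "bdd_above S"
  proof (rule bdd_aboveI[of _ "C * N1"])
    fix x assume "x \<in> S"
    then obtain g where g: "orth g" "nrm g \<le> 1" "x = nrm (K g)" by (auto simp: S_def)
    have "C * nrm g * N1 \<le> C * 1 * N1"
      using g C(1) nrm_one_pos by (intro mult_right_mono mult_left_mono) (auto simp: N1_def)
    then show "x \<le> C * N1" using K_nrm[OF g(1)] g(3) by linarith
  qed
  \<comment> \<open>The operator norm of \<open>K\<close> on the continuous functions orthogonal to
    all \<open>phi n\<close>.\<close>
  define \<kappa> where "\<kappa> = Sup S"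
  have K_le: "nrm (K g) \<le> \<kappa> * nrm g" if g: "orth g" for g
  proof (cases "nrm g = 0")
    case True
    then show ?thesis using K_nrm[OF g] by simp
  next
    case False
    then have pos: "nrm g > 0" using nrm_nonneg[of g] by linarith
    let ?g = "\<lambda>z. 1 / nrm g * g z"
    have "nrm (K ?g) \<in> S"
      unfolding S_def mem_Collect_eq
      by (rule exI[of _ ?g]) (use orth_scale[OF g, of "1 / nrm g"] pos in \<open>auto simp: nrm_scale[of "1 / nrm g", simplified]\<close>)
    moreover have "nrm (K ?g) = nrm (\<lambda>z. 1 / nrm g * K g z)" by (rule nrm_cong) (rule K_scale[OF orth_cont[OF g]])
    ultimately have "1 / nrm g * nrm (K g) \<in> S" unfolding nrm_scale using pos by simp
    then have "1 / nrm g * nrm (K g) \<le> \<kappa>" unfolding \<kappa>_def by (rule cSup_upper[OF _ S_bdd])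
    then show ?thesis using pos by (simp add: field_simps)
  qed
  \<comment> \<open>Otherwise \<open>K f\<close> vanishes, and then so does \<open>f\<close>, which
    is recovered as \<open>(A - mu0) (K f)\<close>.\<close>
  have \<kappa>_pos: "\<kappa> > 0"
  proof (rule ccontr)
    assume "\<not> \<kappa> > 0"
    then have "\<kappa> * nrm f \<le> 0" using nrm_nonneg[of f] by (simp add: mult_nonpos_nonneg)
    then have "nrm (K f) = 0" using K_le[OF assms(1)] nrm_nonneg[of "K f"] by linarith
    then have "K f y = 0" if "y \<in> {0..1}" for y
      using nrm_zeroD[OF K_cont[OF orth_cont[OF assms(1)]] _ that] by simp
    then show False using K_eq_zeroD[OF orth_cont[OF assms(1)] _ assms(2)] fz by auto
  qed
  have "nrm (K (\<lambda>_. 0)) \<in> S"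
    unfolding S_def by (auto simp: orth_def l2_inner_def intro!: exI[of _ "\<lambda>_. 0"])
  then have S_ne: "S \<noteq> {}" by auto
  have "\<exists>g. orth g \<and> nrm g \<le> 1 \<and> \<kappa> - 1 / real (Suc n) < nrm (K g)" for n
  proof -
    have "\<kappa> - 1 / real (Suc n) < Sup S" by (simp add: \<kappa>_def)
    then obtain x where "x \<in> S" "\<kappa> - 1 / real (Suc n) < x" using less_cSup_iff[OF S_ne S_bdd] by auto
    then show ?thesis by (auto simp: S_def)
  qed
  then obtain G where G: "\<And>n. orth (G n)" "\<And>n. nrm (G n) \<le> 1" "\<And>n. \<kappa> - 1 / real (Suc n) < nrm (K (G n))"
    by metis
  have Gb: "\<bar>K (G n) x\<bar> \<le> C" if "x \<in> {0..1}" for n x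
    using C(2)[OF orth_cont[OF G(1)] that, of n] G(2)[of n] mult_left_mono[OF G(2)[of n] less_imp_le[OF C(1)]] by linarith
  have Gl: "\<bar>K (G n) x - K (G n) y\<bar> \<le> C * \<bar>x - y\<bar>" if "x \<in> {0..1}" "y \<in> {0..1}" for n x y
  proof -
    have "C * nrm (G n) * \<bar>x - y\<bar> \<le> C * 1 * \<bar>x - y\<bar>"
      using G(2)[of n] C(1) by (intro mult_right_mono mult_left_mono) auto
    then show ?thesis using C(3)[OF orth_cont[OF G(1)] that, of n] by simp
  qed
  \<comment> \<open>The maximising sequence itself need not converge, but its images under
    \<open>K\<close> are equicontinuous and have a uniformly convergent subsequence. The limit
    \<open>g\<close> of these images is the candidate.\<close>
  obtain g k where g: "continuous_on {0..1} g" "strict_mono (k :: nat \<Rightarrow> nat)"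
    "\<And>e. 0 < e \<Longrightarrow> \<exists>N. \<forall>n x. n \<ge> N \<and> x \<in> {0..1} \<longrightarrow> norm (K (G (k n)) x - g x) < e"
  proof (rule Arzela_Ascoli[of "{0..1::real}" "\<lambda>n. K (G n)" C])
    show "norm (K (G n) x) \<le> C" if "x \<in> {0..1}" for n x using Gb[OF that] by simp
    fix x e :: real assume x: "x \<in> {0..1}" and e: "0 < e"
    show "\<exists>d. 0 < d \<and> (\<forall>n y. y \<in> {0..1} \<and> norm (x - y) < d \<longrightarrow> norm (K (G n) x - K (G n) y) < e)"
    proof (intro exI[of _ "e / C"] conjI allI impI)
      show "0 < e / C" using e C by simp
      fix n y assume y: "y \<in> {0..1} \<and> norm (x - y) < e / C"
      then have "C * \<bar>x - y\<bar> < e" using C(1) by (simp add: field_simps)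
      then show "norm (K (G n) x - K (G n) y) < e" using Gl[OF x, of y n] y by auto
    qed
  qed auto
  define H where "H n = K (G (k n))" for n
  have oG: "orth (G (k n))" and oH: "orth (H n)" for n using G(1) orth_K by (auto simp: H_def)
  have "uniform_limit {0..1} H g sequentially"
  proof (rule uniform_limitI)
    fix e :: real assume "e > 0"
    then obtain N where "\<forall>n x. n \<ge> N \<and> x \<in> {0..1} \<longrightarrow> norm (K (G (k n)) x - g x) < e"
      using g(3) by blast
    then show "\<forall>\<^sub>F n in sequentially. \<forall>x\<in>{0..1}. dist (H n x) (g x) < e"
      unfolding eventually_sequentially dist_real_def H_def by (intro exI[of _ N]) auto
  qed
  then have Hg: "(\<lambda>n. nrm (\<lambda>z. H n z - g z)) \<longlonglongrightarrow> 0"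
    by (rule uniform_limit_nrm[OF _ orth_L2[OF oH] L2_cont[OF g(1)]])
  have og: "orth g"
    unfolding orth_def
  proof (intro conjI allI impI g(1))
    fix n :: nat assume n: "n \<ge> 1"
    have "(\<lambda>i. ip (H i) (phi n)) \<longlonglongrightarrow> ip g (phi n)"
      by (rule ip_tendsto[OF Hg orth_L2[OF oH] L2_cont[OF g(1)] phi_L2[OF n]])
    moreover have "(\<lambda>i. ip (H i) (phi n)) = (\<lambda>_. 0)" using oH n by (auto simp: orth_def)
    ultimately show "ip g (phi n) = 0" using LIMSEQ_unique[OF _ tendsto_const] by metis
  qed
  have nH: "(\<lambda>n. nrm (H n)) \<longlonglongrightarrow> \<kappa>"
  proof (rule tendsto_sandwich)
    show "\<forall>\<^sub>F n in sequentially. \<kappa> - 1 / real (Suc n) \<le> nrm (H n)"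
    proof (intro always_eventually allI)
      fix n
      have "1 / real (Suc (k n)) \<le> 1 / real (Suc n)" using seq_suble[OF g(2), of n] by (simp add: frac_le)
      then show "\<kappa> - 1 / real (Suc n) \<le> nrm (H n)" using G(3)[of "k n"] by (simp add: H_def)
    qed
    show "\<forall>\<^sub>F n in sequentially. nrm (H n) \<le> \<kappa>"
    proof (intro always_eventually allI)
      show "nrm (H n) \<le> \<kappa>" for n
        using K_le[OF oG[of n]] mult_left_mono[OF G(2)[of "k n"] less_imp_le[OF \<kappa>_pos]] by (simp add: H_def)
    qed
    have "(\<lambda>n. \<kappa> - 1 / real (Suc n)) \<longlonglongrightarrow> \<kappa> - 0"
      using LIMSEQ_inverse_real_of_nat by (intro tendsto_intros) (simp add: inverse_eq_divide)
    then show "(\<lambda>n. \<kappa> - 1 / real (Suc n)) \<longlonglongrightarrow> \<kappa>" by simp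
  qed simp
  \<comment> \<open>A maximising sequence of a self-adjoint operator consists of approximate
    eigenvectors of its square; \<open>D n\<close> is the defect of \<open>G (k n)\<close>.\<close>
  define D where "D n = (\<lambda>z. K (H n) z - \<kappa>\<^sup>2 * G (k n) z)" for n
  have oD: "orth (D n)" for n
    unfolding D_def using orth_add[OF orth_K[OF oH[of n]] orth_scale[OF oG[of n], of "-\<kappa>\<^sup>2"]] by simp
  \<comment> \<open>Expand the square: self-adjointness turns the inner product in the mixed term
    into \<open>\<kappa>^2\<close> times the squared norm of \<open>H n\<close>, and the first term
    is at most the same quantity.\<close>
  have D_sq: "(nrm (D n))\<^sup>2 \<le> \<kappa>^4 - \<kappa>\<^sup>2 * (nrm (H n))\<^sup>2" for n
  proof -
    have "(nrm (D n))\<^sup>2 = (nrm (K (H n)))\<^sup>2 - 2 * ip (K (H n)) (\<lambda>z. \<kappa>\<^sup>2 * G (k n) z) + (nrm (\<lambda>z. \<kappa>\<^sup>2 * G (k n) z))\<^sup>2"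
      unfolding D_def by (intro nrm_diff_sq orth_L2 orth_K orth_scale oH oG)
    also have "ip (K (H n)) (\<lambda>z. \<kappa>\<^sup>2 * G (k n) z) = \<kappa>\<^sup>2 * (nrm (H n))\<^sup>2"
      unfolding ip_scale_right K_self_adjoint[OF orth_cont[OF oH] orth_cont[OF oG]] nrm_sq
      by (simp add: H_def)
    also have "(nrm (\<lambda>z. \<kappa>\<^sup>2 * G (k n) z))\<^sup>2 \<le> \<kappa>^4"
    proof -
      have "(nrm (G (k n)))\<^sup>2 \<le> 1" using G(2)[of "k n"] nrm_nonneg[of "G (k n)"] by (simp add: power_le_one)
      then have "\<kappa>^4 * (nrm (G (k n)))\<^sup>2 \<le> \<kappa>^4 * 1" by (intro mult_left_mono) auto
      then show ?thesis by (simp add: nrm_scale power_mult_distrib power_mult[symmetric])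
    qed
    also have "(nrm (K (H n)))\<^sup>2 \<le> \<kappa>\<^sup>2 * (nrm (H n))\<^sup>2"
      using power_mono[OF K_le[OF oH[of n]] nrm_nonneg, of 2] by (simp add: power_mult_distrib)
    finally show ?thesis by simp
  qed
  have nD: "(\<lambda>n. nrm (D n)) \<longlonglongrightarrow> 0"
  proof -
    have "(\<lambda>n. (nrm (D n))\<^sup>2) \<longlonglongrightarrow> 0"
    proof (rule tendsto_sandwich[OF _ _ tendsto_const])
      have "(\<lambda>n. \<kappa>^4 - \<kappa>\<^sup>2 * (nrm (H n))\<^sup>2) \<longlonglongrightarrow> \<kappa>^4 - \<kappa>\<^sup>2 * \<kappa>\<^sup>2" by (intro tendsto_intros nH)
      then show "(\<lambda>n. \<kappa>^4 - \<kappa>\<^sup>2 * (nrm (H n))\<^sup>2) \<longlonglongrightarrow> 0" by (simp flip: power_add)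
    qed (use D_sq in auto)
    then have "(\<lambda>n. sqrt ((nrm (D n))\<^sup>2)) \<longlonglongrightarrow> sqrt 0" by (rule tendsto_real_sqrt)
    then show ?thesis by (simp add: nrm_nonneg)
  qed
  have KKg: "K (K g) x = \<kappa>\<^sup>2 * g x" if x: "x \<in> {0..1}" for x
  proof -
    define E where "E = (\<lambda>z. K (K g) z - \<kappa>\<^sup>2 * g z)"
    have oE: "orth E" unfolding E_def
      using orth_add[OF orth_K[OF orth_K[OF og]] orth_scale[OF og, of "-\<kappa>\<^sup>2"]] by simp
    \<comment> \<open>With \<open>e = H n - g\<close> one has
      \<open>E = K (D n) + (\<kappa>^2 * e - K (K e))\<close>, so the defect of \<open>g\<close> is
      controlled by two null sequences.\<close>
    have E_le: "nrm E \<le> 2 * \<kappa>\<^sup>2 * nrm (\<lambda>z. H n z - g z) + \<kappa> * nrm (D n)" for n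
    proof -
      let ?e = "\<lambda>z. H n z - g z"
      have oe: "orth ?e" using orth_add[OF oH[of n] orth_scale[OF og, of "-1"]] by simp
      have "E z = K (D n) z + (\<kappa>\<^sup>2 * ?e z - K (K ?e) z)" if z: "z \<in> {0..1}" for z
      proof -
        have "K (D n) z = K (K (H n)) z - K (\<lambda>z. \<kappa>\<^sup>2 * G (k n) z) z" unfolding D_def
          by (intro K_diff z orth_cont orth_K orth_scale oH oG)
        moreover have "K (\<lambda>z. \<kappa>\<^sup>2 * G (k n) z) z = \<kappa>\<^sup>2 * H n z" unfolding H_def
          by (intro K_scale z orth_cont oG)
        moreover have "K (K ?e) z = K (\<lambda>z. K (H n) z - K g z) z"
          by (rule K_cong) (use z in \<open>auto intro!: orth_cont orth_K oe K_diff oH og\<close>)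
        moreover have "K (\<lambda>z. K (H n) z - K g z) z = K (K (H n)) z - K (K g) z"
          by (intro K_diff z orth_cont orth_K oH og)
        ultimately show ?thesis by (simp add: E_def algebra_simps)
      qed
      then have "nrm E = nrm (\<lambda>z. K (D n) z + (\<kappa>\<^sup>2 * ?e z - K (K ?e) z))" by (intro nrm_cong) auto
      also have "\<dots> \<le> nrm (K (D n)) + nrm (\<lambda>z. \<kappa>\<^sup>2 * ?e z - K (K ?e) z)"
        by (intro nrm_add_le L2_diff orth_L2 orth_K orth_scale oe oD)
      also have "nrm (\<lambda>z. \<kappa>\<^sup>2 * ?e z - K (K ?e) z) = nrm (\<lambda>z. \<kappa>\<^sup>2 * ?e z + (-1) * K (K ?e) z)" by simp
      also have "\<dots> \<le> nrm (\<lambda>z. \<kappa>\<^sup>2 * ?e z) + nrm (\<lambda>z. (-1) * K (K ?e) z)"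
        by (intro nrm_add_le orth_L2 orth_K orth_scale oe)
      also have "\<dots> = \<kappa>\<^sup>2 * nrm ?e + nrm (K (K ?e))" unfolding nrm_scale by simp
      also have "nrm (K (K ?e)) \<le> \<kappa> * (\<kappa> * nrm ?e)"
        using K_le[OF orth_K[OF oe]] K_le[OF oe] \<kappa>_pos by (meson less_imp_le mult_left_mono order_trans)
      also have "nrm (K (D n)) \<le> \<kappa> * nrm (D n)" by (rule K_le[OF oD])
      finally show ?thesis by (simp add: power2_eq_square)
    qed
    have "(\<lambda>n. 2 * \<kappa>\<^sup>2 * nrm (\<lambda>z. H n z - g z) + \<kappa> * nrm (D n)) \<longlonglongrightarrow> 2 * \<kappa>\<^sup>2 * 0 + \<kappa> * 0"
      by (intro tendsto_intros Hg nD)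
    then have "nrm E \<le> 0" using E_le by (intro LIMSEQ_le_const[where X = "\<lambda>n. 2 * \<kappa>\<^sup>2 * nrm (\<lambda>z. H n z - g z) + \<kappa> * nrm (D n)"]) auto
    then have "E x = 0" using nrm_zeroD[OF orth_cont[OF oE] _ x] nrm_nonneg[of E] by simp
    then show ?thesis by (simp add: E_def)
  qed
  have "nrm g \<noteq> 0"
  proof
    assume 0: "nrm g = 0"
    have "nrm (H n) \<le> nrm (\<lambda>z. H n z - g z)" for n
      using nrm_le_add_diff[OF orth_L2[OF oH[of n]] orth_L2[OF og]] 0 by simp
    then have "\<kappa> \<le> 0" using LIMSEQ_le[OF nH Hg] by auto
    then show False using \<kappa>_pos by simp
  qed
  moreover have "g x = 0" if x: "x \<in> {0..1}" for x
  proof -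
    \<comment> \<open>Factor \<open>K^2 - \<kappa>^2\<close> as
      \<open>(K - \<kappa>) (K + \<kappa>)\<close>: the function \<open>(K + \<kappa>) g\<close> is
      multiplied by \<open>\<kappa>\<close> under \<open>K\<close>, hence zero; then
      \<open>g\<close> is multiplied by \<open>- \<kappa>\<close>, hence zero too.\<close>
    let ?h = "\<lambda>z. K g z + \<kappa> * g z"
    have oh: "orth ?h" by (intro orth_add orth_K orth_scale og)
    have "K ?h y = \<kappa> * ?h y" if y: "y \<in> {0..1}" for y
    proof -
      have "K ?h y = K (K g) y + K (\<lambda>z. \<kappa> * g z) y" by (intro K_add orth_cont orth_K orth_scale og y)
      also have "K (\<lambda>z. \<kappa> * g z) y = \<kappa> * K g y" by (intro K_scale orth_cont og y)
      finally show ?thesis using KKg[OF y] by (simp add: power2_eq_square algebra_simps)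
    qed
    then have "?h y = 0" if "y \<in> {0..1}" for y using orth_eigen_zero[OF oh _ _ that, of \<kappa>] \<kappa>_pos by auto
    then have "K g y = - \<kappa> * g y" if "y \<in> {0..1}" for y using that by (simp add: eq_neg_iff_add_eq_0)
    then show ?thesis using orth_eigen_zero[OF og _ _ x, of "-\<kappa>"] \<kappa>_pos by auto
  qed
  ultimately show False using nrm_cong[of g "\<lambda>_. 0"] by simp
qed

end

section \<open>Parseval's identity\<close>

lemma AE_not_negligible:
  assumes "negligible N"
  shows "AE x in lebesgue_on {0..1::real}. x \<notin> N"
proof -
  have "N \<in> null_sets lebesgue" using assms by (simp add: negligible_iff_null_sets)
  then have "AE x in lebesgue. x \<notin> N" by (rule AE_not_in)
  then show ?thesis by (subst AE_restrict_space_iff) auto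
qed

section \<open>Density of the continuous functions\<close>

context weight
begin

lemma nrm_dominated:
  assumes "\<And>n. F n \<in> borel_measurable (lebesgue_on {0..1})"
    and "AE z in lebesgue_on {0..1}. (\<lambda>n. F n z) \<longlonglongrightarrow> 0"
    and "w \<in> L2 r" "\<And>n z. z \<in> {0..1} \<Longrightarrow> \<bar>F n z\<bar> \<le> \<bar>w z\<bar>"
  shows "(\<lambda>n. nrm (F n)) \<longlonglongrightarrow> 0"
proof -
  have "(\<lambda>n. LINT z|lebesgue_on {0..1}. r z * (F n z)\<^sup>2) \<longlonglongrightarrow> (LINT z|lebesgue_on {0..1::real}. 0)"
  proof (rule integral_dominated_convergence)
    show "integrable (lebesgue_on {0..1}) (\<lambda>z. r z * (w z)\<^sup>2)" using assms(3) by (simp add: L2_def)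
    show "(\<lambda>z. r z * (F n z)\<^sup>2) \<in> borel_measurable (lebesgue_on {0..1})" for n
      using assms(1)[of n] by measurable
    show "AE z in lebesgue_on {0..1}. (\<lambda>n. r z * (F n z)\<^sup>2) \<longlonglongrightarrow> 0"
      using assms(2)
    proof eventually_elim
      case (elim z)
      have "(\<lambda>n. r z * (F n z)\<^sup>2) \<longlonglongrightarrow> r z * 0\<^sup>2" by (intro tendsto_intros elim)
      then show ?case by simp
    qed
    show "AE z in lebesgue_on {0..1}. norm (r z * (F n z)\<^sup>2) \<le> r z * (w z)\<^sup>2" for n
    proof (rule AE_unitI)
      fix z :: real assume z: "z \<in> {0..1}"
      have "\<bar>F n z\<bar>\<^sup>2 \<le> \<bar>w z\<bar>\<^sup>2" using assms(4)[OF z, of n] by (intro power_mono) auto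
      then show "norm (r z * (F n z)\<^sup>2) \<le> r z * (w z)\<^sup>2" using r_pos[OF z] by (simp add: abs_mult)
    qed
  qed auto
  from tendsto_real_sqrt[OF this] show ?thesis by (simp add: l2_norm_def)
qed

lemma nrm_limit_small:
  assumes "(\<lambda>n. nrm (F n)) \<longlonglongrightarrow> 0" "e > 0"
  obtains n where "nrm (F n) < e"
proof -
  have "\<forall>\<^sub>F n in sequentially. nrm (F n) < e" using order_tendstoD(2)[OF assms] .
  then show ?thesis using that by (auto simp: eventually_sequentially)
qed

text \<open>Truncate \<open>f\<close> at height \<open>k\<close>, then truncate at the same height
  continuous functions that converge to \<open>f\<close> almost everywhere: the constant
  \<open>2 * k\<close> dominates the differences, and truncation preserves continuity.\<close>

lemma L2_approx_continuous:
  assumes "f \<in> L2 r" "e > 0"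
  obtains h where "continuous_on {0..1} h" "nrm (\<lambda>z. f z - h z) < e"
proof -
  have fm: "f \<in> borel_measurable (lebesgue_on {0..1})" using assms(1) by (rule L2_measurable)
  define clamp where "clamp k y = max (- real k) (min (real k) y)" for k :: nat and y :: real
  have clamp_eq: "clamp k y = y" if "\<bar>y\<bar> \<le> real k" for k y using that by (auto simp: clamp_def)
  have clamp_le: "\<bar>clamp k y\<bar> \<le> real k" for k y by (auto simp: clamp_def)
  have clamp_le': "\<bar>y - clamp k y\<bar> \<le> \<bar>y\<bar>" for k y by (auto simp: clamp_def)
  have cm: "(\<lambda>z. clamp k (f z)) \<in> borel_measurable (lebesgue_on {0..1})" for k
    unfolding clamp_def using fm by measurable
  have cL: "(\<lambda>z. clamp k (f z)) \<in> L2 r" for k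
    unfolding L2_def
  proof (intro CollectI conjI cm, rule Bochner_Integration.integrable_bound)
    show "integrable (lebesgue_on {0..1}) (\<lambda>z. r z * (real k)\<^sup>2)"
      using L2_cont[of "\<lambda>_. real k"] by (simp add: L2_def)
    show "(\<lambda>z. r z * (clamp k (f z))\<^sup>2) \<in> borel_measurable (lebesgue_on {0..1})" using cm by measurable
    show "AE z in lebesgue_on {0..1}. norm (r z * (clamp k (f z))\<^sup>2) \<le> norm (r z * (real k)\<^sup>2)"
    proof (rule AE_unitI)
      fix z :: real assume z: "z \<in> {0..1}"
      show "norm (r z * (clamp k (f z))\<^sup>2) \<le> norm (r z * (real k)\<^sup>2)"
        using r_pos[OF z] power_mono[OF clamp_le[of k "f z"], of 2] by (simp add: abs_mult)
    qed
  qed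
  have "(\<lambda>k. nrm (\<lambda>z. f z - clamp k (f z))) \<longlonglongrightarrow> 0"
  proof (rule nrm_dominated[OF _ _ assms(1)])
    show "(\<lambda>z. f z - clamp n (f z)) \<in> borel_measurable (lebesgue_on {0..1})" for n using cm fm by measurable
    show "AE z in lebesgue_on {0..1}. (\<lambda>n. f z - clamp n (f z)) \<longlonglongrightarrow> 0"
    proof (rule AE_unitI)
      fix z
      obtain N :: nat where N: "\<bar>f z\<bar> \<le> real N" using real_arch_simple by blast
      have "\<forall>\<^sub>F n in sequentially. f z - clamp n (f z) = 0"
        unfolding eventually_sequentially using N clamp_eq by (intro exI[of _ N]) force
      then show "(\<lambda>n. f z - clamp n (f z)) \<longlonglongrightarrow> 0" by (rule tendsto_eventually)
    qed
  qed (rule clamp_le')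
  then obtain k where k: "nrm (\<lambda>z. f z - clamp k (f z)) < e / 2"
    using nrm_limit_small[where F = "\<lambda>k z. f z - clamp k (f z)" and e = "e / 2"] assms(2) by (metis half_gt_zero)
  have "f measurable_on {0..1}" using fm by (simp add: measurable_on_iff_borel_measurable)
  then obtain N g where g: "negligible N" "\<And>n. continuous_on UNIV (g n)"
    "\<And>x. x \<notin> N \<Longrightarrow> (\<lambda>n. g n x) \<longlonglongrightarrow> (if x \<in> {0..1} then f x else 0)"
    unfolding measurable_on_def by metis
  have gc: "continuous_on {0..1} (\<lambda>z. clamp k (g n z))" for n
    unfolding clamp_def using continuous_on_subset[OF g(2)[of n]] by (intro continuous_intros) auto
  have "(\<lambda>n. nrm (\<lambda>z. clamp k (f z) - clamp k (g n z))) \<longlonglongrightarrow> 0"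
  proof (rule nrm_dominated[where w = "\<lambda>_. 2 * real k"])
    show "(\<lambda>z. clamp k (f z) - clamp k (g n z)) \<in> borel_measurable (lebesgue_on {0..1})" for n
      using cm continuous_borel_measurable[OF gc[of n]] by measurable
    have "AE z in lebesgue_on {0..1}. z \<in> {0..1::real}" by (rule AE_unitI)
    then show "AE z in lebesgue_on {0..1}. (\<lambda>n. clamp k (f z) - clamp k (g n z)) \<longlonglongrightarrow> 0"
      using AE_not_negligible[OF g(1)]
    proof eventually_elim
      case (elim z)
      then have "(\<lambda>n. g n z) \<longlonglongrightarrow> f z" using g(3)[of z] by auto
      then have "(\<lambda>n. clamp k (f z) - clamp k (g n z)) \<longlonglongrightarrow> clamp k (f z) - clamp k (f z)"
        unfolding clamp_def by (intro tendsto_intros)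
      then show ?case by simp
    qed
    show "\<bar>clamp k (f z) - clamp k (g n z)\<bar> \<le> \<bar>2 * real k\<bar>" for n z
      using clamp_le[of k "f z"] clamp_le[of k "g n z"] by linarith
  qed (auto intro: L2_cont)
  then obtain n where n: "nrm (\<lambda>z. clamp k (f z) - clamp k (g n z)) < e / 2"
    using nrm_limit_small[where F = "\<lambda>n z. clamp k (f z) - clamp k (g n z)" and e = "e / 2"] assms(2)
    by (metis half_gt_zero)
  show ?thesis
    using that[OF gc[of n]] nrm_diff_triangle[OF assms(1) cL[of k] L2_cont[OF gc[of n]]] k n by linarith
qed

end

section \<open>Density of the domain of the operator\<close>

context sturm
begin

lemma C2_unit_real:
  assumes "\<And>z. z \<in> {0..1} \<Longrightarrow> (F has_real_derivative F' z) (at z within {0..1})"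
    "\<And>z. z \<in> {0..1} \<Longrightarrow> (F' has_real_derivative F'' z) (at z within {0..1})" "continuous_on {0..1} F''"
  shows "C2_unit F"
  using assms unfolding C1_unit_def C2_unit_def has_real_derivative_iff_has_vector_derivative by blast

text \<open>A polynomial factor with double zeros at both end points enforces every boundary
  condition at once, whatever the coefficients. It costs nothing in the norm because it can be
  divided out approximately beforehand.\<close>

lemma L2_approx_domain:
  assumes "f \<in> L2 r" "e > 0"
  obtains F P h where "isA F P h" "bcL F P = 0" "bcR F P = 0" "nrm (\<lambda>z. f z - F z) < e"
proof -
  obtain g where g: "continuous_on {0..1} g" "nrm (\<lambda>z. f z - g z) < e / 3"
    using L2_approx_continuous[OF assms(1), of "e / 3"] assms(2) by auto
  define s where "s z = z\<^sup>2 * (1 - z)\<^sup>2" for z :: real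
  have s: "s z \<ge> 0" "s z \<le> 1" if "z \<in> {0..1}" for z
    using that by (auto simp: s_def intro!: mult_le_one power_le_one)
  define d where "d n = 1 / real (Suc n)" for n
  have d: "d n > 0" for n by (simp add: d_def)
  have d_lim: "d \<longlonglongrightarrow> 0" unfolding d_def using LIMSEQ_inverse_real_of_nat by (simp add: inverse_eq_divide)
  have s_cont: "continuous_on {0..1} s" unfolding s_def by (intro continuous_intros)
  have sd: "s z + d n \<noteq> 0" if "z \<in> {0..1}" for z n using s(1)[OF that] d[of n] by linarith
  have gs_cont: "continuous_on {0..1} (\<lambda>z. g z / (s z + d n))" for n
    using sd by (intro continuous_intros g(1) s_cont) auto
  \<comment> \<open>The quotient \<open>g / (s + d n)\<close> is a continuous substitute for
    \<open>g / s\<close>. Multiplied by \<open>s\<close> it misses \<open>g\<close> by the factor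
    \<open>d n / (s + d n)\<close>, which tends to 0 except at the two end points.\<close>
  have "(\<lambda>n. nrm (\<lambda>z. g z - s z * (g z / (s z + d n)))) \<longlonglongrightarrow> 0"
  proof (rule nrm_dominated[where w = g])
    show "(\<lambda>z. g z - s z * (g z / (s z + d n))) \<in> borel_measurable (lebesgue_on {0..1})" for n
      by (intro continuous_borel_measurable continuous_intros g(1) s_cont gs_cont)
    have "AE z in lebesgue_on {0..1}. z \<in> {0..1::real}" by (rule AE_unitI)
    moreover have "AE z in lebesgue_on {0..1}. z \<notin> {0, 1::real}" by (rule AE_not_negligible) (auto simp: negligible_finite)
    ultimately show "AE z in lebesgue_on {0..1}. (\<lambda>n. g z - s z * (g z / (s z + d n))) \<longlonglongrightarrow> 0"
    proof eventually_elim
      case (elim z)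
      then have "s z \<noteq> 0" by (auto simp: s_def)
      then have "(\<lambda>n. g z - s z * (g z / (s z + d n))) \<longlonglongrightarrow> g z - s z * (g z / (s z + 0))"
        by (intro tendsto_intros d_lim) auto
      then show ?case using \<open>s z \<noteq> 0\<close> by simp
    qed
    fix n z assume z: "z \<in> {0..1::real}"
    have "g z - s z * (g z / (s z + d n)) = d n / (s z + d n) * g z" using sd[OF z, of n] by (simp add: field_simps)
    also have "\<bar>\<dots>\<bar> \<le> 1 * \<bar>g z\<bar>"
      unfolding abs_mult using s(1)[OF z] d[of n] by (intro mult_right_mono) (auto simp: divide_simps)
    finally show "\<bar>g z - s z * (g z / (s z + d n))\<bar> \<le> \<bar>g z\<bar>" by simp
  qed (use g L2_cont in auto)
  then obtain n where n: "nrm (\<lambda>z. g z - s z * (g z / (s z + d n))) < e / 3"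
    using nrm_limit_small[where F = "\<lambda>n z. g z - s z * (g z / (s z + d n))" and e = "e / 3"] assms(2) by auto
  define h where "h z = g z / (s z + d n)" for z
  have h_cont: "continuous_on {0..1} h" unfolding h_def by (rule gs_cont)
  \<comment> \<open>The 4 instead of 3 makes the resulting bound strictly smaller than
    \<open>e / 3\<close>.\<close>
  define \<epsilon> where "\<epsilon> = e / (4 * nrm (\<lambda>_. 1))"
  have \<epsilon>: "\<epsilon> > 0" using nrm_one_pos assms(2) by (simp add: \<epsilon>_def)
  obtain P where P: "real_polynomial_function P" "\<And>x. x \<in> {0..1} \<Longrightarrow> \<bar>h x - P x\<bar> < \<epsilon>"
    using Stone_Weierstrass_real_polynomial_function[OF _ h_cont \<epsilon>] by auto
  obtain P1 where P1: "real_polynomial_function P1" "\<And>x. (P has_real_derivative (P1 x)) (at x)"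
    using has_real_derivative_polynomial_function[OF P(1)] by blast
  obtain P2 where P2: "real_polynomial_function P2" "\<And>x. (P1 has_real_derivative (P2 x)) (at x)"
    using has_real_derivative_polynomial_function[OF P1(1)] by blast
  obtain P3 where P3: "real_polynomial_function P3" "\<And>x. (P2 has_real_derivative (P3 x)) (at x)"
    using has_real_derivative_polynomial_function[OF P2(1)] by blast
  define F where "F z = s z * P z" for z
  define s1 where "s1 z = 2 * z * (1 - z)\<^sup>2 - 2 * z\<^sup>2 * (1 - z)" for z :: real
  define s2 where "s2 z = 2 * (1 - z)\<^sup>2 - 8 * z * (1 - z) + 2 * z\<^sup>2" for z :: real
  have ds: "(s has_real_derivative s1 z) (at z within {0..1})" for z
    unfolding s_def s1_def by (auto intro!: derivative_eq_intros simp: power2_eq_square algebra_simps)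
  have ds1: "(s1 has_real_derivative s2 z) (at z within {0..1})" for z
    unfolding s1_def s2_def by (auto intro!: derivative_eq_intros simp: power2_eq_square algebra_simps)
  note dP = P1(2)[THEN DERIV_subset[OF _ subset_UNIV]] P2(2)[THEN DERIV_subset[OF _ subset_UNIV]] P3(2)[THEN DERIV_subset[OF _ subset_UNIV]]
  have F1: "(F has_real_derivative s1 z * P z + s z * P1 z) (at z within {0..1})" for z
    unfolding F_def by (auto intro!: derivative_eq_intros ds dP)
  have "((\<lambda>z. s1 z * P z + s z * P1 z) has_real_derivative s2 z * P z + 2 * s1 z * P1 z + s z * P2 z) (at z within {0..1})" for z
    by (auto intro!: derivative_eq_intros ds ds1 dP)
  moreover have "continuous_on {0..1} (\<lambda>z. s2 z * P z + 2 * s1 z * P1 z + s z * P2 z)"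
    unfolding s_def s1_def s2_def
    by (intro continuous_intros DERIV_continuous_on[OF dP(1)] DERIV_continuous_on[OF dP(2)] DERIV_continuous_on[OF dP(3)])
  ultimately have C2: "C2_unit F" using F1 by (intro C2_unit_real)
  have dzF: "dz F z = s1 z * P z + s z * P1 z" if "z \<in> {0..1}" for z
    using F1[of z] that
    by (intro vector_derivative_within_closed_interval) (auto simp: has_real_derivative_iff_has_vector_derivative)
  have "F 0 = 0" "F 1 = 0" "dz F 0 = 0" "dz F 1 = 0"
    by (simp_all add: dzF) (simp_all add: F_def s_def s1_def)
  then have bc: "bcL F (\<lambda>z. p z * dz F z) = 0" "bcR F (\<lambda>z. p z * dz F z) = 0"
    by (simp_all add: bcL_def bcR_def)
  have F_cont: "continuous_on {0..1} F" using DERIV_continuous_on[OF F1] .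
  have "nrm (\<lambda>z. s z * h z - F z) \<le> \<epsilon> * nrm (\<lambda>_. 1)"
  proof (rule nrm_le_sup)
    show "(\<lambda>z. s z * h z - F z) \<in> L2 r" by (intro L2_cont continuous_intros s_cont h_cont F_cont)
    fix z :: real assume z: "z \<in> {0..1}"
    have "\<bar>s z * h z - F z\<bar> = s z * \<bar>h z - P z\<bar>"
      using s(1)[OF z] by (simp add: F_def abs_mult flip: right_diff_distrib)
    also have "\<dots> \<le> 1 * \<epsilon>" using s[OF z] P(2)[OF z] \<epsilon> by (intro mult_mono) auto
    finally show "\<bar>s z * h z - F z\<bar> \<le> \<epsilon>" by simp
  qed (use \<epsilon> in auto)
  also have "\<dots> < e / 3" using nrm_one_pos assms(2) by (simp add: \<epsilon>_def)
  finally have e3: "nrm (\<lambda>z. s z * h z - F z) < e / 3" .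
  have L: "g \<in> L2 r" "(\<lambda>z. s z * h z) \<in> L2 r" "F \<in> L2 r"
    by (intro L2_cont continuous_intros g(1) s_cont h_cont F_cont)+
  have "nrm (\<lambda>z. f z - F z) < e"
    using nrm_diff_triangle[OF assms(1) L(1,3)] nrm_diff_triangle[OF L] g(2) n e3 by (simp add: h_def)
  then show ?thesis using that[OF C2_isA[OF C2] bc] by blast
qed

end

text \<open>The series is written from the first index on: finitely many additional terms do not
  affect convergence, and a term with \<open>lam (Suc i) = 0\<close> is 0 because division by zero
  yields 0.\<close>

locale sturm_summable = sturm_eigen +
  fixes m :: nat
  assumes lam_pos: "0 < lam (Suc m)"
    and summable_sup: "summable (\<lambda>i. (SUP z\<in>{0..1}. \<bar>phi (Suc i) z\<bar>) / lam (Suc i))"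
begin

definition M :: "nat \<Rightarrow> real" where "M n = (SUP z\<in>{0..1}. \<bar>phi n z\<bar>)"

lemma lam_pos': "n > m \<Longrightarrow> lam n > 0"
  using lam_le[of "Suc m" n] lam_pos by auto

lemma phi_le_M:
  assumes "n \<ge> 1" "z \<in> {0..1}" shows "\<bar>phi n z\<bar> \<le> M n"
  unfolding M_def
proof (rule cSUP_upper[OF assms(2)])
  have "compact ((\<lambda>z. \<bar>phi n z\<bar>) ` {0..1})"
    using phi_cont[OF assms(1)] by (intro compact_continuous_image continuous_intros) auto
  then show "bdd_above ((\<lambda>z. \<bar>phi n z\<bar>) ` {0..1})"
    by (intro bounded_imp_bdd_above compact_imp_bounded)
qed

lemma M_nonneg: "n \<ge> 1 \<Longrightarrow> 0 \<le> M n"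
  using phi_le_M[of n 0] by (meson abs_ge_zero atLeastAtMost_iff order_trans zero_le_one order_refl)

lemma summable_M: "summable (\<lambda>i. M (Suc i) / lam (Suc i))"
  using summable_sup by (simp add: M_def)

lemma nrm_phi: "n \<ge> 1 \<Longrightarrow> nrm (phi n) = 1"
  using nrm_sq[of "phi n"] phi_orth[of n n] nrm_nonneg[of "phi n"] by (simp add: power2_eq_1_iff)

lemma coeff_le: "f \<in> L2 r \<Longrightarrow> n \<ge> 1 \<Longrightarrow> \<bar>ip f (phi n)\<bar> \<le> nrm f"
  using Cauchy_Schwarz[OF _ phi_L2, of f n] nrm_phi[of n] by simp

lemma coeff_isA:
  assumes "isA F P h" "bcL F P = 0" "bcR F P = 0" "n \<ge> 1"
  shows "ip h (phi n) = lam n * ip F (phi n)"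
  using self_adjoint[OF assms(1) phi_isA[OF assms(4)] assms(2) phi_bc(1)[OF assms(4)] assms(3) phi_bc(2)[OF assms(4)]]
  by (simp add: ip_scale_right)

definition psum :: "(nat \<Rightarrow> real) \<Rightarrow> nat \<Rightarrow> real \<Rightarrow> real" where
  "psum a N z = (\<Sum>i<N. a i * phi (Suc i) z)"

lemma psum_cont: "continuous_on {0..1} (psum a N)"
  unfolding psum_def by (intro continuous_intros phi_cont) auto

lemma psum_L2: "psum a N \<in> L2 r"
  using L2_cont[OF psum_cont] .

lemma ip_psum:
  assumes "f \<in> L2 r"
  shows "ip f (psum a N) = (\<Sum>i<N. a i * ip f (phi (Suc i)))"
proof -
  have "ip f (psum a N) = ip f (\<lambda>z. \<Sum>i<N. a i * phi (Suc i) z)" by (simp add: psum_def[abs_def])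
  also have "\<dots> = (\<Sum>i<N. ip f (\<lambda>z. a i * phi (Suc i) z))"
    by (intro ip_sum_right L2_scale phi_L2 assms) auto
  finally show ?thesis by (simp add: ip_scale_right)
qed

lemma ip_psum_phi: "ip (psum a N) (phi (Suc j)) = (if j < N then a j else 0)"
proof -
  have "ip (psum a N) (phi (Suc j)) = (\<Sum>i<N. a i * (if j = i then 1 else 0))"
    unfolding ip_sym[of "psum a N"] ip_psum[OF phi_L2[of "Suc j", simplified]]
    by (intro sum.cong) (auto simp: phi_orth)
  then show ?thesis by (simp add: if_distrib cong: if_cong)
qed

lemma nrm_psum_sq: "(nrm (psum a N))\<^sup>2 = (\<Sum>i<N. (a i)\<^sup>2)"
  unfolding nrm_sq ip_psum[OF psum_L2] ip_psum_phi by (simp add: power2_eq_square)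

text \<open>Completing the square. Only the last sum depends on \<open>a\<close>, and it vanishes
  for the Fourier coefficients: this contains both Bessel's inequality and the best approximation
  property.\<close>

lemma nrm_diff_psum_sq:
  assumes "f \<in> L2 r"
  shows "(nrm (\<lambda>z. f z - psum a N z))\<^sup>2 =
    (nrm f)\<^sup>2 - (\<Sum>i<N. (ip f (phi (Suc i)))\<^sup>2) + (\<Sum>i<N. (a i - ip f (phi (Suc i)))\<^sup>2)"
  unfolding nrm_diff_sq[OF assms psum_L2] ip_psum[OF assms] nrm_psum_sq
  by (simp add: power2_diff sum.distrib sum_subtractf sum_distrib_left algebra_simps)

lemma series_coeff:
  assumes "uniform_limit {0..1} (psum a) G sequentially"
  shows "continuous_on {0..1} G" "ip G (phi (Suc j)) = a j"
proof -
  show c: "continuous_on {0..1} G"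
    using uniform_limit_theorem[OF _ assms] psum_cont by auto
  have "(\<lambda>N. nrm (\<lambda>z. psum a N z - G z)) \<longlonglongrightarrow> 0"
    by (rule uniform_limit_nrm[OF assms psum_L2 L2_cont[OF c]])
  then have "(\<lambda>N. ip (psum a N) (phi (Suc j))) \<longlonglongrightarrow> ip G (phi (Suc j))"
    by (rule ip_tendsto) (auto intro: psum_L2 L2_cont c phi_L2)
  moreover have "(\<lambda>N. ip (psum a N) (phi (Suc j))) \<longlonglongrightarrow> a j"
    by (rule tendsto_eventually) (auto simp: ip_psum_phi eventually_sequentially intro!: exI[of _ "Suc j"])
  ultimately show "ip G (phi (Suc j)) = a j" by (rule LIMSEQ_unique)
qed

text \<open>Coefficients of size \<open>1 / lam\<close> are what the summability hypothesis allows: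
  \<open>C * M / lam\<close> is a convergent majorant. The first \<open>m\<close> terms, where
  \<open>lam\<close> may be nonpositive, are exempt from the bound.\<close>

lemma psum_uniform_limit:
  assumes "\<And>i. i \<ge> m \<Longrightarrow> \<bar>a i\<bar> \<le> C / lam (Suc i)"
  shows "uniform_limit {0..1} (psum a) (\<lambda>z. \<Sum>i. a i * phi (Suc i) z) sequentially"
  unfolding psum_def[abs_def]
proof (rule Weierstrass_m_test_ev)
  show "summable (\<lambda>i. C * (M (Suc i) / lam (Suc i)))" by (intro summable_mult summable_M)
  show "\<forall>\<^sub>F i in sequentially. \<forall>z\<in>{0..1}. norm (a i * phi (Suc i) z) \<le> C * (M (Suc i) / lam (Suc i))"
    unfolding eventually_sequentially
  proof (intro exI[of _ m] allI impI ballI)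
    fix i z assume i: "m \<le> i" and z: "z \<in> {0..1::real}"
    have "\<bar>a i\<bar> * \<bar>phi (Suc i) z\<bar> \<le> C / lam (Suc i) * M (Suc i)"
      using assms[OF i] phi_le_M[OF _ z, of "Suc i"] order_trans[OF abs_ge_zero assms[OF i]] by (intro mult_mono) auto
    then show "norm (a i * phi (Suc i) z) \<le> C * (M (Suc i) / lam (Suc i))" by (simp add: abs_mult)
  qed
qed

text \<open>Beyond the first \<open>m\<close>, the coefficients of \<open>F\<close> are those of
  \<open>h = A F\<close> divided by \<open>lam\<close>, so the series converges uniformly; the
  remainder is continuous and orthogonal to all eigenfunctions, hence zero.\<close>

lemma domain_expansion:
  assumes "isA F P h" "bcL F P = 0" "bcR F P = 0"
  shows "uniform_limit {0..1} (psum (\<lambda>i. ip F (phi (Suc i)))) F sequentially"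
proof -
  let ?a = "\<lambda>i. ip F (phi (Suc i))"
  let ?G = "\<lambda>z. \<Sum>i. ?a i * phi (Suc i) z"
  have "\<bar>?a i\<bar> \<le> nrm h / lam (Suc i)" if "i \<ge> m" for i
    using coeff_isA[OF assms, of "Suc i"] coeff_le[OF isA_L2(2)[OF assms(1)], of "Suc i"] lam_pos'[of "Suc i"] that
    by (simp add: field_simps abs_mult)
  then have U: "uniform_limit {0..1} (psum ?a) ?G sequentially" by (rule psum_uniform_limit)
  have "orth (\<lambda>z. F z - ?G z)"
    unfolding orth_def
  proof (intro conjI allI impI)
    show "continuous_on {0..1} (\<lambda>z. F z - ?G z)"
      by (intro continuous_on_diff isAD(4)[OF assms(1)] series_coeff(1)[OF U])
    fix n :: nat assume n: "n \<ge> 1"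
    then obtain j where j: "n = Suc j" by (cases n) auto
    have "ip (\<lambda>z. F z - ?G z) (phi n) = ip F (phi n) - ip ?G (phi n)"
      by (intro ip_diff_left isA_L2(1)[OF assms(1)] L2_cont series_coeff(1)[OF U] phi_cont n)
    then show "ip (\<lambda>z. F z - ?G z) (phi n) = 0" using series_coeff(2)[OF U, of j] j by simp
  qed
  then have "?G z = F z" if "z \<in> {0..1}" for z using orth_zero[of "\<lambda>z. F z - ?G z" z] that by simp
  with U show ?thesis by (subst (asm) uniform_limit_cong'[where g = "psum ?a" and i = F]) auto
qed

text \<open>Late partial sums of the expansion of a nearby domain element are within
  \<open>2 * \<delta>\<close> of \<open>f\<close>. By best approximation the Fourier sums of
  \<open>f\<close> do no worse, so the defect stays below
  \<open>e = (2 * \<delta>)^2\<close>.\<close>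

theorem Parseval:
  assumes "f \<in> L2 r"
  shows "(\<lambda>i. (ip f (phi (Suc i)))\<^sup>2) sums (nrm f)\<^sup>2"
  unfolding sums_def
proof (rule LIMSEQ_I)
  fix e :: real assume e: "e > 0"
  define \<delta> where "\<delta> = sqrt e / 2"
  have \<delta>: "\<delta> > 0" using e by (simp add: \<delta>_def)
  obtain F P h where F: "isA F P h" "bcL F P = 0" "bcR F P = 0" "nrm (\<lambda>z. f z - F z) < \<delta>"
    using L2_approx_domain[OF assms \<delta>] by blast
  let ?a = "\<lambda>i. ip F (phi (Suc i))"
  have FL: "F \<in> L2 r" using isA_L2[OF F(1)] by simp
  have "(\<lambda>N. nrm (\<lambda>z. psum ?a N z - F z)) \<longlonglongrightarrow> 0"
    by (rule uniform_limit_nrm[OF domain_expansion[OF F(1-3)] psum_L2 FL])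
  then obtain N0 where N0: "\<And>N. N \<ge> N0 \<Longrightarrow> nrm (\<lambda>z. psum ?a N z - F z) < \<delta>"
    using order_tendstoD(2)[of "\<lambda>N. nrm (\<lambda>z. psum ?a N z - F z)" 0 sequentially \<delta>] \<delta>
    unfolding eventually_sequentially by blast
  show "\<exists>no. \<forall>N\<ge>no. norm ((\<Sum>i<N. (ip f (phi (Suc i)))\<^sup>2) - (nrm f)\<^sup>2) < e"
  proof (intro exI[of _ N0] allI impI)
    fix N assume N: "N \<ge> N0"
    have "nrm (\<lambda>z. f z - psum ?a N z) \<le> nrm (\<lambda>z. f z - F z) + nrm (\<lambda>z. F z - psum ?a N z)"
      by (rule nrm_diff_triangle[OF assms FL psum_L2])
    then have "nrm (\<lambda>z. f z - psum ?a N z) < 2 * \<delta>"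
      using N0[OF N] F(4) nrm_diff_commute[of F "psum ?a N"] by simp
    then have "(nrm (\<lambda>z. f z - psum ?a N z))\<^sup>2 < (2 * \<delta>)\<^sup>2" by (intro power_strict_mono nrm_nonneg) auto
    also have "\<dots> = e" using e by (simp add: \<delta>_def)
    finally have 1: "(nrm f)\<^sup>2 - (\<Sum>i<N. (ip f (phi (Suc i)))\<^sup>2) < e"
      unfolding nrm_diff_psum_sq[OF assms] using sum_nonneg[of "{..<N}" "\<lambda>i. (?a i - ip f (phi (Suc i)))\<^sup>2"] by simp
    have "0 \<le> (nrm (\<lambda>z. f z - psum (\<lambda>i. ip f (phi (Suc i))) N z))\<^sup>2" by simp
    then have "(\<Sum>i<N. (ip f (phi (Suc i)))\<^sup>2) \<le> (nrm f)\<^sup>2"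
      unfolding nrm_diff_psum_sq[OF assms] by simp
    then show "norm ((\<Sum>i<N. (ip f (phi (Suc i)))\<^sup>2) - (nrm f)\<^sup>2) < e" using 1 by simp
  qed
qed

lemma zero_coeff_zero:
  assumes "continuous_on {0..1} f" "\<And>n. n \<ge> 1 \<Longrightarrow> ip f (phi n) = 0" "z \<in> {0..1}"
  shows "f z = 0"
  using orth_zero[of f z] assms by (simp add: orth_def)

end

section \<open>Heat series\<close>

text \<open>Provides two negative powers of \<open>lam\<close>: one pays for the growth of a
  moderate family, the other leaves the summable majorant \<open>M / lam\<close>.\<close>

lemma exp_minus_le_inverse_square:
  assumes "x > 0" shows "exp (- x) \<le> 2 / (x\<^sup>2 :: real)"
proof -
  have "x\<^sup>2 / 2 \<le> exp x" using exp_lower_Taylor_quadratic[of x] assms by simp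
  then show ?thesis using assms by (simp add: exp_minus field_simps)
qed

context sturm_summable
begin

text \<open>Admissible growth for the spatial factors of a heat series: one power of
  \<open>lam\<close> above the sup norms \<open>M\<close>. It covers the eigenfunctions, their
  fluxes and their images under \<open>A\<close>.\<close>

definition moderate :: "(nat \<Rightarrow> real \<Rightarrow> real) \<Rightarrow> bool" where
  "moderate c \<longleftrightarrow> (\<forall>i. continuous_on {0..1} (c i)) \<and>
     (\<exists>C\<ge>0. \<forall>i\<ge>m. \<forall>z\<in>{0..1}. \<bar>c i z\<bar> \<le> C * lam (Suc i) * M (Suc i))"

text \<open>At some interior point \<open>y\<close> the flux is \<open>p y\<close> times the total
  increment of the eigenfunction, by the mean value theorem. From there the equation for the
  derivative of the flux bounds it everywhere.\<close>

lemma psi_bound: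
  "\<exists>C\<ge>0. \<forall>i\<ge>m. \<forall>z\<in>{0..1}. \<bar>psi (Suc i) z\<bar> \<le> C * lam (Suc i) * M (Suc i)"
proof -
  obtain Pm where Pm: "Pm > 0" "\<And>z. z \<in> {0..1} \<Longrightarrow> \<bar>p z\<bar> \<le> Pm" using bounded_on_unit[OF p_cont] by blast
  obtain Q where Q: "Q > 0" "\<And>z. z \<in> {0..1} \<Longrightarrow> \<bar>q z\<bar> \<le> Q" using bounded_on_unit[OF q_cont] by blast
  obtain R where R: "R > 0" "\<And>z. z \<in> {0..1} \<Longrightarrow> \<bar>r z\<bar> \<le> R" using bounded_on_unit[OF r_cont] by blast
  define l where "l = lam (Suc m)"
  have l: "l > 0" using lam_pos by (simp add: l_def)
  show ?thesis
  proof (intro exI[of _ "(2 * Pm + Q) / l + R"] conjI allI impI ballI)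
    show "0 \<le> (2 * Pm + Q) / l + R" using Pm Q R l by (intro add_nonneg_nonneg divide_nonneg_nonneg) auto
    fix i z assume i: "i \<ge> m" and z: "z \<in> {0..1::real}"
    let ?f = "phi (Suc i)" and ?P = "psi (Suc i)" and ?l = "lam (Suc i)" and ?M = "M (Suc i)"
    have A: "isA ?f ?P (\<lambda>z. ?l * ?f z)" by (rule phi_isA) simp
    have ll: "l \<le> ?l" "?l > 0" using lam_le[of "Suc m" "Suc i"] i l by (auto simp: l_def)
    have Mn: "?M \<ge> 0" by (rule M_nonneg) simp
    have fM: "\<bar>?f y\<bar> \<le> ?M" if "y \<in> {0..1}" for y by (rule phi_le_M) (use that in auto)
    have D: "(?f has_real_derivative ?P y / p y) (at y)" if "0 < y" "y < 1" for y
      using isAD(2)[OF A, of y] that at_within_Icc_at[of 0 y 1] by auto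
    have "\<exists>d y. 0 < y \<and> y < 1 \<and> (?f has_real_derivative d) (at y) \<and> ?f 1 - ?f 0 = (1 - 0) * d"
    proof (rule MVT)
      show "?f differentiable (at y)" if "0 < y" "y < 1" for y
        using D[OF that] real_differentiable_def by blast
    qed (use isAD(4)[OF A] in auto)
    then obtain d y where y: "0 < y" "y < 1" "(?f has_real_derivative d) (at y)" "?f 1 - ?f 0 = (1 - 0) * d"
      by blast
    have "?P y / p y = d" using DERIV_unique[OF D[OF y(1,2)] y(3)] .
    then have Py: "?P y = p y * (?f 1 - ?f 0)" using p_pos[of y] y by auto
    have "\<bar>?P y\<bar> \<le> Pm * (2 * ?M)"
      unfolding Py abs_mult using Pm(1) Pm(2)[of y] y fM[of 1] fM[of 0] by (intro mult_mono) auto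
    moreover have "norm (?P z - ?P y) \<le> (Q * ?M + R * (?l * ?M)) * norm (z - y)"
    proof (rule field_differentiable_bound[where S = "{0..1}" and f' = "\<lambda>x. q x * ?f x - r x * (?l * ?f x)"])
      fix x :: real assume x: "x \<in> {0..1}"
      show "(?P has_real_derivative q x * ?f x - r x * (?l * ?f x)) (at x within {0..1})"
        by (rule isAD(3)[OF A x])
      have "\<bar>q x * ?f x\<bar> \<le> Q * ?M" unfolding abs_mult using Q fM[OF x] x by (intro mult_mono) auto
      moreover have "\<bar>r x * (?l * ?f x)\<bar> \<le> R * (?l * ?M)"
        unfolding abs_mult using R fM[OF x] x ll by (intro mult_mono mult_nonneg_nonneg) auto
      ultimately show "norm (q x * ?f x - r x * (?l * ?f x)) \<le> Q * ?M + R * (?l * ?M)" by simp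
    qed (use z y in auto)
    moreover have "(Q * ?M + R * (?l * ?M)) * norm (z - y) \<le> (Q * ?M + R * (?l * ?M)) * 1"
      using Q R ll Mn z y by (intro mult_left_mono) (auto simp: abs_le_iff)
    ultimately have "\<bar>?P z\<bar> \<le> (2 * Pm + Q) * ?M + R * ?l * ?M" by (simp add: algebra_simps)
    \<comment> \<open>\<open>l \<le> lam (Suc i)\<close> trades the term without \<open>lam\<close>
      for one with it.\<close>
    also have "(2 * Pm + Q) * ?M = (2 * Pm + Q) / l * l * ?M" using l by simp
    also have "\<dots> \<le> (2 * Pm + Q) / l * ?l * ?M"
      using ll Mn Pm Q l by (intro mult_right_mono mult_left_mono divide_nonneg_nonneg) auto
    finally show "\<bar>?P z\<bar> \<le> ((2 * Pm + Q) / l + R) * ?l * ?M" by (simp add: algebra_simps)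
  qed
qed

lemma moderate_phi: "moderate (\<lambda>i. phi (Suc i))"
  unfolding moderate_def
proof (intro conjI allI exI[of _ "1 / lam (Suc m)"] impI ballI)
  fix i z assume i: "i \<ge> m" and z: "z \<in> {0..1::real}"
  have "1 * M (Suc i) \<le> (1 / lam (Suc m) * lam (Suc i)) * M (Suc i)"
    using lam_pos lam_le[of "Suc m" "Suc i"] i M_nonneg[of "Suc i"] by (intro mult_right_mono) (auto simp: field_simps)
  then show "\<bar>phi (Suc i) z\<bar> \<le> 1 / lam (Suc m) * lam (Suc i) * M (Suc i)" using phi_le_M[of "Suc i" z] z by auto
qed (use lam_pos in \<open>auto intro: phi_cont\<close>)

lemma moderate_psi: "moderate (\<lambda>i. psi (Suc i))"
  unfolding moderate_def using psi_bound isAD(5)[OF phi_isA] by auto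

lemma moderate_lam_phi: "moderate (\<lambda>i z. lam (Suc i) * phi (Suc i) z)"
  unfolding moderate_def
proof (intro conjI allI exI[of _ 1] impI ballI)
  fix i z assume i: "i \<ge> m" and z: "z \<in> {0..1::real}"
  have "lam (Suc i) * \<bar>phi (Suc i) z\<bar> \<le> lam (Suc i) * M (Suc i)"
    using lam_pos'[of "Suc i"] i phi_le_M[of "Suc i" z] z by (intro mult_left_mono) auto
  then show "\<bar>lam (Suc i) * phi (Suc i) z\<bar> \<le> 1 * lam (Suc i) * M (Suc i)"
    using lam_pos'[of "Suc i"] i by (simp add: abs_mult)
qed (auto intro!: continuous_intros phi_cont)

text \<open>Mode equations \<open>\<omega>' = f - lam * \<omega>\<close> with a time-independent
  source in the first \<open>m\<close> modes. The exponential bound concerns the other modes, whose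
  eigenvalues are positive.\<close>

definition heat_coeffs :: "(nat \<Rightarrow> real) \<Rightarrow> (nat \<Rightarrow> real \<Rightarrow> real) \<Rightarrow> bool" where
  "heat_coeffs f \<omega> \<longleftrightarrow>
     (\<forall>i s. (\<omega> i has_real_derivative (f i - lam (Suc i) * \<omega> i s)) (at s)) \<and>
     (\<forall>i\<ge>m. f i = 0) \<and>
     (\<exists>A\<ge>0. \<forall>i\<ge>m. \<forall>s\<ge>0. \<bar>\<omega> i s\<bar> \<le> A * exp (- lam (Suc i) * s))"

text \<open>One coefficient family serves three series: \<open>c\<close> ranges over the
  eigenfunctions, their fluxes and \<open>lam\<close> times the eigenfunctions, giving the solution,
  its flux and its image under \<open>A\<close>.\<close>

definition hs :: "(nat \<Rightarrow> real \<Rightarrow> real) \<Rightarrow> (nat \<Rightarrow> real \<Rightarrow> real) \<Rightarrow> real \<Rightarrow> real \<Rightarrow> real" where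
  "hs \<omega> c s z = (\<Sum>i. \<omega> i s * c i z)"

text \<open>For times at least \<open>\<epsilon>\<close> the factor \<open>exp (- lam * s)\<close>
  is at most \<open>2 / (lam * \<epsilon>)^2\<close>, so a moderate family leaves a multiple of
  \<open>M / lam\<close> as majorant. The constant blows up as \<open>\<epsilon>\<close> tends to
  0.\<close>

lemma hs_uniform:
  assumes "heat_coeffs f \<omega>" "moderate c" "\<epsilon> > 0"
  shows "uniform_limit ({\<epsilon>..} \<times> {0..1}) (\<lambda>N x. \<Sum>i<N. \<omega> i (fst x) * c i (snd x)) (\<lambda>x. hs \<omega> c (fst x) (snd x)) sequentially"
proof -
  obtain A where A: "A \<ge> 0" "\<And>i s. i \<ge> m \<Longrightarrow> s \<ge> 0 \<Longrightarrow> \<bar>\<omega> i s\<bar> \<le> A * exp (- lam (Suc i) * s)"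
    using assms(1) by (auto simp: heat_coeffs_def)
  obtain C where C: "C \<ge> 0" "\<And>i z. i \<ge> m \<Longrightarrow> z \<in> {0..1} \<Longrightarrow> \<bar>c i z\<bar> \<le> C * lam (Suc i) * M (Suc i)"
    using assms(2) by (auto simp: moderate_def)
  have S: "summable (\<lambda>i. 2 * A * C / \<epsilon>\<^sup>2 * (M (Suc i) / lam (Suc i)))" by (intro summable_mult summable_M)
  have B: "\<forall>\<^sub>F i in sequentially. \<forall>x\<in>{\<epsilon>..} \<times> {0..1}. norm (\<omega> i (fst x) * c i (snd x)) \<le> 2 * A * C / \<epsilon>\<^sup>2 * (M (Suc i) / lam (Suc i))"
    unfolding eventually_sequentially
  proof (intro exI[of _ m] allI impI ballI)
    fix i and x :: "real \<times> real" assume i: "m \<le> i" and x: "x \<in> {\<epsilon>..} \<times> {0..1}"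
    let ?l = "lam (Suc i)"
    have l: "?l > 0" using lam_pos' i by simp
    have "\<bar>\<omega> i (fst x)\<bar> \<le> A * exp (- ?l * fst x)" using A(2)[OF i] x assms(3) by auto
    also have "\<dots> \<le> A * exp (- (?l * \<epsilon>))"
      using A(1) l x by (intro mult_left_mono) auto
    also have "\<dots> \<le> A * (2 / (?l * \<epsilon>)\<^sup>2)"
      using A(1) l assms(3) by (intro mult_left_mono exp_minus_le_inverse_square) auto
    finally have "\<bar>\<omega> i (fst x)\<bar> \<le> A * (2 / (?l * \<epsilon>)\<^sup>2)" .
    moreover have "\<bar>c i (snd x)\<bar> \<le> C * ?l * M (Suc i)" using C(2)[OF i] x by auto
    ultimately have "\<bar>\<omega> i (fst x)\<bar> * \<bar>c i (snd x)\<bar> \<le> (A * (2 / (?l * \<epsilon>)\<^sup>2)) * (C * ?l * M (Suc i))"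
      by (intro mult_mono) (use A(1) in auto)
    also have "\<dots> = 2 * A * C / \<epsilon>\<^sup>2 * (M (Suc i) / ?l)" using l assms(3) by (simp add: field_simps power2_eq_square)
    finally show "norm (\<omega> i (fst x) * c i (snd x)) \<le> 2 * A * C / \<epsilon>\<^sup>2 * (M (Suc i) / ?l)" by (simp add: abs_mult)
  qed
  show ?thesis unfolding hs_def by (rule Weierstrass_m_test_ev[OF B S])
qed

lemma heat_coeffs_cont: "heat_coeffs f \<omega> \<Longrightarrow> continuous_on S (\<omega> i)"
  unfolding heat_coeffs_def by (meson DERIV_isCont continuous_at_imp_continuous_on)

lemma hs_continuous:
  assumes "heat_coeffs f \<omega>" "moderate c"
  shows "continuous_on ({0<..} \<times> {0..1}) (\<lambda>x. hs \<omega> c (fst x) (snd x))"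
proof -
  have c: "continuous_on {0..1} (c i)" for i using assms(2) by (auto simp: moderate_def)
  have on: "continuous_on ({\<epsilon>..} \<times> {0..1}) (\<lambda>x. hs \<omega> c (fst x) (snd x))" if "\<epsilon> > 0" for \<epsilon>
  proof (rule uniform_limit_theorem[OF _ hs_uniform[OF assms that]])
    show "\<forall>\<^sub>F N in sequentially. continuous_on ({\<epsilon>..} \<times> {0..1}) (\<lambda>x. \<Sum>i<N. \<omega> i (fst x) * c i (snd x))"
      by (intro always_eventually allI continuous_on_sum continuous_on_mult
          continuous_on_compose2[OF heat_coeffs_cont[OF assms(1), of UNIV]] continuous_on_compose2[OF c])
        (auto intro!: continuous_intros)
  qed simp
  show ?thesis
    unfolding continuous_on_eq_continuous_within
  proof
    fix x :: "real \<times> real" assume x: "x \<in> {0<..} \<times> {0..1}"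
    define \<epsilon> where "\<epsilon> = fst x / 2"
    have e: "\<epsilon> > 0" "fst x > \<epsilon>" using x by (auto simp: \<epsilon>_def)
    have "continuous (at x within {\<epsilon>..} \<times> {0..1}) (\<lambda>x. hs \<omega> c (fst x) (snd x))"
      using on[OF e(1)] x e by (auto simp: continuous_on_eq_continuous_within)
    moreover have "at x within {0<..} \<times> {0..1} = at x within {\<epsilon>..} \<times> {0..1}"
    proof (rule at_within_nhd[of _ "{\<epsilon><..} \<times> UNIV"])
      show "open ({\<epsilon><..} \<times> (UNIV :: real set))" by (intro open_Times) auto
    qed (use e x in auto)
    ultimately show "continuous (at x within {0<..} \<times> {0..1}) (\<lambda>x. hs \<omega> c (fst x) (snd x))" by simp
  qed
qed

lemma hs_uniform_z:
  assumes "heat_coeffs f \<omega>" "moderate c" "s > 0"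
  shows "uniform_limit {0..1} (\<lambda>N z. \<Sum>i<N. \<omega> i s * c i z) (hs \<omega> c s) sequentially"
  using uniform_limit_compose'[OF hs_uniform[OF assms], of "\<lambda>z. (s, z)" "{0..1}"] by (auto simp: o_def)

lemma hs_sums:
  assumes "heat_coeffs f \<omega>" "moderate c" "s > 0" "z \<in> {0..1}"
  shows "(\<lambda>i. \<omega> i s * c i z) sums hs \<omega> c s z"
  unfolding sums_def using tendsto_uniform_limitI[OF hs_uniform_z[OF assms(1-3)] assms(4)] .

lemma hs_cont_z:
  assumes "heat_coeffs f \<omega>" "moderate c" "s > 0"
  shows "continuous_on {0..1} (hs \<omega> c s)"
proof -
  have "continuous_on {0..1} (\<lambda>z. hs \<omega> c (fst (s, z)) (snd (s, z)))"
    using assms(3) by (intro continuous_on_compose2[OF hs_continuous[OF assms(1,2)], of _ "\<lambda>z. (s, z)"] continuous_intros) auto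
  then show ?thesis by simp
qed

lemma series_real_derivative:
  fixes F F' :: "nat \<Rightarrow> real \<Rightarrow> real"
  assumes "\<And>i z. z \<in> {0..1} \<Longrightarrow> (F i has_real_derivative F' i z) (at z within {0..1})"
    and "uniform_limit {0..1} (\<lambda>N z. \<Sum>i<N. F' i z) G' sequentially"
    and "\<And>z. z \<in> {0..1} \<Longrightarrow> (\<lambda>i. F i z) sums G z"
    and "z \<in> {0..1}"
  shows "(G has_real_derivative G' z) (at z within {0..1})"
proof -
  obtain g where g: "\<And>z. z \<in> {0..1} \<Longrightarrow> (\<lambda>n. F n z) sums g z \<and> (g has_real_derivative G' z) (at z within {0..1})"
    using has_field_derivative_series[OF _ assms(1,2), of 0] sums_summable[OF assms(3)[of 0]] by force
  show ?thesis
    by (rule deriv_transform[OF assms(4) _ conjunct2[OF g[OF assms(4)]]]) (use g assms(3) sums_unique2 in blast)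
qed

text \<open>Termwise differentiation: the series of derivatives is a combination of heat series of
  moderate families with continuous coefficients and therefore converges uniformly.\<close>

lemma hs_isA:
  assumes "heat_coeffs f \<omega>" "s > 0"
  shows "isA (hs \<omega> (\<lambda>i. phi (Suc i)) s) (hs \<omega> (\<lambda>i. psi (Suc i)) s) (hs \<omega> (\<lambda>i z. lam (Suc i) * phi (Suc i) z) s)"
proof -
  let ?F = "hs \<omega> (\<lambda>i. phi (Suc i)) s" and ?P = "hs \<omega> (\<lambda>i. psi (Suc i)) s"
  let ?h = "hs \<omega> (\<lambda>i z. lam (Suc i) * phi (Suc i) z) s"
  note mods = moderate_phi moderate_psi moderate_lam_phi
  have bd: "bounded (g ` {0..1})" if "continuous_on {0..1::real} g" for g :: "real \<Rightarrow> real"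
    using that by (intro compact_imp_bounded compact_continuous_image) auto
  have mult: "uniform_limit {0..1} (\<lambda>N z. g z * F N z) (\<lambda>z. g z * G z) sequentially"
    if "uniform_limit {0..1} F G sequentially" "continuous_on {0..1} g" "continuous_on {0..1} G"
    for F G and g :: "real \<Rightarrow> real"
    by (intro uniform_lim_mult uniform_limit_const that bd)
  have pc: "continuous_on {0..1} (\<lambda>z. 1 / p z)"
    using p_cont p_pos by (intro continuous_intros) force+
  show ?thesis
    unfolding isA_def
  proof (intro conjI ballI)
    show "continuous_on {0..1} ?h" by (rule hs_cont_z[OF assms(1) mods(3) assms(2)])
    fix z :: real assume z: "z \<in> {0..1}"
    have "uniform_limit {0..1} (\<lambda>N z. 1 / p z * (\<Sum>i<N. \<omega> i s * psi (Suc i) z)) (\<lambda>z. 1 / p z * ?P z) sequentially"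
      by (intro mult hs_uniform_z[OF assms(1) mods(2) assms(2)] pc hs_cont_z[OF assms(1) mods(2) assms(2)])
    then have U1: "uniform_limit {0..1} (\<lambda>N z. \<Sum>i<N. \<omega> i s * (psi (Suc i) z / p z)) (\<lambda>z. ?P z / p z) sequentially"
      by (simp add: sum_distrib_left mult_ac)
    show "(?F has_real_derivative ?P z / p z) (at z within {0..1})"
      by (rule series_real_derivative[OF _ U1 hs_sums[OF assms(1) mods(1) assms(2)] z])
        (auto intro!: derivative_eq_intros isAD(2)[OF phi_isA])
    have "uniform_limit {0..1} (\<lambda>N z. q z * (\<Sum>i<N. \<omega> i s * phi (Suc i) z) - r z * (\<Sum>i<N. \<omega> i s * (lam (Suc i) * phi (Suc i) z)))
        (\<lambda>z. q z * ?F z - r z * ?h z) sequentially"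
      by (intro uniform_limit_minus mult hs_uniform_z[OF assms(1) mods(1) assms(2)] hs_uniform_z[OF assms(1) mods(3) assms(2)]
          q_cont r_cont hs_cont_z[OF assms(1) mods(1) assms(2)] hs_cont_z[OF assms(1) mods(3) assms(2)])
    then have U2: "uniform_limit {0..1} (\<lambda>N z. \<Sum>i<N. \<omega> i s * (q z * phi (Suc i) z - r z * (lam (Suc i) * phi (Suc i) z)))
        (\<lambda>z. q z * ?F z - r z * ?h z) sequentially"
      by (simp add: sum_distrib_left sum_subtractf[symmetric] algebra_simps)
    show "(?P has_real_derivative q z * ?F z - r z * ?h z) (at z within {0..1})"
      by (rule series_real_derivative[OF _ U2 hs_sums[OF assms(1) mods(2) assms(2)] z])
        (auto intro!: derivative_eq_intros isAD(3)[OF phi_isA])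
  qed
qed

lemma hs_bc:
  assumes "heat_coeffs f \<omega>" "s > 0"
  shows "bcL (hs \<omega> (\<lambda>i. phi (Suc i)) s) (hs \<omega> (\<lambda>i. psi (Suc i)) s) = 0"
    and "bcR (hs \<omega> (\<lambda>i. phi (Suc i)) s) (hs \<omega> (\<lambda>i. psi (Suc i)) s) = 0"
proof -
  have "(\<lambda>i. b1 * (\<omega> i s * phi (Suc i) 0) + b2 * ((\<omega> i s * psi (Suc i) 0) / p 0)) sums
      bcL (hs \<omega> (\<lambda>i. phi (Suc i)) s) (hs \<omega> (\<lambda>i. psi (Suc i)) s)"
    unfolding bcL_def
    by (intro sums_add sums_mult sums_divide hs_sums[OF assms(1) moderate_phi assms(2)] hs_sums[OF assms(1) moderate_psi assms(2)]) auto
  moreover have "b1 * (\<omega> i s * phi (Suc i) 0) + b2 * ((\<omega> i s * psi (Suc i) 0) / p 0) = 0" for i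
  proof -
    have "b1 * (\<omega> i s * phi (Suc i) 0) + b2 * ((\<omega> i s * psi (Suc i) 0) / p 0) = \<omega> i s * bcL (phi (Suc i)) (psi (Suc i))"
      by (simp add: bcL_def algebra_simps)
    then show ?thesis using phi_bc(1)[of "Suc i"] by simp
  qed
  ultimately show "bcL (hs \<omega> (\<lambda>i. phi (Suc i)) s) (hs \<omega> (\<lambda>i. psi (Suc i)) s) = 0"
    using sums_unique2[OF _ sums_zero] by simp
  have "(\<lambda>i. a1 * (\<omega> i s * phi (Suc i) 1) + a2 * ((\<omega> i s * psi (Suc i) 1) / p 1)) sums
      bcR (hs \<omega> (\<lambda>i. phi (Suc i)) s) (hs \<omega> (\<lambda>i. psi (Suc i)) s)"
    unfolding bcR_def
    by (intro sums_add sums_mult sums_divide hs_sums[OF assms(1) moderate_phi assms(2)] hs_sums[OF assms(1) moderate_psi assms(2)]) auto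
  moreover have "a1 * (\<omega> i s * phi (Suc i) 1) + a2 * ((\<omega> i s * psi (Suc i) 1) / p 1) = 0" for i
  proof -
    have "a1 * (\<omega> i s * phi (Suc i) 1) + a2 * ((\<omega> i s * psi (Suc i) 1) / p 1) = \<omega> i s * bcR (phi (Suc i)) (psi (Suc i))"
      by (simp add: bcR_def algebra_simps)
    then show ?thesis using phi_bc(2)[of "Suc i"] by simp
  qed
  ultimately show "bcR (hs \<omega> (\<lambda>i. phi (Suc i)) s) (hs \<omega> (\<lambda>i. psi (Suc i)) s) = 0"
    using sums_unique2[OF _ sums_zero] by simp
qed

lemma hs_coeff:
  assumes "heat_coeffs f \<omega>" "s > 0"
  shows "ip (hs \<omega> (\<lambda>i. phi (Suc i)) s) (phi (Suc j)) = \<omega> j s"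
proof (rule series_coeff(2)[of "\<lambda>i. \<omega> i s"])
  show "uniform_limit {0..1} (psum (\<lambda>i. \<omega> i s)) (hs \<omega> (\<lambda>i. phi (Suc i)) s) sequentially"
    unfolding psum_def[abs_def] by (rule hs_uniform_z[OF assms(1) moderate_phi assms(2)])
qed

text \<open>The time-differentiated series splits into the source, a finite sum, minus the series
  with \<open>lam * phi\<close>; the latter converges uniformly on a half-line that contains
  \<open>s\<close> in its interior.\<close>

lemma hs_time_derivative:
  assumes "heat_coeffs f \<omega>" "s > 0" "z \<in> {0..1}"
  shows "((\<lambda>s. hs \<omega> (\<lambda>i. phi (Suc i)) s z) has_real_derivative
     ((\<Sum>i<m. f i * phi (Suc i) z) - hs \<omega> (\<lambda>i z. lam (Suc i) * phi (Suc i) z) s z)) (at s)"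
proof -
  define \<epsilon> where "\<epsilon> = s / 2"
  have e: "\<epsilon> > 0" "s > \<epsilon>" using assms by (auto simp: \<epsilon>_def)
  let ?h = "\<lambda>s. hs \<omega> (\<lambda>i z. lam (Suc i) * phi (Suc i) z) s z"
  have f0: "f i = 0" if "i \<ge> m" for i using assms(1) that by (simp add: heat_coeffs_def)
  have "uniform_limit {\<epsilon>..} (\<lambda>N s. \<Sum>i<N. \<omega> i s * (lam (Suc i) * phi (Suc i) z)) ?h sequentially"
    using uniform_limit_compose'[OF hs_uniform[OF assms(1) moderate_lam_phi e(1)], of "\<lambda>s. (s, z)" "{\<epsilon>..}"] assms(3)
    by (auto simp: o_def)
  moreover have "uniform_limit {\<epsilon>..} (\<lambda>N s. \<Sum>i<N. f i * phi (Suc i) z) (\<lambda>s. \<Sum>i<m. f i * phi (Suc i) z) sequentially"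
  proof (rule uniform_limitI)
    fix d :: real assume d: "d > 0"
    show "\<forall>\<^sub>F N in sequentially. \<forall>x\<in>{\<epsilon>..}. dist (\<Sum>i<N. f i * phi (Suc i) z) (\<Sum>i<m. f i * phi (Suc i) z) < d"
      unfolding eventually_sequentially
    proof (intro exI[of _ m] allI impI ballI)
      fix N assume "m \<le> N"
      then have "(\<Sum>i<N. f i * phi (Suc i) z) = (\<Sum>i<m. f i * phi (Suc i) z)"
        by (intro sum.mono_neutral_right) (auto simp: f0)
      then show "dist (\<Sum>i<N. f i * phi (Suc i) z) (\<Sum>i<m. f i * phi (Suc i) z) < d" using d by simp
    qed
  qed
  ultimately have "uniform_limit {\<epsilon>..} (\<lambda>N s. (\<Sum>i<N. f i * phi (Suc i) z) - (\<Sum>i<N. \<omega> i s * (lam (Suc i) * phi (Suc i) z)))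
      (\<lambda>s. (\<Sum>i<m. f i * phi (Suc i) z) - ?h s) sequentially"
    by (intro uniform_limit_minus)
  then have U: "uniform_limit {\<epsilon>..} (\<lambda>N s. \<Sum>i<N. (f i - lam (Suc i) * \<omega> i s) * phi (Suc i) z)
      (\<lambda>s. (\<Sum>i<m. f i * phi (Suc i) z) - ?h s) sequentially"
    by (simp add: sum_subtractf[symmetric] algebra_simps)
  have D: "(\<omega> i has_real_derivative (f i - lam (Suc i) * \<omega> i s)) (at s)" for i s
    using assms(1) by (simp add: heat_coeffs_def)
  have "\<exists>g. \<forall>x\<in>{\<epsilon>..}. (\<lambda>i. \<omega> i x * phi (Suc i) z) sums g x \<and>
      (g has_real_derivative ((\<Sum>i<m. f i * phi (Suc i) z) - ?h x)) (at x within {\<epsilon>..})"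
  proof (rule has_field_derivative_series[OF _ _ U])
    show "((\<lambda>s. \<omega> n s * phi (Suc n) z) has_real_derivative (f n - lam (Suc n) * \<omega> n x) * phi (Suc n) z) (at x within {\<epsilon>..})" for n x
      by (auto intro!: derivative_eq_intros DERIV_subset[OF D])
    show "s \<in> {\<epsilon>..}" using e by simp
    show "summable (\<lambda>n. \<omega> n s * phi (Suc n) z)"
      using hs_sums[OF assms(1) moderate_phi assms(2,3)] by (rule sums_summable)
  qed simp
  then obtain g where g: "\<And>x. x \<in> {\<epsilon>..} \<Longrightarrow> (\<lambda>i. \<omega> i x * phi (Suc i) z) sums g x"
    "\<And>x. x \<in> {\<epsilon>..} \<Longrightarrow> (g has_real_derivative ((\<Sum>i<m. f i * phi (Suc i) z) - ?h x)) (at x within {\<epsilon>..})"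
    by blast
  have "((\<lambda>s. hs \<omega> (\<lambda>i. phi (Suc i)) s z) has_real_derivative ((\<Sum>i<m. f i * phi (Suc i) z) - ?h s)) (at s within {\<epsilon>..})"
  proof (rule deriv_transform[OF _ _ g(2)])
    fix y assume "y \<in> {\<epsilon>..}"
    then show "hs \<omega> (\<lambda>i. phi (Suc i)) y z = g y"
      using sums_unique2[OF hs_sums[OF assms(1) moderate_phi _ assms(3), of y] g(1)[of y]] e by auto
  qed (use e in auto)
  moreover have "at s within {\<epsilon>..} = at s" by (rule at_within_interior) (use e in auto)
  ultimately show ?thesis by simp
qed

end

section \<open>The lifted boundary input and the flow over one sampling interval\<close>

text \<open>\<open>eta l s\<close> is the integral of \<open>exp (- l * \<sigma>)\<close> over \<open>0 \<le> \<sigma> \<le> s\<close>.\<close>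

definition eta :: "real \<Rightarrow> real \<Rightarrow> real" where
  "eta l s = (if l = 0 then s else (1 - exp (- l * s)) / l)"

lemma eta_0 [simp]: "eta l 0 = 0"
  by (simp add: eta_def)

text \<open>Holds for \<open>l = 0\<close> as well, so a zero eigenvalue needs no separate formulas
  once everything is expressed by \<open>eta\<close>.\<close>

lemma exp_eta: "exp (- l * s) = 1 - l * eta l s"
  by (simp add: eta_def)

lemma eta_deriv: "(eta l has_real_derivative 1 - l * eta l s) (at s)"
proof (cases "l = 0")
  case True
  then have "eta l = (\<lambda>s. s)" by (auto simp: eta_def)
  then show ?thesis using True by simp
next
  case False
  then have "eta l = (\<lambda>s. (1 - exp (- l * s)) / l)" by (auto simp: eta_def)
  then show ?thesis using False unfolding exp_eta[symmetric] by (auto intro!: derivative_eq_intros)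
qed

context sturm_summable
begin

text \<open>The formula for \<open>g n\<close>, taken for all indices: the input also drives the
  modes beyond \<open>m\<close>.\<close>

definition gam :: "nat \<Rightarrow> real" where
  "gam n = p 1 / (a1\<^sup>2 + a2\<^sup>2) * (a2 * phi n 1 - a1 * dz (phi n) 1)"

text \<open>The pair \<open>(phi n 1, psi n 1 / p 1)\<close> is annihilated by
  \<open>(a1, a2)\<close> and therefore equals \<open>gam n / p 1\<close> times
  \<open>(a2, - a1)\<close>; inserting this in the Wronskian at 1 leaves the boundary
  functional.\<close>

lemma boundary_gam:
  assumes "n \<ge> 1"
  shows "F 1 * psi n 1 - P 1 * phi n 1 = - gam n * bcR F P"
proof -
  have p1: "p 1 > 0" by (rule p_pos) auto
  define d where "d = a1\<^sup>2 + a2\<^sup>2"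
  have d: "d > 0" using a_nz by (auto simp: d_def sum_power2_gt_zero_iff)
  have dzp: "dz (phi n) 1 = psi n 1 / p 1" using isA_dz(1)[OF phi_isA[OF assms], of 1] by simp
  have e: "a1 * phi n 1 * p 1 = - a2 * psi n 1"
    using phi_bc(2)[OF assms] p1 by (simp add: bcR_def field_simps)
  have "gam n * bcR F P * (d * p 1) = (a2 * phi n 1 * p 1 - a1 * psi n 1) * (a1 * F 1 * p 1 + a2 * P 1)"
    using p1 d unfolding gam_def bcR_def dzp d_def[symmetric] by (simp add: field_simps)
  also have "\<dots> = a2 * p 1 * F 1 * (a1 * phi n 1 * p 1) + a2\<^sup>2 * phi n 1 * p 1 * P 1 - a1\<^sup>2 * psi n 1 * F 1 * p 1 - a1 * P 1 * (a2 * psi n 1)"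
    by (simp add: algebra_simps power2_eq_square)
  also have "a2 * psi n 1 = - (a1 * phi n 1 * p 1)" using e by simp
  also have "a2 * p 1 * F 1 * (a1 * phi n 1 * p 1) + a2\<^sup>2 * phi n 1 * p 1 * P 1 - a1\<^sup>2 * psi n 1 * F 1 * p 1 - a1 * P 1 * (- (a1 * phi n 1 * p 1))
     = a2 * p 1 * F 1 * (- a2 * psi n 1) + a2\<^sup>2 * phi n 1 * p 1 * P 1 - a1\<^sup>2 * psi n 1 * F 1 * p 1 - a1 * P 1 * (- (a1 * phi n 1 * p 1))"
    unfolding e ..
  also have "\<dots> = - (F 1 * psi n 1 - P 1 * phi n 1) * (d * p 1)"
    by (simp add: d_def algebra_simps power2_eq_square)
  finally show ?thesis using d p1 by simp
qed

text \<open>The right boundary value enters mode \<open>n\<close> with the factor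
  \<open>gam n\<close>. This yields both the coefficients of the lifting and the differential
  equation for the coefficients of an arbitrary solution.\<close>

lemma Lagrange_phi:
  assumes "isA F P h" "bcL F P = 0" "n \<ge> 1"
  shows "ip h (phi n) = lam n * ip F (phi n) - gam n * bcR F P"
  using Lagrange[OF assms(1) phi_isA[OF assms(3)]] boundary_gam[OF assms(3), of F P]
    bcL_wronskian[OF assms(2) phi_bc(1)[OF assms(3)]]
  by (simp add: ip_scale_right)

end

locale sturm_control = sturm_summable +
  fixes k :: "nat \<Rightarrow> real"
  assumes gam_nz: "\<And>n. 1 \<le> n \<Longrightarrow> n \<le> m \<Longrightarrow> gam n \<noteq> 0"
begin

lemma ip_phi_sum:
  assumes "n \<ge> 1"
  shows "ip (\<lambda>z. \<Sum>j=1..m. c j * phi j z) (phi n) = (if n \<le> m then c n else 0)"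
proof -
  have "ip (\<lambda>z. \<Sum>j=1..m. c j * phi j z) (phi n) = (\<Sum>j=1..m. ip (\<lambda>z. c j * phi j z) (phi n))"
    using assms by (intro ip_sum_left L2_scale phi_L2) auto
  also have "\<dots> = (\<Sum>j=1..m. c j * (if j = n then 1 else 0))"
    using assms by (intro sum.cong) (auto simp: ip_scale_left phi_orth)
  finally show ?thesis using assms by (simp add: if_distrib cong: if_cong)
qed

text \<open>If 0 is an eigenvalue \<open>lam j\<close>, then \<open>j \<le> m\<close> and the
  right-hand side is the compatible one: pairing with \<open>phi j\<close> forces the zero-data
  solution to have right boundary value 1, as \<open>gam j\<close> is nonzero. Otherwise a multiple
  of the left solution corrects the boundary value.\<close>

lemma lifting_exists:
  "\<exists>F P. isA F P (\<lambda>z. \<Sum>j=1..m. - gam j * phi j z) \<and> bcL F P = 0 \<and> bcR F P = 1"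
proof -
  let ?h = "\<lambda>z. \<Sum>j=1..m. - gam j * phi j z"
  have "continuous_on {0..1} ?h" by (intro continuous_intros phi_cont) auto
  from isA_ivp[OF this, of 0 0 0] obtain F P where F: "isA F P ?h" "F 0 = 0" "P 0 = 0" by auto
  have FL: "bcL F P = 0" using bcL_zero_data[of F P] F by simp
  obtain u w where u: "isA u w (\<lambda>z. 0 * u z)" "bcL u w = 0" "u 0 = b2" "w 0 = - b1 * p 0"
    using left_solution[of 0] by blast
  show ?thesis
  proof (cases "SL_eigenvalue p r q a1 a2 b1 b2 0")
    case True
    then obtain j where j: "j \<ge> 1" "lam j = 0" using eigenvalue_iff by force
    then have jm: "j \<le> m" using lam_pos'[of j] by (cases "j > m") auto
    have "- gam j = - gam j * bcR F P"
      using Lagrange_phi[OF F(1) FL j(1)] ip_phi_sum[OF j(1), of "\<lambda>j. - gam j"] j jm by simp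
    then have "bcR F P = 1" using gam_nz[OF j(1) jm] by simp
    then show ?thesis using F FL by blast
  next
    case False
    then have nz: "bcR u w \<noteq> 0" using left_solution_bcR[OF u] by simp
    define c where "c = (1 - bcR F P) / bcR u w"
    have "isA (\<lambda>z. F z + c * u z) (\<lambda>z. P z + c * w z) (\<lambda>z. ?h z + c * (0 * u z))"
      by (intro isA_add isA_scale F u)
    then show ?thesis using FL u(2) nz
      by (intro exI[of _ "\<lambda>z. F z + c * u z"] exI[of _ "\<lambda>z. P z + c * w z"]) (simp add: bc_linear, simp add: c_def)
  qed
qed

definition lifting :: "(real \<Rightarrow> real) \<times> (real \<Rightarrow> real)" where
  "lifting = (SOME FP. isA (fst FP) (snd FP) (\<lambda>z. \<Sum>j=1..m. - gam j * phi j z) \<and>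
     bcL (fst FP) (snd FP) = 0 \<and> bcR (fst FP) (snd FP) = 1)"
definition B :: "real \<Rightarrow> real" where "B = fst lifting"
definition BP :: "real \<Rightarrow> real" where "BP = snd lifting"

lemma B_spec: "isA B BP (\<lambda>z. \<Sum>j=1..m. - gam j * phi j z)" "bcL B BP = 0" "bcR B BP = 1"
proof -
  obtain F P where "isA F P (\<lambda>z. \<Sum>j=1..m. - gam j * phi j z)" "bcL F P = 0" "bcR F P = 1"
    using lifting_exists by blast
  then have "\<exists>FP. isA (fst FP) (snd FP) (\<lambda>z. \<Sum>j=1..m. - gam j * phi j z) \<and>
     bcL (fst FP) (snd FP) = 0 \<and> bcR (fst FP) (snd FP) = 1" by (intro exI[of _ "(F, P)"]) auto
  from someI_ex[OF this] show "isA B BP (\<lambda>z. \<Sum>j=1..m. - gam j * phi j z)" "bcL B BP = 0" "bcR B BP = 1"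
    unfolding B_def BP_def lifting_def by auto
qed

lemma B_L2: "B \<in> L2 r"
  using isA_L2(1)[OF B_spec(1)] .

definition bc :: "nat \<Rightarrow> real" where "bc n = ip B (phi n)"

text \<open>On the first \<open>m\<close> modes the right-hand side chosen for \<open>B\<close>
  cancels the boundary contribution; beyond them \<open>bc n = gam n / lam n\<close>, which makes
  these quotients square summable.\<close>

lemma lam_bc:
  assumes "n \<ge> 1"
  shows "lam n * bc n = (if n \<le> m then 0 else gam n)"
  using Lagrange_phi[OF B_spec(1,2) assms] ip_phi_sum[OF assms, of "\<lambda>j. - gam j"] B_spec(3)
  by (auto simp: bc_def)

definition feedback :: "(real \<Rightarrow> real) \<Rightarrow> real" where
  "feedback \<xi> = (\<Sum>l=1..m. k l * ip \<xi> (phi l))"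

lemma feedback_eq:
  assumes "\<xi> \<in> L2 r"
  shows "(LINT z|lebesgue_on {0..1}. r z * (\<Sum>l=1..m. k l * phi l z) * \<xi> z) = feedback \<xi>"
proof -
  have "(LINT z|lebesgue_on {0..1}. r z * (\<Sum>l=1..m. k l * phi l z) * \<xi> z) = ip (\<lambda>z. \<Sum>l=1..m. k l * phi l z) \<xi>"
    by (simp add: l2_inner_def)
  also have "\<dots> = (\<Sum>l=1..m. ip (\<lambda>z. k l * phi l z) \<xi>)"
    using assms by (intro ip_sum_left L2_scale phi_L2) auto
  also have "\<dots> = feedback \<xi>" by (simp add: feedback_def ip_scale_left ip_sym)
  finally show ?thesis .
qed

text \<open>Coefficients of the state minus \<open>feedback \<xi> * B\<close>. This difference has
  homogeneous boundary conditions and the source \<open>- feedback \<xi> * A B\<close>, which lives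
  in the first \<open>m\<close> modes; hence the \<open>eta\<close> term there.\<close>

definition omega :: "(real \<Rightarrow> real) \<Rightarrow> nat \<Rightarrow> real \<Rightarrow> real" where
  "omega \<xi> i s = exp (- lam (Suc i) * s) * (ip \<xi> (phi (Suc i)) - feedback \<xi> * bc (Suc i)) +
     (if i < m then feedback \<xi> * gam (Suc i) * eta (lam (Suc i)) s else 0)"

lemma omega_heat_coeffs:
  assumes "\<xi> \<in> L2 r"
  shows "heat_coeffs (\<lambda>i. if i < m then feedback \<xi> * gam (Suc i) else 0) (omega \<xi>)"
  unfolding heat_coeffs_def
proof (intro conjI allI impI exI)
  fix i s
  show "(omega \<xi> i has_real_derivative (if i < m then feedback \<xi> * gam (Suc i) else 0) - lam (Suc i) * omega \<xi> i s) (at s)"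
    unfolding omega_def[abs_def]
    by (cases "i < m") (auto intro!: derivative_eq_intros eta_deriv simp: algebra_simps)
next
  show "0 \<le> nrm \<xi> + \<bar>feedback \<xi>\<bar> * nrm B" using nrm_nonneg by (intro add_nonneg_nonneg mult_nonneg_nonneg) auto
next
  fix i s assume i: "m \<le> i" and s: "(0::real) \<le> s"
  have "\<bar>ip \<xi> (phi (Suc i)) - feedback \<xi> * bc (Suc i)\<bar> \<le> \<bar>ip \<xi> (phi (Suc i))\<bar> + \<bar>feedback \<xi>\<bar> * \<bar>bc (Suc i)\<bar>"
    by (metis abs_mult abs_triangle_ineq4)
  also have "\<dots> \<le> nrm \<xi> + \<bar>feedback \<xi>\<bar> * nrm B"
    using coeff_le[OF assms, of "Suc i"] coeff_le[OF B_L2, of "Suc i"] by (intro add_mono mult_left_mono) (auto simp: bc_def)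
  finally show "\<bar>omega \<xi> i s\<bar> \<le> (nrm \<xi> + \<bar>feedback \<xi>\<bar> * nrm B) * exp (- lam (Suc i) * s)"
    using i by (simp add: omega_def abs_mult mult.commute)
qed auto

text \<open>\<open>flow \<xi> s\<close> is the state reached from \<open>\<xi>\<close> after time \<open>s\<close> when the input is held at \<open>feedback \<xi>\<close>.
  The series need not converge pointwise at \<open>s = 0\<close>, hence the case distinction.\<close>

definition flow :: "(real \<Rightarrow> real) \<Rightarrow> real \<Rightarrow> real \<Rightarrow> real" where
  "flow \<xi> s = (if s \<le> 0 then \<xi> else (\<lambda>z. feedback \<xi> * B z + hs (omega \<xi>) (\<lambda>i. phi (Suc i)) s z))"

definition flowP :: "(real \<Rightarrow> real) \<Rightarrow> real \<Rightarrow> real \<Rightarrow> real" where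
  "flowP \<xi> s z = feedback \<xi> * BP z + hs (omega \<xi>) (\<lambda>i. psi (Suc i)) s z"

text \<open>The image of the flow under \<open>A\<close> for positive times; its negative is the
  time derivative.\<close>

definition flowh :: "(real \<Rightarrow> real) \<Rightarrow> real \<Rightarrow> real \<Rightarrow> real" where
  "flowh \<xi> s z = feedback \<xi> * (\<Sum>j=1..m. - gam j * phi j z) + hs (omega \<xi>) (\<lambda>i z. lam (Suc i) * phi (Suc i) z) s z"

lemma flow_isA:
  assumes "\<xi> \<in> L2 r" "s > 0"
  shows "isA (flow \<xi> s) (flowP \<xi> s) (flowh \<xi> s)"
  using isA_add[OF isA_scale[OF B_spec(1)] hs_isA[OF omega_heat_coeffs[OF assms(1)] assms(2)], of "feedback \<xi>"] assms(2)
  by (simp add: flow_def flowP_def[abs_def] flowh_def[abs_def])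

lemma flow_bc:
  assumes "\<xi> \<in> L2 r" "s > 0"
  shows "bcL (flow \<xi> s) (flowP \<xi> s) = 0" "bcR (flow \<xi> s) (flowP \<xi> s) = feedback \<xi>"
  using hs_bc[OF omega_heat_coeffs[OF assms(1)] assms(2)] assms(2) B_spec(2,3)
  by (simp_all add: flow_def flowP_def[abs_def] bc_linear)

lemma flow_L2:
  assumes "\<xi> \<in> L2 r" shows "flow \<xi> s \<in> L2 r"
proof (cases "s \<le> 0")
  case True
  then show ?thesis using assms by (simp add: flow_def)
next
  case False
  then show ?thesis using isA_L2(1)[OF flow_isA[OF assms]] by simp
qed

lemma flow_time_derivative:
  assumes "\<xi> \<in> L2 r" "s > 0" "z \<in> {0..1}"
  shows "((\<lambda>s. flow \<xi> s z) has_real_derivative - flowh \<xi> s z) (at s)"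
proof -
  have sum_eq: "(\<Sum>i<m. (if i < m then feedback \<xi> * gam (Suc i) else 0) * phi (Suc i) z) = feedback \<xi> * (\<Sum>j=1..m. gam j * phi j z)"
  proof -
    have "(\<Sum>j=1..m. gam j * phi j z) = (\<Sum>i<m. gam (Suc i) * phi (Suc i) z)"
      using sum.atLeast1_atMost_eq[of "\<lambda>j. gam j * phi j z" m] by simp
    then show ?thesis by (simp only: sum_distrib_left) (intro sum.cong, auto)
  qed
  have "((\<lambda>s. feedback \<xi> * B z + hs (omega \<xi>) (\<lambda>i. phi (Suc i)) s z) has_real_derivative - flowh \<xi> s z) (at s)"
    by (rule DERIV_cong[OF DERIV_add[OF DERIV_const hs_time_derivative[OF omega_heat_coeffs[OF assms(1)] assms(2,3)]]])
      (simp only: flowh_def sum_eq, simp add: sum_negf)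
  then show ?thesis
  proof (rule has_field_derivative_transform_within_open)
    show "open {0::real<..}" "s \<in> {0<..}" using assms(2) by auto
  qed (auto simp: flow_def)
qed

text \<open>Variation of constants. The coefficient of the lifting contributes
  \<open>lam n * bc n * eta (lam n) s\<close> times the input; by \<open>lam_bc\<close> this is the
  input term for \<open>n > m\<close> and zero for \<open>n \<le> m\<close>, where the source
  supplies the term instead.\<close>

lemma flow_coeff:
  assumes "\<xi> \<in> L2 r" "s \<ge> 0" "n \<ge> 1"
  shows "ip (flow \<xi> s) (phi n) = exp (- lam n * s) * ip \<xi> (phi n) + gam n * eta (lam n) s * feedback \<xi>"
proof (cases "s = 0")
  case True
  then show ?thesis by (simp add: flow_def)
next
  case False
  then have s: "s > 0" using assms by simp
  obtain i where i: "n = Suc i" using assms(3) by (cases n) auto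
  note hc = omega_heat_coeffs[OF assms(1)]
  have "ip (flow \<xi> s) (phi n) = feedback \<xi> * bc n + omega \<xi> i s"
    using s hs_coeff[OF hc s, of i]
    by (simp add: flow_def ip_add_left L2_scale B_L2 L2_cont[OF hs_cont_z[OF hc moderate_phi s]] phi_L2 ip_scale_left bc_def i)
  also have "\<dots> = exp (- lam n * s) * ip \<xi> (phi n) + feedback \<xi> * (lam n * bc n) * eta (lam n) s +
       (if i < m then feedback \<xi> * gam n * eta (lam n) s else 0)"
    unfolding omega_def i[symmetric] exp_eta by (simp add: algebra_simps)
  also have "\<dots> = exp (- lam n * s) * ip \<xi> (phi n) + gam n * eta (lam n) s * feedback \<xi>"
    unfolding lam_bc[OF assms(3)] using i by simp
  finally show ?thesis .
qed

text \<open>By Parseval the squared distance is the series of squared coefficient increments. Beyond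
  the first \<open>m\<close> modes these are bounded, uniformly in time, by the coefficients of
  \<open>\<xi> - feedback \<xi> * B\<close>, so the series is continuous down to time 0.\<close>

lemma flow_L2_continuous:
  assumes "\<xi> \<in> L2 r" "s' \<ge> 0"
  shows "((\<lambda>s. nrm (\<lambda>z. flow \<xi> s z - flow \<xi> s' z)) \<longlongrightarrow> 0) (at s' within {0..})"
proof -
  define d where "d i = ip (\<lambda>z. \<xi> z - feedback \<xi> * B z) (phi (Suc i))" for i
  have dL: "(\<lambda>z. \<xi> z - feedback \<xi> * B z) \<in> L2 r" by (intro L2_diff assms L2_scale B_L2)
  have d_eq: "d i = ip \<xi> (phi (Suc i)) - feedback \<xi> * bc (Suc i)" for i
    unfolding d_def by (simp add: ip_diff_left assms L2_scale B_L2 phi_L2 ip_scale_left bc_def)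
  have d_sum: "summable (\<lambda>i. (d i)\<^sup>2)" unfolding d_def using Parseval[OF dL] by (rule sums_summable)
  define e where "e i s = ip (flow \<xi> s) (phi (Suc i)) - ip (flow \<xi> s') (phi (Suc i))" for i s
  define g where "g i s = exp (- lam (Suc i) * s) * ip \<xi> (phi (Suc i)) + gam (Suc i) * eta (lam (Suc i)) s * feedback \<xi>" for i s
  have eg: "e i s = g i s - g i s'" if "s \<ge> 0" for i s
    using flow_coeff[OF assms(1) that, of "Suc i"] flow_coeff[OF assms(1,2), of "Suc i"] by (simp add: e_def g_def)
  have eta_cont: "continuous_on S (eta l)" for S l
    by (meson DERIV_isCont continuous_at_imp_continuous_on eta_deriv)
  have g_cont: "continuous_on {0..} (g i)" for i
    unfolding g_def by (intro continuous_intros eta_cont)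
  have e_bound: "\<bar>e i s\<bar> \<le> \<bar>d i\<bar>" if "i \<ge> m" "s \<ge> 0" for i s
  proof -
    have l: "lam (Suc i) > 0" using lam_pos' that by simp
    have gb: "gam (Suc i) = lam (Suc i) * bc (Suc i)" using lam_bc[of "Suc i"] that by simp
    \<comment> \<open>Replacing \<open>gam\<close> by \<open>lam * bc\<close> leaves one decaying
      exponential times \<open>d i\<close> and a constant that cancels in differences; no bare
      factor \<open>lam\<close> survives.\<close>
    have g_alt: "g i s = exp (- lam (Suc i) * s) * d i + bc (Suc i) * feedback \<xi>" for s
      unfolding g_def gb d_eq exp_eta by (simp add: algebra_simps)
    have "e i s = (exp (- lam (Suc i) * s) - exp (- lam (Suc i) * s')) * d i"
      unfolding eg[OF that(2)] g_alt by (simp add: algebra_simps)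
    moreover have "exp (- lam (Suc i) * s) \<le> 1" "exp (- lam (Suc i) * s') \<le> 1" using l that assms(2) by auto
    then have "\<bar>exp (- lam (Suc i) * s) - exp (- lam (Suc i) * s')\<bar> \<le> 1"
      using exp_gt_zero[of "- lam (Suc i) * s"] exp_gt_zero[of "- lam (Suc i) * s'"] by linarith
    ultimately show ?thesis by (simp add: abs_mult mult_left_le_one_le)
  qed
  define N where "N s = (\<Sum>i. (g i s - g i s')\<^sup>2)" for s
  have U: "uniform_limit {0..} (\<lambda>n s. \<Sum>i<n. (g i s - g i s')\<^sup>2) N sequentially"
    unfolding N_def
  proof (rule Weierstrass_m_test_ev[OF _ d_sum])
    show "\<forall>\<^sub>F i in sequentially. \<forall>s\<in>{0..}. norm ((g i s - g i s')\<^sup>2) \<le> (d i)\<^sup>2"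
      unfolding eventually_sequentially
    proof (intro exI[of _ m] allI impI ballI)
      fix i s assume "m \<le> i" "s \<in> {0::real..}"
      then show "norm ((g i s - g i s')\<^sup>2) \<le> (d i)\<^sup>2"
        using power_mono[OF e_bound[of i s], of 2] eg[of s i] by simp
    qed
  qed
  have "continuous_on {0..} N"
    by (rule uniform_limit_theorem[OF _ U]) (auto intro!: always_eventually continuous_intros g_cont)
  then have "(N \<longlongrightarrow> N s') (at s' within {0..})" using assms(2) by (simp add: continuous_on_def)
  moreover have "N s' = 0" by (simp add: N_def)
  ultimately have "((\<lambda>s. sqrt (N s)) \<longlongrightarrow> sqrt 0) (at s' within {0..})" by (intro tendsto_real_sqrt) simp
  moreover have "nrm (\<lambda>z. flow \<xi> s z - flow \<xi> s' z) = sqrt (N s)" if "s \<ge> 0" for s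
  proof -
    have L: "(\<lambda>z. flow \<xi> s z - flow \<xi> s' z) \<in> L2 r" by (intro L2_diff flow_L2 assms)
    have "ip (\<lambda>z. flow \<xi> s z - flow \<xi> s' z) (phi (Suc i)) = g i s - g i s'" for i
      using eg[OF that, of i] by (simp add: e_def ip_diff_left flow_L2 assms phi_L2)
    then have "(\<lambda>i. (g i s - g i s')\<^sup>2) sums (nrm (\<lambda>z. flow \<xi> s z - flow \<xi> s' z))\<^sup>2"
      using Parseval[OF L] by simp
    then have "N s = (nrm (\<lambda>z. flow \<xi> s z - flow \<xi> s' z))\<^sup>2" unfolding N_def by (rule sums_unique[symmetric])
    then show ?thesis by (simp add: nrm_nonneg)
  qed
  then have "\<forall>\<^sub>F s in at s' within {0..}. sqrt (N s) = nrm (\<lambda>z. flow \<xi> s z - flow \<xi> s' z)"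
    unfolding eventually_at by (intro exI[of _ 1]) auto
  ultimately show ?thesis by (simp add: tendsto_cong)
qed

lemma flow_joint_continuous:
  assumes "\<xi> \<in> L2 r"
  shows "continuous_on ({0<..} \<times> {0..1}) (\<lambda>x. flowP \<xi> (fst x) (snd x))"
    and "continuous_on ({0<..} \<times> {0..1}) (\<lambda>x. flowh \<xi> (fst x) (snd x))"
proof -
  note hc = omega_heat_coeffs[OF assms]
  have snd_cont: "continuous_on ({0<..} \<times> {0..1}) (\<lambda>x::real \<times> real. g (snd x))" if "continuous_on {0..1} g" for g :: "real \<Rightarrow> real"
    by (rule continuous_on_compose2[OF that]) (auto intro!: continuous_intros)
  show "continuous_on ({0<..} \<times> {0..1}) (\<lambda>x. flowP \<xi> (fst x) (snd x))"
    unfolding flowP_def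
    by (intro continuous_intros hs_continuous[OF hc moderate_psi] snd_cont isAD(5)[OF B_spec(1)])
  show "continuous_on ({0<..} \<times> {0..1}) (\<lambda>x. flowh \<xi> (fst x) (snd x))"
    unfolding flowh_def
    by (intro continuous_intros hs_continuous[OF hc moderate_lam_phi] snd_cont phi_cont) auto
qed

definition flowD :: "(real \<Rightarrow> real) \<Rightarrow> real \<Rightarrow> real \<Rightarrow> (real \<times> real) \<Rightarrow>\<^sub>L real" where
  "flowD \<xi> s z = (- flowh \<xi> s z) *\<^sub>R fst_blinfun + (flowP \<xi> s z / p z) *\<^sub>R snd_blinfun"

text \<open>Total differentiability follows from the time derivative at the point and the jointly
  continuous space derivative; the latter is one-sided at the end points of the unit
  interval.\<close>

lemma flow_C1:
  assumes "\<xi> \<in> L2 r"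
  shows "continuous_on ({t0<..} \<times> {0..1}) (\<lambda>x. flowD \<xi> (fst x - t0) (snd x))"
    and "\<And>t z. t > t0 \<Longrightarrow> z \<in> {0..1} \<Longrightarrow>
      ((\<lambda>(t, z). flow \<xi> (t - t0) z) has_derivative blinfun_apply (flowD \<xi> (t - t0) z)) (at (t, z) within {t0<..} \<times> {0..1})"
proof -
  have pnz: "p z \<noteq> 0" if "0 \<le> z" "z \<le> 1" for z using p_pos[of z] that by auto
  have sh: "continuous_on ({t0<..} \<times> {0..1}) (\<lambda>x::real \<times> real. (fst x - t0, snd x))"
    "(\<lambda>x::real \<times> real. (fst x - t0, snd x)) ` ({t0<..} \<times> {0..1}) \<subseteq> {0<..} \<times> {0..1}"
    by (auto intro!: continuous_intros)
  have c: "continuous_on ({t0<..} \<times> {0..1}) (\<lambda>x. flowP \<xi> (fst x - t0) (snd x))"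
    "continuous_on ({t0<..} \<times> {0..1}) (\<lambda>x. flowh \<xi> (fst x - t0) (snd x))"
    using continuous_on_compose2[OF flow_joint_continuous(1)[OF assms] sh]
      continuous_on_compose2[OF flow_joint_continuous(2)[OF assms] sh]
    by simp_all
  have pc: "continuous_on ({t0<..} \<times> {0..1}) (\<lambda>x::real \<times> real. p (snd x))"
    by (rule continuous_on_compose2[OF p_cont]) (auto intro!: continuous_intros)
  have c3: "continuous_on ({t0<..} \<times> {0..1}) (\<lambda>x. flowP \<xi> (fst x - t0) (snd x) / p (snd x))"
    using pnz by (intro continuous_intros c pc) auto
  show "continuous_on ({t0<..} \<times> {0..1}) (\<lambda>x. flowD \<xi> (fst x - t0) (snd x))"
    unfolding flowD_def by (intro continuous_intros c c3)
  fix t z :: real assume t: "t > t0" and z: "z \<in> {0..1}"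
  have "((\<lambda>(t, z). flow \<xi> (t - t0) z) has_derivative
      (\<lambda>(tx, ty). (\<lambda>x. - flowh \<xi> (t - t0) z * x) tx + blinfun_apply (blinfun_scaleR_left (flowP \<xi> (t - t0) z / p z)) ty))
      (at (t, z) within {t0<..} \<times> {0..1})"
  proof (rule has_derivative_partialsI)
    have d: "((\<lambda>t. t - t0) has_real_derivative 1) (at t)" by (auto intro!: derivative_eq_intros)
    have "(((\<lambda>s. flow \<xi> s z)) has_real_derivative - flowh \<xi> (t - t0) z) (at (t - t0))"
      by (rule flow_time_derivative[OF assms _ z]) (use t in auto)
    from DERIV_chain2[OF this d]
    have "((\<lambda>t. flow \<xi> (t - t0) z) has_real_derivative - flowh \<xi> (t - t0) z) (at t)"
      by (simp only: mult_1_right)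
    then show "((\<lambda>x. flow \<xi> (x - t0) z) has_derivative (\<lambda>x. - flowh \<xi> (t - t0) z * x)) (at t within {t0<..})"
      unfolding has_field_derivative_def by (rule has_derivative_at_withinI)
    fix x y :: real assume x: "x \<in> {t0<..}" and y: "y \<in> {0..1}"
    show "((\<lambda>y. flow \<xi> (x - t0) y) has_derivative blinfun_apply (blinfun_scaleR_left (flowP \<xi> (x - t0) y / p y))) (at y within {0..1})"
      by (rule has_derivative_eq_rhs[OF isAD(2)[OF flow_isA[OF assms, of "x - t0"] y, unfolded has_field_derivative_def]])
        (use x in \<open>auto simp: fun_eq_iff\<close>)
  next
    have "continuous_on ({t0<..} \<times> {0..1}) (\<lambda>(x, y). blinfun_scaleR_left (flowP \<xi> (x - t0) y / p y))"
      unfolding split_beta by (intro bounded_linear.continuous_on[OF bounded_linear_blinfun_scaleR_left] c3)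
    then show "continuous (at (t, z) within {t0<..} \<times> {0..1}) (\<lambda>(x, y). blinfun_scaleR_left (flowP \<xi> (x - t0) y / p y))"
      using t z by (simp add: continuous_on_eq_continuous_within)
  qed (use z in auto)
  moreover have "(\<lambda>(tx, ty). (\<lambda>x. - flowh \<xi> (t - t0) z * x) tx + blinfun_apply (blinfun_scaleR_left (flowP \<xi> (t - t0) z / p z)) ty) = blinfun_apply (flowD \<xi> (t - t0) z)"
    by (auto simp: fun_eq_iff flowD_def blinfun.bilinear_simps snd_blinfun.rep_eq)
  ultimately show "((\<lambda>(t, z). flow \<xi> (t - t0) z) has_derivative blinfun_apply (flowD \<xi> (t - t0) z)) (at (t, z) within {t0<..} \<times> {0..1})"
    by simp
qed

end

section \<open>Sampled finite-dimensional systems with a Hurwitz matrix\<close>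

lemma mat_mult_entry:
  assumes "A \<in> carrier_mat n n" "C \<in> carrier_mat n n" "i < n" "l < n"
  shows "(A * C) $$ (i, l) = (\<Sum>j<n. A $$ (i, j) * C $$ (j, l))"
  using assms by (auto simp: scalar_prod_def lessThan_atLeast0 intro!: sum.cong)

text \<open>A complex triangular form has the eigenvalues on its diagonal, whence the negative real
  parts. The conclusions are entrywise so that the estimates below can work with plain sums.\<close>

lemma hurwitz_triangularisation:
  assumes M: "M \<in> carrier_mat m m" and hw: "hurwitz M"
  obtains U P Q :: "nat \<Rightarrow> nat \<Rightarrow> complex"
  where "\<And>i j. j < i \<Longrightarrow> i < m \<Longrightarrow> U i j = 0"
    and "\<And>i. i < m \<Longrightarrow> Re (U i i) < 0"
    and "\<And>i l. i < m \<Longrightarrow> l < m \<Longrightarrow> (\<Sum>j<m. Q i j * of_real (M $$ (j, l))) = (\<Sum>j<m. U i j * Q j l)"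
    and "\<And>i l. i < m \<Longrightarrow> l < m \<Longrightarrow> (\<Sum>j<m. P i j * Q j l) = (if i = l then 1 else 0)"
proof -
  let ?A = "map_mat complex_of_real M"
  have A: "?A \<in> carrier_mat m m" using M by simp
  obtain as where "char_poly ?A = (\<Prod>a\<leftarrow>as. [:- a, 1:])" using char_poly_factorized[OF A] by blast
  then obtain T where T: "T \<in> carrier_mat m m" "upper_triangular T" "similar_mat ?A T"
    using schur_decomposition_exists[OF A] by blast
  then obtain P Q where w: "similar_mat_wit ?A T P Q" by (auto simp: similar_mat_def)
  note PQ = similar_mat_witD2[OF A w]
  have QA: "Q * ?A = T * Q"
  proof -
    have "Q * ?A = Q * (P * T * Q)" using PQ(3) by simp
    also have "\<dots> = (Q * P) * (T * Q)"
      using PQ(5,6,7) by (simp add: assoc_mult_mat[of _ m m _ m _ m])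
    finally show ?thesis using PQ by simp
  qed
  show ?thesis
  proof (rule that[of "\<lambda>i j. T $$ (i, j)" "\<lambda>i j. Q $$ (i, j)" "\<lambda>i j. P $$ (i, j)"])
    show "T $$ (i, j) = 0" if "j < i" "i < m" for i j using T that by auto
    show "Re (T $$ (i, i)) < 0" if i: "i < m" for i
    proof -
      have "T $$ (i, i) \<in> set (diag_mat T)" using i T(1) by (auto simp: diag_mat_def)
      then have "poly (char_poly T) (T $$ (i, i)) = 0"
        unfolding char_poly_upper_triangular[OF T(1,2)] poly_prod_list prod_list_zero_iff by force
      then have "eigenvalue ?A (T $$ (i, i))"
        unfolding eigenvalue_root_char_poly[OF A] char_poly_similar[OF T(3)] .
      then show ?thesis using hw by (auto simp: hurwitz_def)
    qed
    show "(\<Sum>j<m. Q $$ (i, j) * of_real (M $$ (j, l))) = (\<Sum>j<m. T $$ (i, j) * Q $$ (j, l))" if "i < m" "l < m" for i l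
    proof -
      have "(\<Sum>j<m. Q $$ (i, j) * of_real (M $$ (j, l))) = (Q * ?A) $$ (i, l)"
        unfolding mat_mult_entry[OF PQ(7) A that] using M that by (intro sum.cong) auto
      also have "\<dots> = (\<Sum>j<m. T $$ (i, j) * Q $$ (j, l))"
        unfolding QA by (rule mat_mult_entry[OF T(1) PQ(7) that])
      finally show ?thesis .
    qed
    show "(\<Sum>j<m. P $$ (i, j) * Q $$ (j, l)) = (if i = l then 1 else 0)" if "i < m" "l < m" for i l
      using mat_mult_entry[OF PQ(6,7) that] PQ(1) that by simp
  qed
qed

text \<open>The square is \<open>1 + 2 h Re u + h^2 |u|^2\<close>, at most
  \<open>1 - 4 \<sigma> h + 2 \<sigma> h\<close>, which lies below
  \<open>(1 - \<sigma> h)^2\<close>: the step size restriction keeps the quadratic term below half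
  of the damping.\<close>

lemma norm_one_plus_le:
  assumes "0 \<le> h" "Re u \<le> - 2 * \<sigma>" "norm u \<le> b" "h * b\<^sup>2 \<le> 2 * \<sigma>" "h * \<sigma> \<le> 1" "\<sigma> > 0"
  shows "norm (1 + of_real h * u) \<le> 1 - \<sigma> * h"
proof (rule power2_le_imp_le)
  have "(norm (1 + of_real h * u))\<^sup>2 = 1 + 2 * h * Re u + h\<^sup>2 * (norm u)\<^sup>2"
    unfolding cmod_power2 by (simp add: power2_eq_square algebra_simps)
  also have "\<dots> \<le> 1 + 2 * h * (- 2 * \<sigma>) + h * (2 * \<sigma>)"
  proof -
    have "h\<^sup>2 * (norm u)\<^sup>2 \<le> h * (h * b\<^sup>2)"
      using mult_left_mono[OF power_mono[OF assms(3) norm_ge_zero, of 2], of "h\<^sup>2"]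
      by (simp add: power2_eq_square mult.assoc)
    also have "\<dots> \<le> h * (2 * \<sigma>)" using assms by (intro mult_left_mono) auto
    finally have 1: "h\<^sup>2 * (norm u)\<^sup>2 \<le> h * (2 * \<sigma>)" .
    have "h * Re u \<le> h * (- 2 * \<sigma>)" using assms by (intro mult_left_mono) auto
    with 1 show ?thesis by linarith
  qed
  also have "\<dots> \<le> (1 - \<sigma> * h)\<^sup>2"
    unfolding power2_diff using zero_le_power2[of "\<sigma> * h"] by (simp add: algebra_simps)
  finally show "(norm (1 + of_real h * u))\<^sup>2 \<le> (1 - \<sigma> * h)\<^sup>2" .
qed (use assms in \<open>simp add: mult.commute\<close>)

text \<open>The weights \<open>L ^ i\<close> with large \<open>L\<close> make the strictly upper triangular part negligible
  against the diagonal, so that an explicit Euler step with small step size contracts the weighted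
  \<open>l1\<close> norm of the triangular coordinates.\<close>

lemma hurwitz_euler_contraction:
  assumes M: "M \<in> carrier_mat m m" and hw: "hurwitz M" and m: "m \<ge> 1"
  obtains V :: "(nat \<Rightarrow> real) \<Rightarrow> real" and C1 C2 \<gamma> h0
  where "C1 > 0" "C2 > 0" "\<gamma> > 0" "h0 > 0"
    and "\<And>x. V x \<ge> 0"
    and "\<And>x y. V (\<lambda>j. x j + y j) \<le> V x + V y"
    and "\<And>x i. i < m \<Longrightarrow> \<bar>x i\<bar> \<le> C1 * V x"
    and "\<And>x. V x \<le> C2 * (\<Sum>j<m. \<bar>x j\<bar>)"
    and "\<And>x h. 0 \<le> h \<Longrightarrow> h \<le> h0 \<Longrightarrow> V (\<lambda>i. x i + h * (\<Sum>j<m. M $$ (i, j) * x j)) \<le> (1 - \<gamma> * h) * V x"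
proof (rule hurwitz_triangularisation[OF M hw])
  fix U P Q :: "nat \<Rightarrow> nat \<Rightarrow> complex"
  assume
    U0: "\<And>i j. j < i \<Longrightarrow> i < m \<Longrightarrow> U i j = 0"
    and Re: "\<And>i. i < m \<Longrightarrow> Re (U i i) < 0"
    and QM: "\<And>i l. i < m \<Longrightarrow> l < m \<Longrightarrow> (\<Sum>j<m. Q i j * of_real (M $$ (j, l))) = (\<Sum>j<m. U i j * Q j l)"
    and PQ: "\<And>i l. i < m \<Longrightarrow> l < m \<Longrightarrow> (\<Sum>j<m. P i j * Q j l) = (if i = l then 1 else 0)"
  have bound: "\<exists>c>0. \<forall>i<m. \<forall>j<m. norm (W i j) \<le> c" for W :: "nat \<Rightarrow> nat \<Rightarrow> complex"
  proof (intro exI[of _ "1 + (\<Sum>i<m. \<Sum>j<m. norm (W i j))"] conjI allI impI)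
    show "0 < 1 + (\<Sum>i<m. \<Sum>j<m. norm (W i j))" by (intro add_pos_nonneg sum_nonneg) auto
    fix i j assume ij: "i < m" "j < m"
    have "norm (W i j) \<le> (\<Sum>j<m. norm (W i j))" using ij by (intro member_le_sum) auto
    also have "\<dots> \<le> (\<Sum>i<m. \<Sum>j<m. norm (W i j))" using ij
      by (intro member_le_sum[of i _ "\<lambda>i. \<Sum>j<m. norm (W i j)"] sum_nonneg) auto
    finally show "norm (W i j) \<le> 1 + (\<Sum>i<m. \<Sum>j<m. norm (W i j))" by simp
  qed
  obtain b where b: "b > 0" "\<And>i j. i < m \<Longrightarrow> j < m \<Longrightarrow> norm (U i j) \<le> b" using bound[of U] by blast
  obtain cP where cP: "cP > 0" "\<And>i j. i < m \<Longrightarrow> j < m \<Longrightarrow> norm (P i j) \<le> cP" using bound[of P] by blast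
  obtain cQ where cQ: "cQ > 0" "\<And>i j. i < m \<Longrightarrow> j < m \<Longrightarrow> norm (Q i j) \<le> cQ" using bound[of Q] by blast
  define \<sigma> where "\<sigma> = Min ((\<lambda>i. - Re (U i i) / 2) ` {..<m})"
  have \<sigma>: "\<sigma> > 0" unfolding \<sigma>_def using Re m by (subst Min_gr_iff) (auto simp: lessThan_empty_iff)
  have Re\<sigma>: "Re (U i i) \<le> - 2 * \<sigma>" if "i < m" for i
  proof -
    have "\<sigma> \<le> - Re (U i i) / 2" unfolding \<sigma>_def using that by (intro Min_le) auto
    then show ?thesis by simp
  qed
  \<comment> \<open>Large enough that the off-diagonal terms, at most \<open>m * b\<close> times the
    next lower weight, cost no more than \<open>\<sigma> / 2\<close>.\<close>
  define L where "L = max 1 (2 * real m * b / \<sigma>)"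
  have L: "L \<ge> 1" "real m * b \<le> \<sigma> / 2 * L"
  proof -
    show "L \<ge> 1" by (simp add: L_def)
    have "2 * real m * b / \<sigma> \<le> L" by (simp add: L_def)
    then show "real m * b \<le> \<sigma> / 2 * L" using \<sigma> by (simp add: field_simps)
  qed
  define y where "y x i = (\<Sum>j<m. Q i j * of_real (x j))" for x :: "nat \<Rightarrow> real" and i
  define V where "V x = (\<Sum>i<m. L ^ i * norm (y x i))" for x
  \<comment> \<open>The two step size conditions of \<open>norm_one_plus_le\<close>.\<close>
  define h0 where "h0 = min (2 * \<sigma> / b\<^sup>2) (1 / \<sigma>)"
  have Vn: "V x \<ge> 0" for x unfolding V_def using L(1) by (intro sum_nonneg) auto
  show ?thesis
  proof (rule that[of "cP" "cQ * (\<Sum>i<m. L ^ i)" "\<sigma> / 2" h0 V])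
    show "cP > 0" "\<sigma> / 2 > 0" by fact (use \<sigma> in simp)
    show "cQ * (\<Sum>i<m. L ^ i) > 0" using cQ L m by (intro mult_pos_pos sum_pos) (auto simp: lessThan_empty_iff)
    show "h0 > 0" using \<sigma> b by (simp add: h0_def)
    show "V x \<ge> 0" for x by fact
    show "V (\<lambda>j. x j + x' j) \<le> V x + V x'" for x x'
    proof -
      have "y (\<lambda>j. x j + x' j) i = y x i + y x' i" for i
        by (simp add: y_def algebra_simps sum.distrib)
      then have "V (\<lambda>j. x j + x' j) \<le> (\<Sum>i<m. L ^ i * (norm (y x i) + norm (y x' i)))"
        unfolding V_def using L by (intro sum_mono mult_left_mono) (auto intro: norm_triangle_ineq)
      then show ?thesis by (simp add: V_def algebra_simps sum.distrib)
    qed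
    show "\<bar>x i\<bar> \<le> cP * V x" if i: "i < m" for x i
    proof -
      have "(\<Sum>j<m. P i j * y x j) = (\<Sum>l<m. \<Sum>j<m. P i j * (Q j l * of_real (x l)))"
        unfolding y_def sum_distrib_left by (rule sum.swap)
      also have "\<dots> = (\<Sum>l<m. (\<Sum>j<m. P i j * Q j l) * of_real (x l))"
        by (simp add: sum_distrib_right mult.assoc)
      also have "\<dots> = (\<Sum>l<m. (if i = l then 1 else 0) * of_real (x l))"
        by (intro sum.cong refl) (use PQ i in auto)
      also have "\<dots> = of_real (x i)" using i by (simp add: if_distrib[of "\<lambda>c. c * _"] cong: if_cong)
      finally have "\<bar>x i\<bar> = norm (\<Sum>j<m. P i j * y x j)" by simp
      also have "\<dots> \<le> (\<Sum>j<m. cP * (L ^ j * norm (y x j)))"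
      proof (intro sum_norm_le)
        fix j assume "j \<in> {..<m}"
        moreover have "1 * norm (y x j) \<le> L ^ j * norm (y x j)" using L by (intro mult_right_mono) auto
        ultimately show "norm (P i j * y x j) \<le> cP * (L ^ j * norm (y x j))"
          unfolding norm_mult using cP i by (intro mult_mono) auto
      qed
      finally show ?thesis by (simp add: V_def sum_distrib_left)
    qed
    show "V x \<le> cQ * (\<Sum>i<m. L ^ i) * (\<Sum>j<m. \<bar>x j\<bar>)" for x
    proof -
      have "norm (y x i) \<le> cQ * (\<Sum>j<m. \<bar>x j\<bar>)" if "i < m" for i
        unfolding y_def sum_distrib_left using cQ that by (intro sum_norm_le) (auto simp: norm_mult intro!: mult_right_mono)
      then have "V x \<le> (\<Sum>i<m. L ^ i * (cQ * (\<Sum>j<m. \<bar>x j\<bar>)))"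
        unfolding V_def using L by (intro sum_mono mult_left_mono) auto
      also have "\<dots> = cQ * (\<Sum>i<m. L ^ i) * (\<Sum>j<m. \<bar>x j\<bar>)"
        by (simp add: sum_distrib_right sum_distrib_left mult_ac)
      finally show ?thesis .
    qed
    fix x :: "nat \<Rightarrow> real" and h assume h: "0 \<le> h" "h \<le> h0"
    have hb: "h * b\<^sup>2 \<le> 2 * \<sigma>" "h * \<sigma> \<le> 1" using h b \<sigma> by (auto simp: h0_def field_simps)
    define x' where "x' = (\<lambda>i. x i + h * (\<Sum>j<m. M $$ (i, j) * x j))"
    have y': "y x' i = y x i + of_real h * (\<Sum>j<m. U i j * y x j)" if i: "i < m" for i
    proof -
      have "(\<Sum>j<m. Q i j * of_real (\<Sum>l<m. M $$ (j, l) * x l)) = (\<Sum>l<m. \<Sum>j<m. Q i j * (of_real (M $$ (j, l)) * of_real (x l)))"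
        unfolding of_real_sum sum_distrib_left of_real_mult by (rule sum.swap)
      also have "\<dots> = (\<Sum>l<m. (\<Sum>j<m. Q i j * of_real (M $$ (j, l))) * of_real (x l))"
        by (simp add: sum_distrib_right mult.assoc)
      also have "\<dots> = (\<Sum>l<m. (\<Sum>j<m. U i j * Q j l) * of_real (x l))"
        by (intro sum.cong refl) (use QM i in auto)
      also have "\<dots> = (\<Sum>l<m. \<Sum>j<m. U i j * (Q j l * of_real (x l)))"
        by (simp add: sum_distrib_right mult.assoc)
      also have "\<dots> = (\<Sum>j<m. U i j * y x j)"
        unfolding y_def sum_distrib_left by (rule sum.swap)
      finally have "(\<Sum>j<m. Q i j * of_real (\<Sum>l<m. M $$ (j, l) * x l)) = (\<Sum>j<m. U i j * y x j)" .
      moreover have "y x' i = y x i + of_real h * (\<Sum>j<m. Q i j * of_real (\<Sum>l<m. M $$ (j, l) * x l))"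
      proof -
        have "y (\<lambda>i. x i + h * w i) i = y x i + of_real h * (\<Sum>j<m. Q i j * of_real (w j))" for w
          unfolding y_def by (simp add: algebra_simps sum.distrib sum_distrib_left)
        then show ?thesis unfolding x'_def .
      qed
      ultimately show ?thesis by simp
    qed
    have "norm (y x' i) \<le> (1 - \<sigma> * h) * norm (y x i) + h * (\<Sum>j\<in>{i<..<m}. b * norm (y x j))" if i: "i < m" for i
    proof -
      have "(\<Sum>j<m. U i j * y x j) = (\<Sum>j\<in>insert i {i<..<m}. U i j * y x j)"
      proof (rule sum.mono_neutral_right)
        show "\<forall>j\<in>{..<m} - insert i {i<..<m}. U i j * y x j = 0"
        proof
          fix j assume "j \<in> {..<m} - insert i {i<..<m}"
          then have "j < i" by auto
          then show "U i j * y x j = 0" using U0[OF _ i] by simp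
        qed
      qed (use i in auto)
      also have "\<dots> = U i i * y x i + (\<Sum>j\<in>{i<..<m}. U i j * y x j)" by simp
      finally have "y x' i = (1 + of_real h * U i i) * y x i + of_real h * (\<Sum>j\<in>{i<..<m}. U i j * y x j)"
        unfolding y'[OF i] by (simp add: algebra_simps)
      then have "norm (y x' i) \<le> norm (1 + of_real h * U i i) * norm (y x i) + h * norm (\<Sum>j\<in>{i<..<m}. U i j * y x j)"
        using norm_triangle_ineq[of "(1 + of_real h * U i i) * y x i" "of_real h * (\<Sum>j\<in>{i<..<m}. U i j * y x j)"] h(1)
        by (simp add: norm_mult)
      also have "\<dots> \<le> (1 - \<sigma> * h) * norm (y x i) + h * (\<Sum>j\<in>{i<..<m}. b * norm (y x j))"
      proof (intro add_mono mult_right_mono mult_left_mono)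
        show "norm (1 + of_real h * U i i) \<le> 1 - \<sigma> * h"
          by (rule norm_one_plus_le[OF h(1) Re\<sigma>[OF i] b(2)[OF i i] hb \<sigma>])
        show "norm (\<Sum>j\<in>{i<..<m}. U i j * y x j) \<le> (\<Sum>j\<in>{i<..<m}. b * norm (y x j))"
          using b(2) i by (intro sum_norm_le) (auto simp: norm_mult intro!: mult_right_mono)
      qed (use h in auto)
      finally show ?thesis .
    qed
    then have "V x' \<le> (\<Sum>i<m. L ^ i * ((1 - \<sigma> * h) * norm (y x i) + h * (\<Sum>j\<in>{i<..<m}. b * norm (y x j))))"
      unfolding V_def using L(1) by (intro sum_mono mult_left_mono) auto
    also have "\<dots> = (1 - \<sigma> * h) * V x + h * (\<Sum>i<m. \<Sum>j\<in>{i<..<m}. L ^ i * (b * norm (y x j)))"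
      by (simp add: V_def algebra_simps sum.distrib sum_distrib_left sum_subtractf)
    \<comment> \<open>Collect by columns: coordinate \<open>j\<close> contributes only to rows
      \<open>i < j\<close>, whose weights sum to at most \<open>m * L ^ (j - 1)\<close>.\<close>
    also have "(\<Sum>i<m. \<Sum>j\<in>{i<..<m}. L ^ i * (b * norm (y x j))) = (\<Sum>j<m. \<Sum>i<j. L ^ i * (b * norm (y x j)))"
    proof -
      have "(\<Sum>i<m. \<Sum>j\<in>{i<..<m}. L ^ i * (b * norm (y x j))) = (\<Sum>i<m. \<Sum>j\<in>{j. j < m \<and> i < j}. L ^ i * (b * norm (y x j)))"
        by (intro sum.cong) auto
      also have "\<dots> = (\<Sum>j<m. \<Sum>i\<in>{i. i < m \<and> i < j}. L ^ i * (b * norm (y x j)))"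
        using sum.swap_restrict[of "{..<m}" "{..<m}" "\<lambda>i j. L ^ i * (b * norm (y x j))" "\<lambda>i j. i < j"] by simp
      also have "\<dots> = (\<Sum>j<m. \<Sum>i<j. L ^ i * (b * norm (y x j)))" by (intro sum.cong) auto
      finally show ?thesis .
    qed
    also have "\<dots> \<le> (\<Sum>j<m. \<sigma> / 2 * (L ^ j * norm (y x j)))"
    proof (intro sum_mono)
      fix j assume j: "j \<in> {..<m}"
      have "(\<Sum>i<j. L ^ i) * b \<le> \<sigma> / 2 * L ^ j"
      proof (cases j)
        case (Suc j')
        have "(\<Sum>i<j. L ^ i) \<le> (\<Sum>i<j. L ^ j')"
          using L(1) Suc by (intro sum_mono power_increasing) auto
        also have "\<dots> \<le> real m * L ^ j'" using j L(1) by (simp add: mult_right_mono)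
        finally have "(\<Sum>i<j. L ^ i) * b \<le> real m * L ^ j' * b" using b by (intro mult_right_mono) auto
        also have "\<dots> = (real m * b) * L ^ j'" by simp
        also have "\<dots> \<le> (\<sigma> / 2 * L) * L ^ j'" using L by (intro mult_right_mono) auto
        finally show ?thesis using Suc by (simp add: mult_ac)
      qed (use \<sigma> in simp)
      then have "((\<Sum>i<j. L ^ i) * b) * norm (y x j) \<le> (\<sigma> / 2 * L ^ j) * norm (y x j)" by (intro mult_right_mono) auto
      then show "(\<Sum>i<j. L ^ i * (b * norm (y x j))) \<le> \<sigma> / 2 * (L ^ j * norm (y x j))"
        by (simp add: sum_distrib_right mult.assoc)
    qed
    also have "(\<Sum>j<m. \<sigma> / 2 * (L ^ j * norm (y x j))) = \<sigma> / 2 * V x" by (simp add: V_def sum_distrib_left)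
    finally have "V x' \<le> (1 - \<sigma> * h) * V x + h * (\<sigma> / 2 * V x)" using h(1) by (simp add: mult_left_mono)
    then show "V (\<lambda>i. x i + h * (\<Sum>j<m. M $$ (i, j) * x j)) \<le> (1 - \<sigma> / 2 * h) * V x"
      unfolding x'_def[symmetric] by (simp add: algebra_simps)
  qed
qed

text \<open>The derivative of \<open>eta l\<close> is \<open>exp (- l * s)\<close>, so the mean
  value theorem gives the first bound; a second use gives
  \<open>eta l h - h = - l * eta l z * h\<close>, to which the first bound applies.\<close>

lemma eta_first_order:
  assumes "0 \<le> h" "h \<le> 1"
  shows "\<bar>eta l h\<bar> \<le> exp \<bar>l\<bar> * h" "\<bar>eta l h - h\<bar> \<le> \<bar>l\<bar> * exp \<bar>l\<bar> * h\<^sup>2"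
proof -
  have 1: "\<bar>eta l h\<bar> \<le> exp \<bar>l\<bar> * h" if "0 \<le> h" "h \<le> 1" for h
  proof (cases "h = 0")
    case False
    then have "h > 0" using that by simp
    from MVT2[OF this eta_deriv[of l]] obtain z where z: "0 < z" "z < h" "eta l h - eta l 0 = (h - 0) * (1 - l * eta l z)"
      by auto
    then have "eta l h = exp (- l * z) * h" unfolding exp_eta by simp
    moreover have "- l * z \<le> \<bar>l\<bar> * 1"
      using z that by (intro order_trans[OF mult_right_mono[of "- l" "\<bar>l\<bar>"] mult_left_mono]) auto
    ultimately show ?thesis using that by (simp add: abs_mult mult_right_mono)
  qed simp
  then show "\<bar>eta l h\<bar> \<le> exp \<bar>l\<bar> * h" using assms by simp
  show "\<bar>eta l h - h\<bar> \<le> \<bar>l\<bar> * exp \<bar>l\<bar> * h\<^sup>2"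
  proof (cases "h = 0")
    case False
    then have h: "h > 0" using assms by simp
    from MVT2[OF h eta_deriv[of l]] obtain z where z: "0 < z" "z < h" "eta l h - eta l 0 = (h - 0) * (1 - l * eta l z)"
      by auto
    then have "eta l h - h = - (l * (eta l z * h))" by (simp add: algebra_simps)
    then have "\<bar>eta l h - h\<bar> = \<bar>l\<bar> * (\<bar>eta l z\<bar> * h)" using h by (simp add: abs_mult)
    also have "\<dots> \<le> \<bar>l\<bar> * ((exp \<bar>l\<bar> * h) * h)"
    proof (intro mult_left_mono mult_right_mono)
      have "\<bar>eta l z\<bar> \<le> exp \<bar>l\<bar> * z" using 1[of z] z assms by auto
      also have "\<dots> \<le> exp \<bar>l\<bar> * h" using z by simp
      finally show "\<bar>eta l z\<bar> \<le> exp \<bar>l\<bar> * h" .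
    qed (use h in auto)
    finally show ?thesis by (simp add: power2_eq_square mult_ac)
  qed simp
qed

text \<open>The exact update of mode \<open>n\<close> is
  \<open>x + eta (lam n) h * (g n * u - lam n * x)\<close>; replacing \<open>eta\<close> by
  \<open>h\<close> turns it into an Euler step of the closed-loop matrix. The error is quadratic in
  \<open>h\<close> and linear in \<open>V x\<close>, so for small \<open>h\<close> it uses up at
  most half of the contraction rate.\<close>

theorem sampled_data_decay:
  assumes hw: "hurwitz (closed_loop_matrix m lam g k)" and m: "m \<ge> 1"
  obtains C c T where "C > 0" "c > 0" "T > 0"
    and "\<And>(\<tau> :: nat \<Rightarrow> real) X. strict_mono \<tau> \<Longrightarrow> \<tau> 0 = 0 \<Longrightarrow> (\<And>i. \<tau> (Suc i) - \<tau> i \<le> T) \<Longrightarrow>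
      (\<And>i n. 1 \<le> n \<Longrightarrow> n \<le> m \<Longrightarrow> X (Suc i) n = exp (- lam n * (\<tau> (Suc i) - \<tau> i)) * X i n
          + g n * eta (lam n) (\<tau> (Suc i) - \<tau> i) * (\<Sum>l=1..m. k l * X i l)) \<Longrightarrow>
      (\<And>i n. 1 \<le> n \<Longrightarrow> n \<le> m \<Longrightarrow> \<bar>X i n\<bar> \<le> C * exp (- c * \<tau> i) * (\<Sum>l=1..m. \<bar>X 0 l\<bar>))"
proof -
  let ?M = "closed_loop_matrix m lam g k"
  have M: "?M \<in> carrier_mat m m" by (simp add: closed_loop_matrix_def)
  show thesis
  proof (rule hurwitz_euler_contraction[OF M hw m])
    fix V C1 C2 \<gamma> h0 assume V: "C1 > 0" "C2 > 0" "\<gamma> > 0" "h0 > 0"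
      "\<And>x. V x \<ge> 0"
      "\<And>x y. V (\<lambda>j. x j + y j) \<le> V x + V y"
      "\<And>x i. i < m \<Longrightarrow> \<bar>x i\<bar> \<le> C1 * V x"
      "\<And>x. V x \<le> C2 * (\<Sum>j<m. \<bar>x j\<bar>)"
      "\<And>x h. 0 \<le> h \<Longrightarrow> h \<le> h0 \<Longrightarrow> V (\<lambda>i. x i + h * (\<Sum>j<m. ?M $$ (i, j) * x j)) \<le> (1 - \<gamma> * h) * V x"
    define E where "E i = \<bar>lam (Suc i)\<bar> * exp \<bar>lam (Suc i)\<bar>" for i
    define KE where "KE = (\<Sum>i<m. E i * (\<bar>lam (Suc i)\<bar> + \<bar>g (Suc i)\<bar> * (\<Sum>l<m. \<bar>k (Suc l)\<bar>)) * C1)"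
    have En: "E i \<ge> 0" for i by (simp add: E_def)
    have KE: "KE \<ge> 0" unfolding KE_def using V En by (intro sum_nonneg mult_nonneg_nonneg add_nonneg_nonneg) auto
    \<comment> \<open>1 serves the bounds on \<open>eta\<close>, \<open>h0\<close> the Euler
      contraction, and the last entry keeps the error below \<open>\<gamma> / 2\<close>; adding 1 in
      the denominator covers \<open>KE = 0\<close>.\<close>
    define T where "T = min (min 1 h0) (\<gamma> / (2 * (C2 * KE + 1)))"
    have pos: "C2 * KE + 1 > 0" using V KE by (simp add: add_nonneg_pos)
    have T: "T > 0" "T \<le> 1" "T \<le> h0" "T * (C2 * KE) \<le> \<gamma> / 2"
    proof -
      show "T > 0" using V pos by (simp add: T_def)
      have "T \<le> \<gamma> / (2 * (C2 * KE + 1))" by (simp add: T_def)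
      then have "T * (C2 * KE + 1) \<le> \<gamma> / 2" using pos by (simp add: field_simps)
      then show "T * (C2 * KE) \<le> \<gamma> / 2" using \<open>T > 0\<close> by (simp add: algebra_simps)
    qed (auto simp: T_def)
    have step: "V x' \<le> exp (- (\<gamma> / 2) * h) * V x"
      if h: "0 \<le> h" "h \<le> T" and x': "\<And>i. i < m \<Longrightarrow> x' i = exp (- lam (Suc i) * h) * x i + g (Suc i) * eta (lam (Suc i)) h * (\<Sum>l<m. k (Suc l) * x l)" for h x x'
    proof -
      \<comment> \<open>Indices from \<open>m\<close> on are filled in so that \<open>x'\<close> is
        literally a sum of two functions, as subadditivity of \<open>V\<close> requires; the bound
        on \<open>V e\<close> reads only the entries below \<open>m\<close>.\<close>
      define e where "e i = (if i < m then (eta (lam (Suc i)) h - h) * (g (Suc i) * (\<Sum>l<m. k (Suc l) * x l) - lam (Suc i) * x i) else x' i - (x i + h * (\<Sum>j<m. ?M $$ (i, j) * x j)))" for i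
      have x'_eq: "x' = (\<lambda>i. (x i + h * (\<Sum>j<m. ?M $$ (i, j) * x j)) + e i)"
      proof
        fix i
        show "x' i = (x i + h * (\<Sum>j<m. ?M $$ (i, j) * x j)) + e i"
        proof (cases "i < m")
          case True
          have "(\<Sum>j<m. ?M $$ (i, j) * x j) = (\<Sum>j<m. (if i = j then - lam (Suc i) * x j else 0) + g (Suc i) * (k (Suc j) * x j))"
            using True by (intro sum.cong) (auto simp: closed_loop_matrix_def algebra_simps)
          also have "\<dots> = - lam (Suc i) * x i + g (Suc i) * (\<Sum>l<m. k (Suc l) * x l)"
            using True by (simp add: sum.distrib sum_distrib_left)
          finally have S: "(\<Sum>j<m. ?M $$ (i, j) * x j) = - lam (Suc i) * x i + g (Suc i) * (\<Sum>l<m. k (Suc l) * x l)" .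
          have "e i = (eta (lam (Suc i)) h - h) * (g (Suc i) * (\<Sum>l<m. k (Suc l) * x l) - lam (Suc i) * x i)"
            using True by (simp add: e_def)
          then show ?thesis unfolding x'[OF True] exp_eta S by (simp add: algebra_simps)
        qed (simp add: e_def)
      qed
      have x_le: "\<bar>x i\<bar> \<le> C1 * V x" if "i < m" for i using V(7)[OF that] .
      have e_le: "\<bar>e i\<bar> \<le> h\<^sup>2 * (E i * (\<bar>lam (Suc i)\<bar> + \<bar>g (Suc i)\<bar> * (\<Sum>l<m. \<bar>k (Suc l)\<bar>)) * C1) * V x" if i: "i < m" for i
      proof -
        have "\<bar>\<Sum>l<m. k (Suc l) * x l\<bar> \<le> (\<Sum>l<m. \<bar>k (Suc l)\<bar> * (C1 * V x))"
          by (intro order_trans[OF sum_abs] sum_mono) (auto simp: abs_mult intro!: mult_left_mono x_le)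
        then have 1: "\<bar>g (Suc i)\<bar> * \<bar>\<Sum>l<m. k (Suc l) * x l\<bar> \<le> \<bar>g (Suc i)\<bar> * ((\<Sum>l<m. \<bar>k (Suc l)\<bar>) * (C1 * V x))"
          by (intro mult_left_mono) (auto simp: sum_distrib_right)
        have 2: "\<bar>lam (Suc i)\<bar> * \<bar>x i\<bar> \<le> \<bar>lam (Suc i)\<bar> * (C1 * V x)" using x_le[OF i] by (intro mult_left_mono) auto
        have "\<bar>g (Suc i) * (\<Sum>l<m. k (Suc l) * x l) - lam (Suc i) * x i\<bar> \<le> \<bar>g (Suc i)\<bar> * \<bar>\<Sum>l<m. k (Suc l) * x l\<bar> + \<bar>lam (Suc i)\<bar> * \<bar>x i\<bar>"
          unfolding abs_mult[symmetric] by (rule abs_triangle_ineq4)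
        also have "\<dots> \<le> (\<bar>lam (Suc i)\<bar> + \<bar>g (Suc i)\<bar> * (\<Sum>l<m. \<bar>k (Suc l)\<bar>)) * C1 * V x"
          using 1 2 by (simp add: algebra_simps)
        finally have 3: "\<bar>g (Suc i) * (\<Sum>l<m. k (Suc l) * x l) - lam (Suc i) * x i\<bar> \<le> (\<bar>lam (Suc i)\<bar> + \<bar>g (Suc i)\<bar> * (\<Sum>l<m. \<bar>k (Suc l)\<bar>)) * C1 * V x" .
        have "\<bar>e i\<bar> \<le> (E i * h\<^sup>2) * ((\<bar>lam (Suc i)\<bar> + \<bar>g (Suc i)\<bar> * (\<Sum>l<m. \<bar>k (Suc l)\<bar>)) * C1 * V x)"
          using i eta_first_order(2)[of h "lam (Suc i)"] h T(2) En[of i] 3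
          by (auto simp: e_def abs_mult E_def intro!: mult_mono)
        then show ?thesis by (simp add: mult_ac)
      qed
      have "V x' \<le> V (\<lambda>i. x i + h * (\<Sum>j<m. ?M $$ (i, j) * x j)) + V e"
        unfolding x'_eq by (rule V(6))
      also have "V (\<lambda>i. x i + h * (\<Sum>j<m. ?M $$ (i, j) * x j)) \<le> (1 - \<gamma> * h) * V x"
        using h T by (intro V(9)) auto
      also have "V e \<le> C2 * (\<Sum>j<m. \<bar>e j\<bar>)" by (rule V(8))
      also have "\<dots> \<le> C2 * (h\<^sup>2 * KE * V x)"
      proof (intro mult_left_mono)
        have "(\<Sum>j<m. \<bar>e j\<bar>) \<le> (\<Sum>i<m. h\<^sup>2 * (E i * (\<bar>lam (Suc i)\<bar> + \<bar>g (Suc i)\<bar> * (\<Sum>l<m. \<bar>k (Suc l)\<bar>)) * C1) * V x)"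
          by (intro sum_mono e_le) auto
        then show "(\<Sum>j<m. \<bar>e j\<bar>) \<le> h\<^sup>2 * KE * V x" by (simp add: KE_def sum_distrib_left sum_distrib_right)
      qed (use V in auto)
      also have "C2 * (h\<^sup>2 * KE * V x) = h * (h * (C2 * KE)) * V x" by (simp add: power2_eq_square mult_ac)
      also have "\<dots> \<le> h * (\<gamma> / 2) * V x"
      proof (intro mult_right_mono mult_left_mono)
        have "h * (C2 * KE) \<le> T * (C2 * KE)" using h V KE by (intro mult_right_mono) auto
        then show "h * (C2 * KE) \<le> \<gamma> / 2" using T by linarith
      qed (use h V in auto)
      finally have "V x' \<le> (1 + - (\<gamma> / 2) * h) * V x" by (simp add: algebra_simps)
      also have "\<dots> \<le> exp (- (\<gamma> / 2) * h) * V x" using V(5) by (intro mult_right_mono exp_ge_add_one_self)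
      finally show ?thesis .
    qed
    show thesis
    proof (rule that[of "C1 * C2" "\<gamma> / 2" T])
      show "C1 * C2 > 0" "\<gamma> / 2 > 0" "T > 0" using V T by auto
      fix \<tau> :: "nat \<Rightarrow> real" and X i n
      assume \<tau>: "strict_mono \<tau>" "\<tau> 0 = 0" "\<And>i. \<tau> (Suc i) - \<tau> i \<le> T"
        and X: "\<And>i n. 1 \<le> n \<Longrightarrow> n \<le> m \<Longrightarrow> X (Suc i) n = exp (- lam n * (\<tau> (Suc i) - \<tau> i)) * X i n
            + g n * eta (lam n) (\<tau> (Suc i) - \<tau> i) * (\<Sum>l=1..m. k l * X i l)"
        and n: "1 \<le> n" "n \<le> m"
      have sum_eq: "(\<Sum>l=1..m. f l) = (\<Sum>l<m. f (Suc l))" for f :: "nat \<Rightarrow> real"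
        using sum.atLeast1_atMost_eq[of f m] by simp
      have Vi: "V (\<lambda>j. X i (Suc j)) \<le> exp (- (\<gamma> / 2) * \<tau> i) * V (\<lambda>j. X 0 (Suc j))" for i
      proof (induction i)
        case 0
        then show ?case using \<tau>(2) by simp
      next
        case (Suc i)
        have "0 \<le> \<tau> (Suc i) - \<tau> i" using strict_monoD[OF \<tau>(1), of i "Suc i"] by simp
        then have "V (\<lambda>j. X (Suc i) (Suc j)) \<le> exp (- (\<gamma> / 2) * (\<tau> (Suc i) - \<tau> i)) * V (\<lambda>j. X i (Suc j))"
          by (rule step[OF _ \<tau>(3)]) (rule X[unfolded sum_eq], auto)
        also have "\<dots> \<le> exp (- (\<gamma> / 2) * (\<tau> (Suc i) - \<tau> i)) * (exp (- (\<gamma> / 2) * \<tau> i) * V (\<lambda>j. X 0 (Suc j)))"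
          by (intro mult_left_mono Suc.IH) auto
        also have "\<dots> = exp (- (\<gamma> / 2) * \<tau> (Suc i)) * V (\<lambda>j. X 0 (Suc j))"
          by (simp add: mult.assoc[symmetric] exp_add[symmetric] algebra_simps)
        finally show ?case .
      qed
      obtain j where j: "n = Suc j" "j < m" using n by (cases n) auto
      have "\<bar>X i n\<bar> \<le> C1 * V (\<lambda>j. X i (Suc j))" using V(7)[OF j(2), of "\<lambda>j. X i (Suc j)"] j by simp
      also have "\<dots> \<le> C1 * (exp (- (\<gamma> / 2) * \<tau> i) * V (\<lambda>j. X 0 (Suc j)))" using V Vi by (intro mult_left_mono) auto
      also have "\<dots> \<le> C1 * (exp (- (\<gamma> / 2) * \<tau> i) * (C2 * (\<Sum>j<m. \<bar>X 0 (Suc j)\<bar>)))"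
        using V(1) V(8)[of "\<lambda>j. X 0 (Suc j)"] by (intro mult_left_mono) auto
      finally show "\<bar>X i n\<bar> \<le> C1 * C2 * exp (- (\<gamma> / 2) * \<tau> i) * (\<Sum>l=1..m. \<bar>X 0 l\<bar>)"
        unfolding sum_eq by (simp add: mult_ac)
    qed
  qed
qed

section \<open>The closed-loop solution and its uniqueness\<close>

context sturm_control
begin

primrec node :: "(nat \<Rightarrow> real) \<Rightarrow> (real \<Rightarrow> real) \<Rightarrow> nat \<Rightarrow> real \<Rightarrow> real" where
  "node \<tau> x0 0 = x0"
| "node \<tau> x0 (Suc i) = flow (node \<tau> x0 i) (\<tau> (Suc i) - \<tau> i)"

text \<open>A sampling time is assigned to the interval on its left, where the solution is already smooth.\<close>

definition sol :: "(nat \<Rightarrow> real) \<Rightarrow> (real \<Rightarrow> real) \<Rightarrow> real \<Rightarrow> real \<Rightarrow> real" where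
  "sol \<tau> x0 t = (let i = (LEAST i. t \<le> \<tau> (Suc i)) in flow (node \<tau> x0 i) (t - \<tau> i))"

lemma node_L2: "x0 \<in> L2 r \<Longrightarrow> node \<tau> x0 i \<in> L2 r"
  by (induction i) (auto intro: flow_L2)

end

section \<open>The sampling grid\<close>

locale sampling =
  fixes \<tau> :: "nat \<Rightarrow> real"
  assumes mono: "strict_mono \<tau>" and start: "\<tau> 0 = 0" and unbounded: "filterlim \<tau> at_top sequentially"
begin

lemma tau_less: "i < j \<Longrightarrow> \<tau> i < \<tau> j"
  using mono by (rule strict_monoD)

lemma tau_le: "i \<le> j \<Longrightarrow> \<tau> i \<le> \<tau> j"
  using mono by (simp add: strict_mono_less_eq)

lemma tau_nonneg: "0 \<le> \<tau> i"
  using tau_le[of 0 i] start by simp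

lemma cell:
  assumes "t \<ge> 0" obtains i where "\<tau> i \<le> t" "t < \<tau> (Suc i)"
proof -
  obtain N where "t < \<tau> N"
    using unbounded unfolding filterlim_at_top_dense eventually_sequentially by blast
  then have ex: "\<exists>n. t < \<tau> n" by blast
  define n where "n = (LEAST n. t < \<tau> n)"
  have n: "t < \<tau> n" unfolding n_def by (rule LeastI_ex[OF ex])
  then obtain i where i: "n = Suc i" using assms start by (cases n) auto
  have "\<not> t < \<tau> i" using not_less_Least[of i "\<lambda>n. t < \<tau> n"] i by (simp add: n_def)
  then show ?thesis using that[of i] n i by simp
qed

lemma off_grid:
  assumes "t \<in> {0..} - range \<tau>" obtains i where "\<tau> i < t" "t < \<tau> (Suc i)"
proof -
  from assms have "t \<ge> 0" by simp
  then obtain i where i: "\<tau> i \<le> t" "t < \<tau> (Suc i)" by (rule cell)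
  then have "\<tau> i \<noteq> t" using assms by auto
  then show ?thesis using that[of i] i by simp
qed

lemma open_cell_off_grid: "{\<tau> i<..<\<tau> (Suc i)} \<subseteq> {0..} - range \<tau>"
proof
  fix t assume t: "t \<in> {\<tau> i<..<\<tau> (Suc i)}"
  have "t \<noteq> \<tau> j" for j
    using t tau_le[of j i] tau_le[of "Suc i" j] by (cases "j \<le> i") (auto simp: not_le)
  then show "t \<in> {0..} - range \<tau>" using t tau_nonneg[of i] by auto
qed

text \<open>Off the grid all limits are local to one open cell, so the regularity of a single flow
  can be used.\<close>

lemma at_within_off_grid:
  assumes "\<tau> i < t" "t < \<tau> (Suc i)"
  shows "at (t, z) within ({0..} - range \<tau>) \<times> Z = at (t, z) within {\<tau> i<..<\<tau> (Suc i)} \<times> Z"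
proof (rule at_within_nhd[of _ "{\<tau> i<..<\<tau> (Suc i)} \<times> UNIV"])
  show "open ({\<tau> i<..<\<tau> (Suc i)} \<times> UNIV)" by (intro open_Times) auto
qed (use assms open_cell_off_grid[of i] in auto)

lemma closed_cell_unique:
  assumes "\<tau> i < t" "t \<le> \<tau> (Suc i)"
  shows "(LEAST i. t \<le> \<tau> (Suc i)) = i"
  using assms(2)
proof (rule Least_equality)
  fix j assume "t \<le> \<tau> (Suc j)"
  then have "\<tau> i < \<tau> (Suc j)" using assms(1) by simp
  then have "i < Suc j" using mono by (simp add: strict_mono_less)
  then show "i \<le> j" by simp
qed

end

locale closed_loop = sturm_control r p q a1 a2 b1 b2 lam phi m k + sampling \<tau>
  for r p q a1 a2 b1 b2 lam phi m k \<tau>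
begin

text \<open>Each node after the first belongs to two closed cells. The formulas agree there because
  a flow at time 0 returns its initial state unchanged.\<close>

lemma sol_cell:
  assumes "\<tau> i \<le> t" "t \<le> \<tau> (Suc i)"
  shows "sol \<tau> x0 t = flow (node \<tau> x0 i) (t - \<tau> i)"
proof (cases "t = \<tau> i")
  case False
  then show ?thesis using closed_cell_unique[of i t] assms by (simp add: sol_def)
next
  case True
  show ?thesis
  proof (cases i)
    case 0
    have "(LEAST i. t \<le> \<tau> (Suc i)) = 0" by (rule Least_eq_0) (use assms 0 in auto)
    then show ?thesis using 0 by (simp add: sol_def)
  next
    case (Suc j)
    have "(LEAST i. t \<le> \<tau> (Suc i)) = j" by (rule closed_cell_unique) (use True Suc tau_less[of j i] in auto)
    then show ?thesis using True Suc by (simp add: sol_def flow_def[of "flow _ _"])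
  qed
qed

lemma sol_node: "sol \<tau> x0 (\<tau> i) = node \<tau> x0 i"
  using sol_cell[of i "\<tau> i" x0] tau_le[of i "Suc i"] by (simp add: flow_def)

lemma sol_L2:
  assumes "x0 \<in> L2 r" "t \<ge> 0" shows "sol \<tau> x0 t \<in> L2 r"
proof -
  obtain i where "\<tau> i \<le> t" "t < \<tau> (Suc i)" using assms(2) by (rule cell)
  then show ?thesis using sol_cell[of i t x0] flow_L2[OF node_L2[OF assms(1)]] by simp
qed

lemma sol_continuous_cell:
  assumes "x0 \<in> L2 r" "\<tau> i \<le> t" "t \<le> \<tau> (Suc i)"
  shows "((\<lambda>s. nrm (\<lambda>z. sol \<tau> x0 s z - sol \<tau> x0 t z)) \<longlongrightarrow> 0) (at t within {\<tau> i..\<tau> (Suc i)})"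
proof -
  let ?f = "flow (node \<tau> x0 i)"
  have "filterlim (\<lambda>s. s - \<tau> i) (at (t - \<tau> i) within {0..}) (at t within {\<tau> i..\<tau> (Suc i)})"
    unfolding filterlim_at
    by (auto intro!: tendsto_eq_intros simp: eventually_at intro: exI[of _ 1])
  moreover have "((\<lambda>s. nrm (\<lambda>z. ?f s z - ?f (t - \<tau> i) z)) \<longlongrightarrow> 0) (at (t - \<tau> i) within {0..})"
    using assms by (intro flow_L2_continuous node_L2) auto
  ultimately have "((\<lambda>s. nrm (\<lambda>z. ?f (s - \<tau> i) z - ?f (t - \<tau> i) z)) \<longlongrightarrow> 0) (at t within {\<tau> i..\<tau> (Suc i)})"
    by (rule filterlim_compose[rotated])
  moreover have "\<forall>\<^sub>F s in at t within {\<tau> i..\<tau> (Suc i)}. nrm (\<lambda>z. ?f (s - \<tau> i) z - ?f (t - \<tau> i) z)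
      = nrm (\<lambda>z. sol \<tau> x0 s z - sol \<tau> x0 t z)"
    using sol_cell[of i _ x0] assms unfolding eventually_at by (intro exI[of _ 1]) auto
  ultimately show ?thesis by (simp add: tendsto_cong)
qed

lemma sol_continuous:
  assumes "x0 \<in> L2 r" "t \<ge> 0"
  shows "((\<lambda>s. nrm (\<lambda>z. sol \<tau> x0 s z - sol \<tau> x0 t z)) \<longlongrightarrow> 0) (at t within {0..})"
proof -
  obtain i where i: "\<tau> i \<le> t" "t < \<tau> (Suc i)" using assms(2) by (rule cell)
  have C: "((\<lambda>s. nrm (\<lambda>z. sol \<tau> x0 s z - sol \<tau> x0 t z)) \<longlongrightarrow> 0) (at t within {\<tau> i..\<tau> (Suc i)})"
    using i by (intro sol_continuous_cell assms) auto
  consider "\<tau> i < t" | "t = \<tau> i" "i = 0" | j where "t = \<tau> i" "i = Suc j" using i by (cases i) force+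
  then show ?thesis
  proof cases
    case 1
    have "at t within {0..} = at t within {\<tau> i..\<tau> (Suc i)}"
      by (rule at_within_nhd[of _ "{\<tau> i<..<\<tau> (Suc i)}"]) (use 1 i tau_nonneg[of i] in auto)
    then show ?thesis using C by simp
  next
    case 2
    have "at t within {0..} = at t within {\<tau> i..\<tau> (Suc i)}"
      by (rule at_within_nhd[of _ "{..<\<tau> (Suc i)}"]) (use 2 i start in auto)
    then show ?thesis using C by simp
  next
    case 3
    have lt: "\<tau> j < t" using 3 tau_less[of j i] by simp
    have "((\<lambda>s. nrm (\<lambda>z. sol \<tau> x0 s z - sol \<tau> x0 t z)) \<longlongrightarrow> 0) (at t within {\<tau> j..\<tau> (Suc j)})"
      using 3 lt by (intro sol_continuous_cell assms) auto
    \<comment> \<open>At a positive node the limits within the two adjacent cells are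
      combined.\<close>
    then have "((\<lambda>s. nrm (\<lambda>z. sol \<tau> x0 s z - sol \<tau> x0 t z)) \<longlongrightarrow> 0) (at t within {\<tau> j..\<tau> (Suc j)} \<union> {\<tau> i..\<tau> (Suc i)})"
      using C by (rule Lim_Un)
    moreover have "at t within {0..} = at t within {\<tau> j..\<tau> (Suc j)} \<union> {\<tau> i..\<tau> (Suc i)}"
      by (rule at_within_nhd[of _ "{\<tau> j<..<\<tau> (Suc i)}"]) (use 3 i lt tau_nonneg[of j] in auto)
    ultimately show ?thesis by simp
  qed
qed

lemma sol_C1:
  assumes "x0 \<in> L2 r"
  shows "C1_on (({0..} - range \<tau>) \<times> {0..1}) (\<lambda>(t, z). sol \<tau> x0 t z)"
proof -
  let ?I = "{0..} - range \<tau>"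
  define D where "D = (\<lambda>(t, z). let i = (LEAST i. t \<le> \<tau> (Suc i)) in flowD (node \<tau> x0 i) (t - \<tau> i) z)"
  have D_eq: "D (t, z) = flowD (node \<tau> x0 i) (t - \<tau> i) z" if "\<tau> i < t" "t < \<tau> (Suc i)" for t z i
    using closed_cell_unique[of i t] that by (simp add: D_def)
  show ?thesis
    unfolding C1_on_def
  proof (intro exI[of _ D] conjI ballI)
    show "continuous_on (?I \<times> {0..1}) D"
      unfolding continuous_on_eq_continuous_within
    proof
      fix x assume x: "x \<in> ?I \<times> {0..1::real}"
      obtain t z where tz: "x = (t, z)" by force
      obtain i where i: "\<tau> i < t" "t < \<tau> (Suc i)" using x tz off_grid[of t] by auto
      have "continuous_on ({\<tau> i<..<\<tau> (Suc i)} \<times> {0..1}) (\<lambda>x. flowD (node \<tau> x0 i) (fst x - \<tau> i) (snd x))"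
        by (rule continuous_on_subset[OF flow_C1(1)[OF node_L2[OF assms]]]) auto
      then have "continuous_on ({\<tau> i<..<\<tau> (Suc i)} \<times> {0..1}) D"
        by (rule continuous_on_eq) (auto simp: D_eq)
      then show "continuous (at x within ?I \<times> {0..1}) D"
        unfolding tz at_within_off_grid[OF i] using x tz i by (auto simp: continuous_on_eq_continuous_within)
    qed
    fix x assume x: "x \<in> ?I \<times> {0..1::real}"
    obtain t z where tz: "x = (t, z)" by force
    obtain i where i: "\<tau> i < t" "t < \<tau> (Suc i)" using x tz off_grid[of t] by auto
    have "((\<lambda>(t, z). flow (node \<tau> x0 i) (t - \<tau> i) z) has_derivative blinfun_apply (D x)) (at (t, z) within {\<tau> i<..<\<tau> (Suc i)} \<times> {0..1})"
      unfolding tz D_eq[OF i]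
      by (rule has_derivative_subset[OF flow_C1(2)[OF node_L2[OF assms]]]) (use x tz i in auto)
    then have "((\<lambda>(t, z). sol \<tau> x0 t z) has_derivative blinfun_apply (D x)) (at (t, z) within {\<tau> i<..<\<tau> (Suc i)} \<times> {0..1})"
      by (rule has_derivative_transform[rotated 2]) (use x tz i in \<open>auto simp: sol_cell[of i]\<close>)
    then show "((\<lambda>(t, z). sol \<tau> x0 t z) has_derivative blinfun_apply (D x)) (at x within ?I \<times> {0..1})"
      unfolding tz at_within_off_grid[OF i] .
  qed
qed

lemma sol_isA:
  assumes "x0 \<in> L2 r" "\<tau> i < t" "t \<le> \<tau> (Suc i)"
  shows "isA (sol \<tau> x0 t) (flowP (node \<tau> x0 i) (t - \<tau> i)) (flowh (node \<tau> x0 i) (t - \<tau> i))"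
  using flow_isA[OF node_L2[OF assms(1)], of "t - \<tau> i"] sol_cell[of i t x0] assms by simp

theorem sol_closed_loop:
  assumes "x0 \<in> L2 r"
  shows "closed_loop_solution p r q a1 a2 b1 b2 phi m k \<tau> x0 (sol \<tau> x0)"
  unfolding closed_loop_solution_def Let_def
proof (intro conjI allI impI ballI)
  show "sol \<tau> x0 t \<in> L2 r" if "0 \<le> t" for t by (rule sol_L2[OF assms that])
  show "((\<lambda>s. nrm (\<lambda>z. sol \<tau> x0 s z - sol \<tau> x0 t z)) \<longlongrightarrow> 0) (at t within {0..})" if "0 \<le> t" for t
    by (rule sol_continuous[OF assms that])
  show "C1_on (({0..} - range \<tau>) \<times> {0..1}) (\<lambda>(t, z). sol \<tau> x0 t z)" by (rule sol_C1[OF assms])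
  show "C2_unit (sol \<tau> x0 t)" if tpos: "0 < t" for t
  proof (cases "t \<in> range \<tau>")
    case True
    then obtain j where j: "t = \<tau> j" by auto
    then obtain i where "j = Suc i" using tpos start by (cases j) auto
    then show ?thesis using isA_C2[OF sol_isA[OF assms, of i t]] j tau_less[of i j] by auto
  next
    case False
    then obtain i where "\<tau> i < t" "t < \<tau> (Suc i)" using off_grid[of t] tpos by auto
    then show ?thesis using isA_C2[OF sol_isA[OF assms, of i t]] by auto
  qed
  show "sol \<tau> x0 0 z = x0 z" for z using sol_node[of x0 0] start by simp
  show "deriv (\<lambda>s. sol \<tau> x0 s z) t - 1 / r z * dz (\<lambda>y. p y * dz (sol \<tau> x0 t) y) z + q z / r z * sol \<tau> x0 t z = 0"
    if t: "t \<in> {0..} - range \<tau>" and z: "z \<in> {0<..<1}" for t z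
  proof -
    obtain i where i: "\<tau> i < t" "t < \<tau> (Suc i)" using off_grid[OF t] .
    let ?h = "flowh (node \<tau> x0 i) (t - \<tau> i)"
    have z': "z \<in> {0..1}" using z by auto
    have d: "((\<lambda>t. t - \<tau> i) has_real_derivative 1) (at t)" by (auto intro!: derivative_eq_intros)
    have "((\<lambda>s. flow (node \<tau> x0 i) s z) has_real_derivative - ?h z) (at (t - \<tau> i))"
      by (rule flow_time_derivative[OF node_L2[OF assms] _ z']) (use i in auto)
    from DERIV_chain2[OF this d]
    have "((\<lambda>s. flow (node \<tau> x0 i) (s - \<tau> i) z) has_real_derivative - ?h z) (at t)"
      by (simp only: mult_1_right)
    then have "((\<lambda>s. sol \<tau> x0 s z) has_real_derivative - ?h z) (at t)"
      by (rule has_field_derivative_transform_within_open[of _ _ _ "{\<tau> i<..<\<tau> (Suc i)}"]) (use i in \<open>auto simp: sol_cell[of i]\<close>)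
    then have "deriv (\<lambda>s. sol \<tau> x0 s z) t = - ?h z" by (rule DERIV_imp_deriv)
    moreover have "dz (\<lambda>y. p y * dz (sol \<tau> x0 t) y) z = q z * sol \<tau> x0 t z - r z * ?h z"
      using i by (intro isA_dz(2)[OF sol_isA[OF assms _ _] z']) auto
    ultimately show ?thesis using r_pos[OF z'] by (simp add: field_simps)
  qed
  \<comment> \<open>The strict inequality makes the input constant on
    \<open>[\<tau> i, \<tau> (Suc i))\<close>: at a node it already uses the new sample, whereas
    \<open>sol\<close> assigns a positive node to the cell on its left.\<close>
  define u where "u t = feedback (node \<tau> x0 (LEAST i. t < \<tau> (Suc i)))" for t
  have u: "u t = feedback (node \<tau> x0 i)" if "\<tau> i \<le> t" "t < \<tau> (Suc i)" for i t
  proof -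
    have "(LEAST i. t < \<tau> (Suc i)) = i"
    proof (rule Least_equality[where P = "\<lambda>i. t < \<tau> (Suc i)"])
      fix j assume "t < \<tau> (Suc j)"
      then have "\<tau> i < \<tau> (Suc j)" using that by simp
      then show "i \<le> j" using mono by (simp add: strict_mono_less)
    qed (rule that)
    then show ?thesis by (simp add: u_def)
  qed
  show "\<exists>u. (\<forall>t\<in>{0..} - range \<tau>. b1 * sol \<tau> x0 t 0 + b2 * dz (sol \<tau> x0 t) 0 = 0 \<and> a1 * sol \<tau> x0 t 1 + a2 * dz (sol \<tau> x0 t) 1 - u t = 0) \<and>
     (\<forall>i. \<forall>t\<in>{\<tau> i..<\<tau> (Suc i)}. u t = (LINT z|lebesgue_on {0..1}. r z * (\<Sum>l = 1..m. k l * phi l z) * sol \<tau> x0 (\<tau> i) z))"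
  proof (intro exI[of _ u] conjI ballI allI)
    fix i t assume "t \<in> {\<tau> i..<\<tau> (Suc i)}"
    then show "u t = (LINT z|lebesgue_on {0..1}. r z * (\<Sum>l = 1..m. k l * phi l z) * sol \<tau> x0 (\<tau> i) z)"
      unfolding sol_node feedback_eq[OF node_L2[OF assms]] using u by simp
  next
    fix t assume "t \<in> {0..} - range \<tau>"
    then obtain i where i: "\<tau> i < t" "t < \<tau> (Suc i)" by (rule off_grid)
    have A: "isA (sol \<tau> x0 t) (flowP (node \<tau> x0 i) (t - \<tau> i)) (flowh (node \<tau> x0 i) (t - \<tau> i))"
      using i by (intro sol_isA assms) auto
    have e: "sol \<tau> x0 t = flow (node \<tau> x0 i) (t - \<tau> i)" using i by (intro sol_cell) auto
    have bcs: "bcL (sol \<tau> x0 t) (flowP (node \<tau> x0 i) (t - \<tau> i)) = 0"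
      "bcR (sol \<tau> x0 t) (flowP (node \<tau> x0 i) (t - \<tau> i)) = u t"
      unfolding e using flow_bc[OF node_L2[OF assms], of "t - \<tau> i"] u[of i t] i by auto
    show "b1 * sol \<tau> x0 t 0 + b2 * dz (sol \<tau> x0 t) 0 = 0" "a1 * sol \<tau> x0 t 1 + a2 * dz (sol \<tau> x0 t) 1 - u t = 0"
      using bcs isA_dz(1)[OF A, of 0] isA_dz(1)[OF A, of 1] by (simp_all add: bcL_def bcR_def)
  qed
qed

section \<open>Uniqueness of closed-loop solutions\<close>

lemma solutionD:
  assumes "closed_loop_solution p r q a1 a2 b1 b2 phi m k \<tau> x0 y"
  shows "\<And>t. t \<ge> 0 \<Longrightarrow> y t \<in> L2 r"
    and "\<And>t. t \<ge> 0 \<Longrightarrow> ((\<lambda>s. nrm (\<lambda>z. y s z - y t z)) \<longlongrightarrow> 0) (at t within {0..})"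
    and "C1_on (({0..} - range \<tau>) \<times> {0..1}) (\<lambda>(t, z). y t z)"
    and "\<And>t. t > 0 \<Longrightarrow> C2_unit (y t)"
    and "\<And>z. z \<in> {0..1} \<Longrightarrow> y 0 z = x0 z"
    and "\<And>t z. t \<in> {0..} - range \<tau> \<Longrightarrow> z \<in> {0<..<1} \<Longrightarrow>
      deriv (\<lambda>s. y s z) t - 1 / r z * dz (\<lambda>w. p w * dz (y t) w) z + q z / r z * y t z = 0"
    and "\<exists>u. (\<forall>t\<in>{0..} - range \<tau>. b1 * y t 0 + b2 * dz (y t) 0 = 0 \<and> a1 * y t 1 + a2 * dz (y t) 1 - u t = 0) \<and>
      (\<forall>i. \<forall>t\<in>{\<tau> i..<\<tau> (Suc i)}. u t = (LINT z|lebesgue_on {0..1}. r z * (\<Sum>l=1..m. k l * phi l z) * y (\<tau> i) z))"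
  using assms unfolding closed_loop_solution_def Let_def by blast+

text \<open>On an open cell the solution is continuously differentiable up to the end points in
  \<open>z\<close>, which permits differentiation under the integral; the equation and
  \<open>Lagrange_phi\<close> then bring in the input through \<open>gam n\<close>.\<close>

lemma solution_coeff_derivative:
  assumes y: "closed_loop_solution p r q a1 a2 b1 b2 phi m k \<tau> x0 y"
    and t: "\<tau> i < t" "t < \<tau> (Suc i)" and n: "n \<ge> 1"
  shows "((\<lambda>s. ip (y s) (phi n)) has_real_derivative gam n * feedback (y (\<tau> i)) - lam n * ip (y t) (phi n)) (at t)"
proof -
  let ?I = "{0..} - range \<tau>" and ?W = "{\<tau> i<..<\<tau> (Suc i)}"
  obtain D where D: "continuous_on (?I \<times> {0..1}) D"
    "\<And>s. s \<in> ?I \<times> {0..1} \<Longrightarrow> ((\<lambda>(t, z). y t z) has_derivative blinfun_apply (D s)) (at s within ?I \<times> {0..1})"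
    using solutionD(3)[OF y] unfolding C1_on_def by blast
  have WI: "?W \<subseteq> ?I" by (rule open_cell_off_grid)
  have tpos: "s > 0" if "s \<in> ?W" for s using that tau_nonneg[of i] by auto
  have yA: "isA (y s) (\<lambda>z. p z * dz (y s) z) (SL_op p r q (y s))" if "s \<in> ?W" for s
    by (rule C2_isA[OF solutionD(4)[OF y tpos[OF that]]])
  have yc: "continuous_on {0..1} (y s)" if "s \<in> ?W" for s using isAD(4)[OF yA[OF that]] .
  \<comment> \<open>The time derivative, read off from the total derivative in the direction
    \<open>(1, 0)\<close>.\<close>
  define d where "d s z = blinfun_apply (D (s, z)) (1, 0)" for s z
  have dd: "((\<lambda>s. y s z) has_real_derivative d s z) (at s)" if s: "s \<in> ?W" and z: "z \<in> {0..1}" for s z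
  proof -
    have "((\<lambda>(t, z). y t z) has_derivative blinfun_apply (D (s, z))) (at (s, z) within (\<lambda>s. (s, z)) ` ?W)"
      by (rule has_derivative_subset[OF D(2)]) (use s z WI in auto)
    moreover have "((\<lambda>s. (s, z)) has_derivative (\<lambda>h. (h, 0))) (at s within ?W)"
      by (auto intro!: derivative_eq_intros)
    ultimately have "((\<lambda>s. (\<lambda>(t, z). y t z) (s, z)) has_derivative (\<lambda>h. blinfun_apply (D (s, z)) (h, 0))) (at s within ?W)"
      using has_derivative_in_compose[of "\<lambda>s. (s, z)" "\<lambda>h. (h, 0)" s ?W "\<lambda>(t, z). y t z" "blinfun_apply (D (s, z))"] by simp
    moreover have "blinfun_apply (D (s, z)) (h, 0) = d s z * h" for h
      using blinfun.scaleR_right[of "D (s, z)" h "(1, 0)"] by (simp add: d_def mult.commute)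
    ultimately have "((\<lambda>s. y s z) has_real_derivative d s z) (at s within ?W)"
      by (simp add: has_field_derivative_def)
    moreover have "at s within ?W = at s" using s by (intro at_within_open) auto
    ultimately show ?thesis by simp
  qed
  have dc: "continuous_on (?W \<times> {0..1}) (\<lambda>(s, z). r z * d s z * phi n z)"
  proof -
    have snd_cont: "continuous_on (?W \<times> {0..1}) (\<lambda>x::real \<times> real. g (snd x))" if "continuous_on {0..1} g" for g :: "real \<Rightarrow> real"
      by (rule continuous_on_compose2[OF that]) (auto intro!: continuous_intros)
    have "continuous_on (?W \<times> {0..1}) D" using WI by (intro continuous_on_subset[OF D(1)]) auto
    then have "continuous_on (?W \<times> {0..1}) (\<lambda>x. d (fst x) (snd x))"
      unfolding d_def by (auto intro!: continuous_intros)
    then show ?thesis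
      unfolding split_beta by (intro continuous_on_mult snd_cont r_cont phi_cont[OF n])
  qed
  have "((\<lambda>s. integral (cbox 0 1) (\<lambda>z. r z * y s z * phi n z)) has_field_derivative
      integral (cbox 0 1) (\<lambda>z. r z * d t z * phi n z)) (at t within ?W)"
  proof (rule leibniz_rule_field_derivative)
    show "((\<lambda>s. r z * y s z * phi n z) has_real_derivative r z * d s z * phi n z) (at s within ?W)"
      if "s \<in> ?W" "z \<in> cbox 0 1" for s z
      using that by (auto intro!: derivative_eq_intros DERIV_subset[OF dd])
    show "(\<lambda>z. r z * y s z * phi n z) integrable_on cbox 0 1" if "s \<in> ?W" for s
      using yc[OF that] r_cont phi_cont[OF n] by (auto intro!: integrable_continuous_real continuous_intros)
    show "continuous_on (?W \<times> cbox 0 1) (\<lambda>(s, z). r z * d s z * phi n z)" using dc by simp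
  qed (use t in auto)
  then have 1: "((\<lambda>s. integral {0..1} (\<lambda>z. r z * y s z * phi n z)) has_field_derivative
      integral {0..1} (\<lambda>z. r z * d t z * phi n z)) (at t)"
    using at_within_open[of t ?W] t by simp
  have tW: "t \<in> ?W" and tI: "t \<in> ?I" using t WI by auto
  have "integral {0..1} (\<lambda>z. r z * d t z * phi n z) = integral {0..1} (\<lambda>z. - (r z * SL_op p r q (y t) z * phi n z))"
  \<comment> \<open>The differential equation is given only for interior \<open>z\<close>; the two
    end points form a null set.\<close>
  proof (rule integral_spike[of "{0, 1}"])
    fix z :: real assume z: "z \<in> {0..1} - {0, 1}"
    then have z1: "z \<in> {0<..<1}" "z \<in> {0..1}" by auto
    have "deriv (\<lambda>s. y s z) t - 1 / r z * dz (\<lambda>w. p w * dz (y t) w) z + q z / r z * y t z = 0"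
      by (rule solutionD(6)[OF y tI z1(1)])
    then have "d t z = - SL_op p r q (y t) z"
      using DERIV_imp_deriv[OF dd[OF tW z1(2)]] by (simp add: SL_op_def)
    then show "- (r z * SL_op p r q (y t) z * phi n z) = r z * d t z * phi n z" by simp
  qed auto
  also have "\<dots> = - ip (SL_op p r q (y t)) (phi n)"
    using isAD(1)[OF yA[OF tW]] phi_cont[OF n] by (simp add: ip_continuous_eq)
  also have "\<dots> = gam n * feedback (y (\<tau> i)) - lam n * ip (y t) (phi n)"
  proof -
    obtain u where u: "\<And>t. t \<in> ?I \<Longrightarrow> b1 * y t 0 + b2 * dz (y t) 0 = 0 \<and> a1 * y t 1 + a2 * dz (y t) 1 - u t = 0"
      "\<And>i t. t \<in> {\<tau> i..<\<tau> (Suc i)} \<Longrightarrow> u t = (LINT z|lebesgue_on {0..1}. r z * (\<Sum>l=1..m. k l * phi l z) * y (\<tau> i) z)"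
      using solutionD(7)[OF y] by blast
    have "y (\<tau> i) \<in> L2 r" by (rule solutionD(1)[OF y tau_nonneg])
    then have ut: "u t = feedback (y (\<tau> i))" using u(2)[of t i] t feedback_eq by auto
    have p01: "p 0 \<noteq> 0" "p 1 \<noteq> 0" using p_pos[of 0] p_pos[of 1] by auto
    have bcs: "bcL (y t) (\<lambda>z. p z * dz (y t) z) = 0" "bcR (y t) (\<lambda>z. p z * dz (y t) z) = feedback (y (\<tau> i))"
      using u(1)[OF tI] ut p01 by (simp_all add: bcL_def bcR_def)
    show ?thesis using Lagrange_phi[OF yA[OF tW] bcs(1) n] bcs(2) by simp
  qed
  finally have 2: "integral {0..1} (\<lambda>z. r z * d t z * phi n z) = gam n * feedback (y (\<tau> i)) - lam n * ip (y t) (phi n)" .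
  show ?thesis
  proof (rule has_field_derivative_transform_within_open[OF 1[unfolded 2], of ?W])
    fix s assume s: "s \<in> ?W"
    show "integral {0..1} (\<lambda>z. r z * y s z * phi n z) = ip (y s) (phi n)"
      using ip_continuous_eq[OF yc[OF s] phi_cont[OF n]] by simp
  qed (use t in auto)
qed

text \<open>Bridges the sampling times, at which no time derivative is available.\<close>

lemma solution_coeff_continuous:
  assumes y: "closed_loop_solution p r q a1 a2 b1 b2 phi m k \<tau> x0 y" and n: "n \<ge> 1"
  shows "continuous_on {0..} (\<lambda>s. ip (y s) (phi n))"
  unfolding continuous_on_def
proof
  fix t :: real assume t: "t \<in> {0..}"
  have L: "y s \<in> L2 r" if "s \<ge> 0" for s by (rule solutionD(1)[OF y that])
  have lim: "((\<lambda>s. nrm (\<lambda>z. y s z - y t z)) \<longlongrightarrow> 0) (at t within {0..})" using solutionD(2)[OF y] t by simp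
  show "((\<lambda>s. ip (y s) (phi n)) \<longlongrightarrow> ip (y t) (phi n)) (at t within {0..})"
  proof (rule LIM_zero_cancel, rule Lim_null_comparison[OF _ lim])
    show "\<forall>\<^sub>F s in at t within {0..}. norm (ip (y s) (phi n) - ip (y t) (phi n)) \<le> nrm (\<lambda>z. y s z - y t z)"
      unfolding eventually_at
    proof (intro exI[of _ 1] conjI ballI impI)
      fix s :: real assume s: "s \<in> {0..}"
      show "norm (ip (y s) (phi n) - ip (y t) (phi n)) \<le> nrm (\<lambda>z. y s z - y t z)"
        using coeff_le[OF L2_diff[OF L[of s] L[of t]] n] s t by (simp add: ip_diff_left L phi_L2[OF n])
    qed simp
  qed
qed

text \<open>Induction over the nodes: equal profiles at a node give equal inputs on the next cell,
  hence equal coefficients up to the next node. Profiles at positive times are continuous, so their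
  coefficients determine them pointwise.\<close>

theorem solution_unique:
  assumes y1: "closed_loop_solution p r q a1 a2 b1 b2 phi m k \<tau> x0 y1"
    and y2: "closed_loop_solution p r q a1 a2 b1 b2 phi m k \<tau> x0 y2"
    and "t \<ge> 0" "z \<in> {0..1}"
  shows "y1 t z = y2 t z"
proof -
  have C: "continuous_on {0..1} (y1 s)" "continuous_on {0..1} (y2 s)" if "s > 0" for s
    using isAD(4)[OF C2_isA[OF solutionD(4)[OF y1 that]]] isAD(4)[OF C2_isA[OF solutionD(4)[OF y2 that]]] .
  have step: "y1 t z = y2 t z" if eq: "\<And>z. z \<in> {0..1} \<Longrightarrow> y1 (\<tau> i) z = y2 (\<tau> i) z"
    and t: "\<tau> i < t" "t \<le> \<tau> (Suc i)" and z: "z \<in> {0..1}" for i t z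
  proof -
    have tpos: "t > 0" using t tau_nonneg[of i] by simp
    have coeff: "ip (y1 t) (phi n) - ip (y2 t) (phi n) = 0" if n: "n \<ge> 1" for n
    proof -
      \<comment> \<open>The integrating factor makes the difference of the coefficients constant on
        the cell, since the input terms cancel.\<close>
      define e where "e s = exp (lam n * s) * (ip (y1 s) (phi n) - ip (y2 s) (phi n))" for s
      have fb: "feedback (y1 (\<tau> i)) = feedback (y2 (\<tau> i))"
        unfolding feedback_def by (intro sum.cong refl arg_cong2[where f = "(*)"] ip_cong eq)
      have "e t = e (\<tau> i)"
      proof (rule DERIV_isconst_end[OF t(1)])
        have sub: "{\<tau> i..t} \<subseteq> {0..}" using tau_nonneg[of i] by auto
        show "continuous_on {\<tau> i..t} e"
          unfolding e_def
          by (intro continuous_intros continuous_on_subset[OF solution_coeff_continuous[OF y1 n] sub]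
              continuous_on_subset[OF solution_coeff_continuous[OF y2 n] sub])
        fix s assume s: "\<tau> i < s" "s < t"
        then have s': "s < \<tau> (Suc i)" using t by simp
        show "(e has_real_derivative 0) (at s)"
          unfolding e_def
          by (rule derivative_eq_intros solution_coeff_derivative[OF y1 s(1) s' n] solution_coeff_derivative[OF y2 s(1) s' n] refl)+
            (simp add: fb algebra_simps)
      qed
      moreover have "ip (y1 (\<tau> i)) (phi n) = ip (y2 (\<tau> i)) (phi n)" by (rule ip_cong) (use eq in auto)
      ultimately show ?thesis by (simp add: e_def)
    qed
    have "y1 t z - y2 t z = 0"
    proof (rule zero_coeff_zero[OF _ _ z, of "\<lambda>z. y1 t z - y2 t z"])
      show "continuous_on {0..1} (\<lambda>z. y1 t z - y2 t z)" by (intro continuous_on_diff C tpos)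
      show "ip (\<lambda>z. y1 t z - y2 t z) (phi n) = 0" if "n \<ge> 1" for n
        using coeff[OF that] by (simp add: ip_diff_left L2_cont C tpos phi_L2[OF that])
    qed
    then show ?thesis by simp
  qed
  have nodes: "\<forall>z\<in>{0..1}. y1 (\<tau> i) z = y2 (\<tau> i) z" for i
  proof (induction i)
    case 0
    then show ?case using solutionD(5)[OF y1] solutionD(5)[OF y2] start by simp
  next
    case (Suc i)
    then show ?case using step[of i "\<tau> (Suc i)"] tau_less[of i "Suc i"] by blast
  qed
  obtain i where i: "\<tau> i \<le> t" "t < \<tau> (Suc i)" using assms(3) by (rule cell)
  show ?thesis
  proof (cases "t = \<tau> i")
    case True
    then show ?thesis using nodes assms(4) by blast
  next
    case False
    then show ?thesis using step[of i t z] nodes i assms(4) by auto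
  qed
qed

end

section \<open>Exponential decay\<close>

text \<open>In the tail the effect of a held input, \<open>1 - exp (- l * s)\<close>, has to be paid
  for by the gap between the decay rates \<open>c\<close> and \<open>l\<close>. With
  \<open>y = exp (- (l - c) * s)\<close> the assumption \<open>2 * c \<le> l\<close> gives
  \<open>y^2 \<le> exp (- l * s)\<close>, so the quotient is at most
  \<open>(1 + y) * exp (c * s)\<close>, uniformly in \<open>l\<close>.\<close>

lemma hold_tail_inequality:
  fixes l c s :: real
  assumes "0 < c" "2 * c \<le> l" "0 \<le> s" "s \<le> 1"
  shows "1 - exp (- l * s) \<le> (exp (- c * s) - exp (- l * s)) * (2 * exp c)"
proof -
  define y where "y = exp (- (l - c) * s)"
  have "- (l - c) * s \<le> 0" using assms by (simp add: mult_nonpos_nonneg)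
  then have y: "0 < y" "y \<le> 1" by (simp_all add: y_def)
  have "2 * (- (l - c)) * s \<le> - l * s" using assms by (intro mult_right_mono) auto
  then have "y\<^sup>2 \<le> exp (- l * s)"
    unfolding y_def power2_eq_square exp_add[symmetric] by (simp add: algebra_simps)
  then have "1 - exp (- l * s) \<le> (1 - y) * (1 + y)" by (simp add: power2_eq_square algebra_simps)
  also have "\<dots> \<le> (1 - y) * 2" using y by (intro mult_left_mono) auto
  also have "\<dots> \<le> (exp (- c * s) * exp c) * ((1 - y) * 2)"
  proof -
    have "1 \<le> exp (- c * s + c)" using assms by (simp add: mult_left_le)
    then have "1 * ((1 - y) * 2) \<le> exp (- c * s + c) * ((1 - y) * 2)" using y by (intro mult_right_mono) auto
    then show ?thesis unfolding exp_add by simp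
  qed
  also have "\<dots> = (exp (- c * s) - exp (- c * s) * y) * (2 * exp c)" by (simp add: algebra_simps)
  also have "exp (- c * s) * y = exp (- l * s)" unfolding y_def exp_add[symmetric] by (simp add: algebra_simps)
  finally show ?thesis .
qed

context sturm_control
begin

text \<open>Parseval reduces the estimate to the coefficients: the first \<open>m\<close> are
  controlled by the sampled system, each of the others by a bound that reproduces itself from one
  sampling time to the next.\<close>

theorem exponential_decay:
  assumes hw: "hurwitz (closed_loop_matrix m lam gam k)" and m: "m \<ge> 1"
  shows "\<exists>G c T. G > 0 \<and> c > 0 \<and> T > 0 \<and> (\<forall>\<tau>. strict_mono \<tau> \<longrightarrow> \<tau> 0 = 0 \<longrightarrow> (\<forall>i. \<tau> (Suc i) - \<tau> i \<le> T) \<longrightarrow>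
    filterlim \<tau> at_top sequentially \<longrightarrow> (\<forall>x0\<in>L2 r. \<forall>t\<ge>0. nrm (sol \<tau> x0 t) \<le> G * exp (- c * t) * nrm x0))"
proof (rule sampled_data_decay[OF hw m])
  fix C0 c0 T0 :: real
  assume C0: "C0 > 0" "c0 > 0" "T0 > 0"
    and decay: "\<And>(\<tau> :: nat \<Rightarrow> real) X. strict_mono \<tau> \<Longrightarrow> \<tau> 0 = 0 \<Longrightarrow> (\<And>i. \<tau> (Suc i) - \<tau> i \<le> T0) \<Longrightarrow>
      (\<And>i n. 1 \<le> n \<Longrightarrow> n \<le> m \<Longrightarrow> X (Suc i) n = exp (- lam n * (\<tau> (Suc i) - \<tau> i)) * X i n
          + gam n * eta (lam n) (\<tau> (Suc i) - \<tau> i) * (\<Sum>l=1..m. k l * X i l)) \<Longrightarrow>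
      (\<And>i n. 1 \<le> n \<Longrightarrow> n \<le> m \<Longrightarrow> \<bar>X i n\<bar> \<le> C0 * exp (- c0 * \<tau> i) * (\<Sum>l=1..m. \<bar>X 0 l\<bar>))"
  \<comment> \<open>Half of \<open>lam (Suc m)\<close> ensures \<open>2 * c \<le> lam n\<close> for
    all \<open>n > m\<close>, as \<open>hold_tail_inequality\<close> requires.\<close>
  define c where "c = min c0 (lam (Suc m) / 2)"
  have c: "c > 0" "c \<le> c0" "2 * c \<le> lam (Suc m)" using C0 lam_pos by (auto simp: c_def)
  \<comment> \<open>The cap 1 bounds the time elapsed within a cell, so that all constants below are
    uniform.\<close>
  define T where "T = min T0 1"
  \<comment> \<open>\<open>Z\<close> bounds the first \<open>m\<close> coefficients at the sampling
    times and \<open>U\<close> the input, both relative to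
    \<open>exp (- c * \<tau> i) * nrm x0\<close>. \<open>K1\<close> is \<open>U\<close> times the
    factor of \<open>hold_tail_inequality\<close>; \<open>A n\<close> covers mode
    \<open>n \<le> m\<close> between samples.\<close>
  define Z where "Z = C0 * real m"
  define U where "U = (\<Sum>l=1..m. \<bar>k l\<bar>) * Z"
  define K1 where "K1 = 2 * exp c * U"
  define A where "A n = (if n \<le> m then exp \<bar>lam n\<bar> * (Z + \<bar>gam n\<bar> * U) * exp c else 0)" for n
  define SA where "SA = (\<Sum>i<m. (A (Suc i))\<^sup>2)"
  have Z: "Z \<ge> 0" using C0 by (simp add: Z_def)
  have U: "U \<ge> 0" unfolding U_def using Z by (intro mult_nonneg_nonneg sum_nonneg) auto
  have K1: "K1 \<ge> 0" using U by (simp add: K1_def)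
  \<comment> \<open>The squared bounds summed over all modes: \<open>SA\<close> from the first
    modes, 2 from the initial coefficients, the last term from the coefficients of \<open>B\<close>.
    The factors 2 stem from \<open>(x + y)^2 \<le> 2 x^2 + 2 y^2\<close>.\<close>
  define G where "G = sqrt (SA + 2 + 2 * K1\<^sup>2 * (nrm B)\<^sup>2)"
  have SA: "SA \<ge> 0" unfolding SA_def by (intro sum_nonneg) auto
  have Gsq: "SA + 2 + 2 * K1\<^sup>2 * (nrm B)\<^sup>2 > 0"
    using SA mult_nonneg_nonneg[OF zero_le_power2[of K1] zero_le_power2[of "nrm B"]] by linarith
  show ?thesis
  proof (rule exI[of _ G], rule exI[of _ c], rule exI[of _ T], intro conjI allI impI ballI)
    show "G > 0" "c > 0" "T > 0" using Gsq c C0 by (auto simp: G_def T_def)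
    fix \<tau> :: "nat \<Rightarrow> real" and x0 and t :: real
    assume \<tau>: "strict_mono \<tau>" "\<tau> 0 = 0" "\<forall>i. \<tau> (Suc i) - \<tau> i \<le> T" "filterlim \<tau> at_top sequentially"
      and x0: "x0 \<in> L2 r" and t: "t \<ge> 0"
    interpret closed_loop r p q a1 a2 b1 b2 lam phi m k \<tau>
      by (intro closed_loop.intro sturm_control_axioms sampling.intro \<tau>)
    define N where "N = nrm x0"
    have N: "N \<ge> 0" by (simp add: N_def nrm_nonneg)
    define X where "X i n = ip (node \<tau> x0 i) (phi n)" for i n
    have nL: "node \<tau> x0 i \<in> L2 r" for i by (rule node_L2[OF x0])
    have fb: "feedback (node \<tau> x0 i) = (\<Sum>l=1..m. k l * X i l)" for i by (simp add: feedback_def X_def)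
    have rec: "ip (flow (node \<tau> x0 i) s) (phi n) = exp (- lam n * s) * X i n + gam n * eta (lam n) s * feedback (node \<tau> x0 i)"
      if "s \<ge> 0" "n \<ge> 1" for i s n
      using flow_coeff[OF nL that] by (simp add: X_def)
    have X_bound: "\<bar>X i n\<bar> \<le> Z * exp (- c * \<tau> i) * N" if n: "1 \<le> n" "n \<le> m" for i n
    proof -
      have "\<bar>X i n\<bar> \<le> C0 * exp (- c0 * \<tau> i) * (\<Sum>l=1..m. \<bar>X 0 l\<bar>)"
      proof (rule decay[OF \<tau>(1,2) _ _ n])
        show "\<tau> (Suc i) - \<tau> i \<le> T0" for i using \<tau>(3)[rule_format, of i] by (simp add: T_def)
        show "X (Suc i) n = exp (- lam n * (\<tau> (Suc i) - \<tau> i)) * X i n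
          + gam n * eta (lam n) (\<tau> (Suc i) - \<tau> i) * (\<Sum>l=1..m. k l * X i l)" if "1 \<le> n" for i n
          using rec[of "\<tau> (Suc i) - \<tau> i" n i] that tau_less[of i "Suc i"] unfolding fb by (simp add: X_def)
      qed
      also have "\<dots> \<le> C0 * exp (- c * \<tau> i) * (\<Sum>l=1..m. N)"
      proof (intro mult_mono sum_mono)
        show "exp (- c0 * \<tau> i) \<le> exp (- c * \<tau> i)" using c tau_nonneg[of i] by (simp add: mult_right_mono)
        show "\<bar>X 0 l\<bar> \<le> N" if "l \<in> {1..m}" for l using coeff_le[OF x0, of l] that by (simp add: X_def N_def)
      qed (use C0 in \<open>auto intro: sum_nonneg\<close>)
      finally show ?thesis by (simp add: Z_def mult_ac)
    qed
    have u_bound: "\<bar>feedback (node \<tau> x0 i)\<bar> \<le> U * exp (- c * \<tau> i) * N" for i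
    proof -
      have "\<bar>feedback (node \<tau> x0 i)\<bar> \<le> (\<Sum>l=1..m. \<bar>k l\<bar> * (Z * exp (- c * \<tau> i) * N))"
        unfolding fb by (intro order_trans[OF sum_abs] sum_mono) (use X_bound in \<open>auto simp: abs_mult intro!: mult_left_mono\<close>)
      then show ?thesis by (simp only: U_def sum_distrib_right mult.assoc)
    qed
    have head: "\<bar>ip (flow (node \<tau> x0 i) s) (phi n)\<bar> \<le> A n * exp (- c * (\<tau> i + s)) * N"
      if n: "1 \<le> n" "n \<le> m" and s: "0 \<le> s" "s \<le> 1" for i s n
    proof -
      have "- lam n * s \<le> \<bar>lam n\<bar> * 1"
        using s by (intro order_trans[OF mult_right_mono[of "- lam n" "\<bar>lam n\<bar>"] mult_left_mono]) auto
      then have 1: "exp (- lam n * s) \<le> exp \<bar>lam n\<bar>" by simp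
      have "exp \<bar>lam n\<bar> * s \<le> exp \<bar>lam n\<bar>" using s by simp
      then have 2: "\<bar>eta (lam n) s\<bar> \<le> exp \<bar>lam n\<bar>" using eta_first_order(1)[OF s, of "lam n"] by linarith
      have "\<bar>ip (flow (node \<tau> x0 i) s) (phi n)\<bar> \<le> \<bar>exp (- lam n * s) * X i n\<bar> + \<bar>gam n * eta (lam n) s * feedback (node \<tau> x0 i)\<bar>"
        unfolding rec[OF s(1) n(1)] by (rule abs_triangle_ineq)
      also have "\<dots> \<le> exp \<bar>lam n\<bar> * (Z * exp (- c * \<tau> i) * N) + \<bar>gam n\<bar> * exp \<bar>lam n\<bar> * (U * exp (- c * \<tau> i) * N)"
        unfolding abs_mult abs_exp_cancel using 1 2 X_bound[OF n] u_bound[of i]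
        by (intro add_mono mult_mono mult_nonneg_nonneg) auto
      also have "\<dots> = exp \<bar>lam n\<bar> * (Z + \<bar>gam n\<bar> * U) * exp (- c * \<tau> i) * N" by (simp add: algebra_simps)
      also have "\<dots> \<le> exp \<bar>lam n\<bar> * (Z + \<bar>gam n\<bar> * U) * (exp c * exp (- c * (\<tau> i + s))) * N"
      proof (intro mult_right_mono mult_left_mono)
        show "exp (- c * \<tau> i) \<le> exp c * exp (- c * (\<tau> i + s))"
          unfolding exp_add[symmetric] using c s by (simp add: algebra_simps mult_left_le)
      qed (use Z U N in \<open>auto intro!: mult_nonneg_nonneg add_nonneg_nonneg\<close>)
      finally show ?thesis using n by (simp add: A_def mult_ac)
    qed
    \<comment> \<open>Chosen so that the bound \<open>exp (- c * \<tau> i) * a n\<close> survives a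
      sampling step: the share \<open>K1 * N * |bc n|\<close> offsets the held input. Both summands
      are square summable in \<open>n\<close>.\<close>
    define a where "a n = \<bar>ip x0 (phi n)\<bar> + K1 * N * \<bar>bc n\<bar>" for n
    have a: "a n \<ge> 0" for n using K1 N by (simp add: a_def)
    have tail_step: "\<bar>ip (flow (node \<tau> x0 i) s) (phi n)\<bar> \<le> exp (- c * (\<tau> i + s)) * a n"
      if n: "n > m" and s: "0 \<le> s" "s \<le> 1" and IH: "\<bar>X i n\<bar> \<le> exp (- c * \<tau> i) * a n" for i s n
    proof -
      have l: "2 * c \<le> lam n" "lam n > 0" using c lam_le[of "Suc m" n] n lam_pos by auto
      have "gam n = lam n * bc n" using lam_bc[of n] n by simp
      then have ge: "gam n * eta (lam n) s = bc n * (1 - exp (- lam n * s))"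
        unfolding exp_eta by simp
      have E: "exp (- lam n * s) \<le> 1" using l s by simp
      have "\<bar>ip (flow (node \<tau> x0 i) s) (phi n)\<bar> \<le> \<bar>exp (- lam n * s) * X i n\<bar> + \<bar>gam n * eta (lam n) s * feedback (node \<tau> x0 i)\<bar>"
        using rec[OF s(1), of n i] n by (simp add: abs_triangle_ineq)
      also have "\<dots> \<le> exp (- lam n * s) * (exp (- c * \<tau> i) * a n) + (\<bar>bc n\<bar> * (1 - exp (- lam n * s))) * (U * exp (- c * \<tau> i) * N)"
        unfolding ge abs_mult abs_exp_cancel using IH u_bound[of i] E
        by (intro add_mono mult_mono mult_nonneg_nonneg) auto
      also have "\<dots> = exp (- c * \<tau> i) * (exp (- lam n * s) * a n + (1 - exp (- lam n * s)) * (U * N * \<bar>bc n\<bar>))"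
        by (simp add: algebra_simps)
      also have "\<dots> \<le> exp (- c * \<tau> i) * (exp (- c * s) * a n)"
      proof (intro mult_left_mono)
        have "(1 - exp (- lam n * s)) * (U * N * \<bar>bc n\<bar>) \<le> ((exp (- c * s) - exp (- lam n * s)) * (2 * exp c)) * (U * N * \<bar>bc n\<bar>)"
          using hold_tail_inequality[OF c(1) l(1) s] U N by (intro mult_right_mono) auto
        also have "\<dots> = (exp (- c * s) - exp (- lam n * s)) * (K1 * N * \<bar>bc n\<bar>)" by (simp add: K1_def)
        also have "\<dots> \<le> (exp (- c * s) - exp (- lam n * s)) * a n"
        proof (rule mult_left_mono)
          have "c * s \<le> lam n * s" using l c s by (intro mult_right_mono) auto
          then show "0 \<le> exp (- c * s) - exp (- lam n * s)" by simp
        qed (simp add: a_def)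
        finally show "exp (- lam n * s) * a n + (1 - exp (- lam n * s)) * (U * N * \<bar>bc n\<bar>) \<le> exp (- c * s) * a n"
          by (simp add: algebra_simps)
      qed simp
      also have "\<dots> = exp (- c * (\<tau> i + s)) * a n" by (simp add: algebra_simps exp_add[symmetric])
      finally show ?thesis .
    qed
    have X_tail: "\<bar>X i n\<bar> \<le> exp (- c * \<tau> i) * a n" if n: "n > m" for i n
    proof (induction i)
      case 0
      then show ?case using start K1 N by (simp add: X_def a_def)
    next
      case (Suc i)
      have "\<tau> (Suc i) - \<tau> i \<le> 1" "0 \<le> \<tau> (Suc i) - \<tau> i" using \<tau>(3)[rule_format, of i] tau_less[of i "Suc i"] by (auto simp: T_def)
      then show ?case using tail_step[OF n _ _ Suc.IH, of "\<tau> (Suc i) - \<tau> i"] by (simp add: X_def)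
    qed
    obtain i where i: "\<tau> i \<le> t" "t < \<tau> (Suc i)" using t by (rule cell)
    define s where "s = t - \<tau> i"
    have s: "0 \<le> s" "s \<le> 1" "\<tau> i + s = t" using i \<tau>(3)[rule_format, of i] by (auto simp: s_def T_def)
    have sol: "sol \<tau> x0 t = flow (node \<tau> x0 i) s" unfolding s_def using i by (intro sol_cell) auto
    let ?E = "exp (- c * t)"
    \<comment> \<open>A common majorant for both kinds of modes; \<open>A\<close> vanishes beyond
      \<open>m\<close>, so its squares sum to \<open>SA\<close>.\<close>
    define d where "d j = (A (Suc j))\<^sup>2 * N\<^sup>2 + 2 * (ip x0 (phi (Suc j)))\<^sup>2 + 2 * K1\<^sup>2 * N\<^sup>2 * (bc (Suc j))\<^sup>2" for j
    have coeff: "(ip (sol \<tau> x0 t) (phi (Suc j)))\<^sup>2 \<le> ?E\<^sup>2 * d j" for j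
    proof (cases "j < m")
      case True
      have "\<bar>ip (sol \<tau> x0 t) (phi (Suc j))\<bar>\<^sup>2 \<le> (A (Suc j) * ?E * N)\<^sup>2"
        using head[of "Suc j" s i] True s unfolding sol by (intro power_mono) auto
      also have "\<dots> \<le> ?E\<^sup>2 * d j" by (simp add: d_def power_mult_distrib algebra_simps)
      finally show ?thesis by simp
    next
      case False
      have "\<bar>ip (sol \<tau> x0 t) (phi (Suc j))\<bar>\<^sup>2 \<le> (?E * a (Suc j))\<^sup>2"
        using tail_step[OF _ s(1,2) X_tail, of "Suc j" i] False s(3) unfolding sol by (intro power_mono) auto
      also have "\<dots> = ?E\<^sup>2 * (a (Suc j))\<^sup>2" by (simp add: power_mult_distrib)
      also have "\<dots> \<le> ?E\<^sup>2 * d j"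
      proof (intro mult_left_mono)
        have "(a (Suc j))\<^sup>2 \<le> 2 * (ip x0 (phi (Suc j)))\<^sup>2 + 2 * (K1 * N * \<bar>bc (Suc j)\<bar>)\<^sup>2"
          using sum_squares_bound[of "\<bar>ip x0 (phi (Suc j))\<bar>" "K1 * N * \<bar>bc (Suc j)\<bar>"]
          unfolding a_def power2_sum by simp
        moreover have "(K1 * N * \<bar>bc (Suc j)\<bar>)\<^sup>2 = K1\<^sup>2 * (N\<^sup>2 * (bc (Suc j))\<^sup>2)"
          by (simp add: power_mult_distrib)
        moreover have "0 \<le> (A (Suc j))\<^sup>2 * N\<^sup>2" by simp
        ultimately show "(a (Suc j))\<^sup>2 \<le> d j" unfolding d_def mult.assoc by linarith
      qed simp
      finally show ?thesis by simp
    qed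
    have S1: "(\<lambda>j. (A (Suc j))\<^sup>2) sums SA"
      unfolding SA_def by (rule sums_finite) (auto simp: A_def)
    have "d sums (SA * N\<^sup>2 + 2 * N\<^sup>2 + 2 * K1\<^sup>2 * N\<^sup>2 * (nrm B)\<^sup>2)"
      unfolding d_def bc_def using Parseval[OF x0] Parseval[OF B_L2] S1
      by (intro sums_add sums_mult sums_mult2) (simp_all add: N_def)
    then have "(\<lambda>j. ?E\<^sup>2 * d j) sums (?E\<^sup>2 * (SA * N\<^sup>2 + 2 * N\<^sup>2 + 2 * K1\<^sup>2 * N\<^sup>2 * (nrm B)\<^sup>2))"
      by (rule sums_mult)
    with Parseval[OF sol_L2[OF x0 t]] coeff
    have "(nrm (sol \<tau> x0 t))\<^sup>2 \<le> ?E\<^sup>2 * (SA * N\<^sup>2 + 2 * N\<^sup>2 + 2 * K1\<^sup>2 * N\<^sup>2 * (nrm B)\<^sup>2)"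
      by (intro sums_le[OF _ Parseval[OF sol_L2[OF x0 t]]])
    also have "\<dots> = (G * ?E * N)\<^sup>2"
      using Gsq by (simp add: G_def power_mult_distrib algebra_simps)
    finally have "(nrm (sol \<tau> x0 t))\<^sup>2 \<le> (G * ?E * N)\<^sup>2" .
    then have "nrm (sol \<tau> x0 t) \<le> G * ?E * N"
      by (rule power2_le_imp_le) (use Gsq N in \<open>simp add: G_def\<close>)
    then show "nrm (sol \<tau> x0 t) \<le> G * ?E * nrm x0" unfolding N_def .
  qed
qed

end

theorem theorem3p1:
  fixes p r q :: "real \<Rightarrow> real"
    and a1 a2 b1 b2 :: real
    and lam :: "nat \<Rightarrow> real"
    and phi :: "nat \<Rightarrow> real \<Rightarrow> real"
    and N m :: nat
    and g k :: "nat \<Rightarrow> real"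
  assumes "C1_unit p" and "\<forall>z\<in>{0..1}. 0 < p z"
    and "continuous_on {0..1} r" and "\<forall>z\<in>{0..1}. 0 < r z"
    and "continuous_on {0..1} q"
    and "\<bar>a1\<bar> + \<bar>a2\<bar> > 0" and "\<bar>b1\<bar> + \<bar>b2\<bar> > 0"
    and "SL_eigensystem p r q a1 a2 b1 b2 lam phi"
    and "N > 0" and "lam N > 0"
    and "summable (\<lambda>n. inverse (lam (N + n)) * (SUP z\<in>{0..1}. \<bar>phi (N + n) z\<bar>))"
    and "m \<ge> 1" and "lam (m + 1) > 0"
    and "\<forall>n\<in>{1..m}. g n = p 1 / (a1\<^sup>2 + a2\<^sup>2) * (a2 * phi n 1 - a1 * dz (phi n) 1)"
    and "\<forall>n\<in>{1..m}. g n \<noteq> 0"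
    and "hurwitz (closed_loop_matrix m lam g k)"
  shows "\<exists>G c T. G > 0 \<and> c > 0 \<and> T > 0 \<and>
    (\<forall>\<tau> :: nat \<Rightarrow> real.
      strict_mono \<tau> \<and> (\<forall>i. \<tau> i \<ge> 0) \<and> \<tau> 0 = 0 \<and>
      (\<forall>i. \<tau> (Suc i) - \<tau> i \<le> T) \<and> filterlim \<tau> at_top sequentially \<longrightarrow>
      (\<forall>x0\<in>L2 r. \<exists>x.
         closed_loop_solution p r q a1 a2 b1 b2 phi m k \<tau> x0 x \<and>
         (\<forall>y. closed_loop_solution p r q a1 a2 b1 b2 phi m k \<tau> x0 y \<longrightarrow>
              (\<forall>t\<ge>0. \<forall>z\<in>{0..1}. y t z = x t z)) \<and>
         (\<forall>t\<ge>0. l2_norm r (x t) \<le> G * exp (- c * t) * l2_norm r x0)))"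
proof -
  interpret S: sturm_summable r p q a1 a2 b1 b2 lam phi m
  proof unfold_locales
    show "0 < lam (Suc m)" using assms by simp
    \<comment> \<open>The hypothesis starts its series at \<open>N\<close>; a shift by
      \<open>N' = N - 1\<close> relates it to the series from the first index.\<close>
    obtain N' where N': "N = Suc N'" using \<open>N > 0\<close> by (cases N) auto
    have "(\<lambda>n. inverse (lam (N + n)) * (SUP z\<in>{0..1}. \<bar>phi (N + n) z\<bar>)) =
        (\<lambda>n. (SUP z\<in>{0..1}. \<bar>phi (Suc (n + N')) z\<bar>) / lam (Suc (n + N')))"
      by (auto simp: N' field_simps add.commute)
    with assms(11) show "summable (\<lambda>i. (SUP z\<in>{0..1}. \<bar>phi (Suc i) z\<bar>) / lam (Suc i))"
      using summable_iff_shift[of "\<lambda>i. (SUP z\<in>{0..1}. \<bar>phi (Suc i) z\<bar>) / lam (Suc i)" N'] by simp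
  qed (use assms(1-8) in blast)+
  have g: "g n = S.gam n" if "1 \<le> n" "n \<le> m" for n
    using assms(14) that by (simp add: S.gam_def)
  interpret S: sturm_control r p q a1 a2 b1 b2 lam phi m k
    by unfold_locales (use g assms(15) in force)
  \<comment> \<open>\<open>g\<close> is prescribed only for \<open>1 \<le> n \<le> m\<close>, and
    these are the only entries the matrix reads.\<close>
  have "closed_loop_matrix m lam S.gam k = closed_loop_matrix m lam g k"
    unfolding closed_loop_matrix_def using g by (intro eq_matI) auto
  then obtain G c T where GcT: "G > 0" "c > 0" "T > 0"
    "\<And>\<tau>. strict_mono \<tau> \<Longrightarrow> \<tau> 0 = 0 \<Longrightarrow> (\<forall>i. \<tau> (Suc i) - \<tau> i \<le> T) \<Longrightarrow>
      filterlim \<tau> at_top sequentially \<Longrightarrow> (\<forall>x0\<in>L2 r. \<forall>t\<ge>0. l2_norm r (S.sol \<tau> x0 t) \<le> G * exp (- c * t) * l2_norm r x0)"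
    using S.exponential_decay assms(12,16) by metis
  show ?thesis
  proof (rule exI[of _ G], rule exI[of _ c], rule exI[of _ T], intro conjI allI impI ballI GcT(1-3))
    fix \<tau> :: "nat \<Rightarrow> real" and x0
    assume \<tau>: "strict_mono \<tau> \<and> (\<forall>i. \<tau> i \<ge> 0) \<and> \<tau> 0 = 0 \<and> (\<forall>i. \<tau> (Suc i) - \<tau> i \<le> T) \<and> filterlim \<tau> at_top sequentially"
      and x0: "x0 \<in> L2 r"
    interpret L: closed_loop r p q a1 a2 b1 b2 lam phi m k \<tau>
      by (intro closed_loop.intro S.sturm_control_axioms sampling.intro) (use \<tau> in auto)
    show "\<exists>x. closed_loop_solution p r q a1 a2 b1 b2 phi m k \<tau> x0 x \<and>
         (\<forall>y. closed_loop_solution p r q a1 a2 b1 b2 phi m k \<tau> x0 y \<longrightarrow>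
              (\<forall>t\<ge>0. \<forall>z\<in>{0..1}. y t z = x t z)) \<and>
         (\<forall>t\<ge>0. l2_norm r (x t) \<le> G * exp (- c * t) * l2_norm r x0)"
    proof (intro exI[of _ "S.sol \<tau> x0"] conjI allI impI ballI)
      show sol: "closed_loop_solution p r q a1 a2 b1 b2 phi m k \<tau> x0 (S.sol \<tau> x0)"
        by (rule L.sol_closed_loop[OF x0])
      show "y t z = S.sol \<tau> x0 t z" if "closed_loop_solution p r q a1 a2 b1 b2 phi m k \<tau> x0 y" "0 \<le> t" "z \<in> {0..1}" for y t z
        by (rule L.solution_unique[OF that(1) sol that(2,3)])
      show "l2_norm r (S.sol \<tau> x0 t) \<le> G * exp (- c * t) * l2_norm r x0" if "0 \<le> t" for t
        using GcT(4)[of \<tau>] \<tau> x0 that by blast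
    qed
  qed
qed

end
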